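(* Let $\mathscr{A}\subset\mathscr{B}$ be an inclusion of tracially complete $C^*$-algebras. Let $R,S>0$ and let $I_1,J_1,I_2,J_2$ be index sets. Suppose $a=(a_i)_{i\in I_1}$ and $b=(b_i)_{i\in J_1}$ are $R$-bounded tuples such that $a$ generates $\mathscr{A}$ and $a$ and $b$ jointly generate $\mathscr{B}$. Suppose similarly that $c=(c_i)_{i\in I_2}$ and $d=(d_i)_{i\in J_2}$ are $S$-bounded tuples such that $c$ generates $\mathscr{A}$ and $c$ and $d$ jointly generate $\mathscr{B}$. Then $$h(a:b)=h(c:d).$$ That is, the $1$-bounded entropy $h(\mathscr{A}:\mathscr{B})$ of $\mathscr{A}$ in the presence of $\mathscr{B}$ is independent of the tuples used in its computation.
   Context: A trace means a tracial state. A tracially complete $C^*$-algebra is a pair $(M,\mathscr{T})$ with $M$ a unital $C^*$-algebra and $\mathscr{T}$ a weak-$*$ compact convex set of traces on $M$ such that $\|x\|_{2,\mathscr{T}}=\sup_{\tau\in\mathscr{T}}\tau(x^*x)^{1/2}$ is a norm on $M$ and the operator-norm unit ball of $M$ is complete in the metric induced by $\|\cdot\|_{2,\mathscr{T}}$. An inclusion $\mathscr{A}\subset\mathscr{B}$ of tracially complete $C^*$-algebras means: $(\mathscr{B},\mathscr{T})$ is tracially complete, $\mathscr{A}$ is a unital $C^*$-subalgebra of $\mathscr{B}$, and $\mathscr{A}$ is tracially complete with respect to the set of restrictions $\{\tau|_{\mathscr{A}}:\tau\in\mathscr{T}\}$. A tuple generates a tracially complete $C^*$-algebra if the unital $C^*$-subalgebra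 generated by its entries is $\|\cdot\|_{2,\mathscr{T}}$-dense in it. A tuple $(x_i)_{i}$ is $R$-bounded if $\|x_i\|\le R$ for all $i$. For an index set $I$, $\mathbb{C}^*\langle T_i\mid i\in I\rangle$ is the unital $*$-algebra of noncommutative complex polynomials in free variables $T_i$ and their formal adjoints. For $R>0$, $\Sigma_{R,I}$ is the set of linear functionals $\ell$ on it with $\ell(P^*P)\ge 0$, $\ell(1)=1$, $\ell(PQ)=\ell(QP)$ for all $P,Q$, and $\ell((T_j^*T_j)^k)\le R^{2k}$ for all $k\in\mathbb{N}$, $j\in I$, with the weak-$*$ topology (pointwise convergence on $\mathbb{C}^*\langle T_i\mid i\in I\rangle$). For an $R$-bounded tuple $A\in M_N(\mathbb{C})^I$ let $\ell_A(P)=\frac1N\mathrm{Tr}(P(A))$. For $\mathcal{O}\subset\Sigma_{R,I}$ open, $\Gamma_R^{(N)}(\mathcal{O})=\{A\in M_N(\mathbb{C})^I: \|A_i\|\le R\ \forall i,\ \ell_A\in\mathcal{O}\}$. On $M_N(\mathbb{C})$ let $\|A\|_2=(\frac1N\mathrm{Tr}(A^*A))^{1/2}$. For $\Omega\subset M_N(\mathbb{C})^I$, $F\subset I$ finite and $\epsilon>0$, $K^{\mathrm{orb}}_{F,\epsilon}(\Omega)$ is the minimal cardinality of a subset $\Omega_0\subset\Omega$ such that for each $C\in\Omega$ there are $B\in\Omega_0$ and a unitary $U\in U(N)$ with $\|C_i-UB_iU^*\|_2<\epsilon$ for all $i\in F$. Convention: $\log 0=-\infty$. If $a=(a_i)_{i\in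 I}$ generates $\mathscr{A}$, $a$ together with $b=(b_j)_{j\in J}$ generates $(\mathscr{B},\mathscr{T})$, and both tuples are $R$-bounded, let $L_{(a,b)}\subset\Sigma_{R,I\sqcup J}$ be the set of functionals $P\mapsto\tau(P(a,b))$, $\tau\in\mathscr{T}$ (compact and convex), and define $$h(a:b)=\sup_{F,\epsilon}\ \inf_{\mathcal{O}\supset L_{(a,b)}}\ \limsup_{N\to\infty}\frac{1}{N^2}\log K^{\mathrm{orb}}_{F,\epsilon}\big(\Gamma_R^{(N)}(\mathcal{O})\big),$$ where $F$ ranges over finite subsets of $I$ only, $\epsilon>0$, and $\mathcal{O}$ ranges over weak-$*$ open neighborhoods of $L_{(a,b)}$ in $\Sigma_{R,I\sqcup J}$. The quantity $h(c:d)$ is defined in the same way, with norm cutoff $S$. The common value is denoted $h(\mathscr{A}:\mathscr{B})$. *)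

theory Defs
  imports
    "HOL-Analysis.Analysis"
    "HOL-Library.Poly_Mapping"
    "HOL-Library.Extended_Nat"
    "HOL-Library.Complex_Order"
    "Jordan_Normal_Form.Schur_Decomposition"
begin

section \<open>Unital C*-algebras\<close>

text \<open>
  Unital but not \<^class>\<open>real_normed_algebra_1\<close>: the zero algebra is not excluded.
  In a nonzero instance \<open>norm 1 = 1\<close> follows from the C*-identity.
\<close>

class cstar_algebra = banach + real_normed_algebra + monoid_mult +
  fixes scaleC :: "complex \<Rightarrow> 'a \<Rightarrow> 'a"
    and adj :: "'a \<Rightarrow> 'a"
  assumes scaleC_add_right: "scaleC c (x + y) = scaleC c x + scaleC c y"
    and scaleC_add_left: "scaleC (c + d) x = scaleC c x + scaleC d x"
    and scaleC_scaleC: "scaleC c (scaleC d x) = scaleC (c * d) x"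
    and scaleC_of_real: "scaleC (complex_of_real r) x = scaleR r x"
    and norm_scaleC: "norm (scaleC c x) = cmod c * norm x"
    and mult_scaleC_left: "scaleC c x * y = scaleC c (x * y)"
    and mult_scaleC_right: "x * scaleC c y = scaleC c (x * y)"
    and adj_adj: "adj (adj x) = x"
    and adj_add: "adj (x + y) = adj x + adj y"
    and adj_scaleC: "adj (scaleC c x) = scaleC (cnj c) (adj x)"
    and adj_mult: "adj (x * y) = adj y * adj x"
    and norm_adj_mult: "norm (adj x * x) = (norm x)\<^sup>2"

instantiation complex :: cstar_algebra
begin

definition scaleC_complex :: "complex \<Rightarrow> complex \<Rightarrow> complex" where
  "scaleC_complex c x = c * x"

definition adj_complex :: "complex \<Rightarrow> complex" where
  "adj_complex x = cnj x"

instance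
  by standard
    (auto simp: scaleC_complex_def adj_complex_def algebra_simps scaleR_conv_of_real
      norm_mult power2_eq_square)

end

definition unital_cstar_subalgebra :: "'b::cstar_algebra set \<Rightarrow> bool" where
  "unital_cstar_subalgebra M \<longleftrightarrow>
     1 \<in> M \<and>
     (\<forall>x\<in>M. \<forall>y\<in>M. x + y \<in> M \<and> x * y \<in> M) \<and>
     (\<forall>c. \<forall>x\<in>M. scaleC c x \<in> M) \<and>
     (\<forall>x\<in>M. adj x \<in> M) \<and>
     closed M"


section \<open>Tracially complete C*-algebras\<close>

text \<open>
  A functional on a subalgebra \<open>M\<close> is represented by the function that takes the value
  \<^const>\<open>undefined\<close> outside \<open>M\<close>. The weak-* topology (pointwise convergence on \<open>M\<close>) is then
  the product topology over \<open>M\<close>.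
\<close>

definition tracial_states :: "'b::cstar_algebra set \<Rightarrow> ('b \<Rightarrow> complex) set" where
  "tracial_states M =
     {\<tau> \<in> extensional M.
        (\<forall>x\<in>M. \<forall>y\<in>M. \<tau> (x + y) = \<tau> x + \<tau> y) \<and>
        (\<forall>c. \<forall>x\<in>M. \<tau> (scaleC c x) = c * \<tau> x) \<and>
        (\<forall>x\<in>M. 0 \<le> \<tau> (adj x * x)) \<and>
        \<tau> 1 = 1 \<and>
        (\<forall>x\<in>M. \<forall>y\<in>M. \<tau> (x * y) = \<tau> (y * x))}"

definition convex_functionals :: "'b set \<Rightarrow> ('b \<Rightarrow> complex) set \<Rightarrow> bool" where
  "convex_functionals M T \<longleftrightarrow>
     (\<forall>\<sigma>\<in>T. \<forall>\<tau>\<in>T. \<forall>u\<in>{0..1::real}.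
        (\<lambda>x\<in>M. of_real (1 - u) * \<sigma> x + of_real u * \<tau> x) \<in> T)"

text \<open>The supremum is taken in \<open>[0,\<infinity>)\<close>, so that it is \<open>0\<close> for empty \<open>T\<close>.\<close>

definition norm2 :: "('b::cstar_algebra \<Rightarrow> complex) set \<Rightarrow> 'b \<Rightarrow> real" where
  "norm2 T x = Sup (insert 0 ((\<lambda>\<tau>. sqrt (Re (\<tau> (adj x * x)))) ` T))"

definition is_norm_on :: "'b::cstar_algebra set \<Rightarrow> ('b \<Rightarrow> real) \<Rightarrow> bool" where
  "is_norm_on M p \<longleftrightarrow>
     (\<forall>x\<in>M. 0 \<le> p x \<and> (p x = 0 \<longleftrightarrow> x = 0)) \<and>
     (\<forall>c. \<forall>x\<in>M. p (scaleC c x) = cmod c * p x) \<and>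
     (\<forall>x\<in>M. \<forall>y\<in>M. p (x + y) \<le> p x + p y)"

definition tracially_complete ::
    "'b::cstar_algebra set \<Rightarrow> ('b \<Rightarrow> complex) set \<Rightarrow> bool" where
  "tracially_complete M T \<longleftrightarrow>
     unital_cstar_subalgebra M \<and>
     T \<subseteq> tracial_states M \<and>
     compactin (product_topology (\<lambda>_. euclidean) M) T \<and>
     convex_functionals M T \<and>
     is_norm_on M (norm2 T) \<and>
     Metric_space.mcomplete {x \<in> M. norm x \<le> 1} (\<lambda>x y. norm2 T (x - y))"

abbreviation restrict_functionals ::
    "'b set \<Rightarrow> ('b \<Rightarrow> complex) set \<Rightarrow> ('b \<Rightarrow> complex) set" where
  "restrict_functionals M T \<equiv> (\<lambda>\<tau>. restrict \<tau> M) ` T"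

text \<open>The ambient algebra is the whole type.\<close>

definition tracially_complete_inclusion ::
    "'b::cstar_algebra set \<Rightarrow> ('b \<Rightarrow> complex) set \<Rightarrow> bool" where
  "tracially_complete_inclusion A T \<longleftrightarrow>
     tracially_complete UNIV T \<and>
     unital_cstar_subalgebra A \<and>
     tracially_complete A (restrict_functionals A T)"

definition bounded_tuple :: "real \<Rightarrow> 'i set \<Rightarrow> ('i \<Rightarrow> 'b::cstar_algebra) \<Rightarrow> bool" where
  "bounded_tuple R I x \<longleftrightarrow> (\<forall>i\<in>I. norm (x i) \<le> R)"

definition generates ::
    "'b::cstar_algebra set \<Rightarrow> ('b \<Rightarrow> complex) set \<Rightarrow> 'i set \<Rightarrow> ('i \<Rightarrow> 'b) \<Rightarrow> bool" where
  "generates M T I x \<longleftrightarrow>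
     x ` I \<subseteq> M \<and>
     (\<forall>y\<in>M. \<forall>\<epsilon>>0. \<exists>z \<in> unital_cstar_subalgebra hull (x ` I). norm2 T (y - z) < \<epsilon>)"


section \<open>Noncommutative *-polynomials\<close>

datatype 'i letter = Var 'i | Adj 'i

datatype 'i sword = Word (letters: "'i letter list")

text \<open>
  The free monoid, written additively: finitely supported functions on it with the
  multiplication of \<^type>\<open>poly_mapping\<close> then form the free *-algebra.
\<close>

instantiation sword :: (type) monoid_add
begin

definition zero_sword :: "'a sword" where
  "zero_sword = Word []"

definition plus_sword :: "'a sword \<Rightarrow> 'a sword \<Rightarrow> 'a sword" where
  "plus_sword v w = Word (letters v @ letters w)"

instance
  by standard (auto simp: zero_sword_def plus_sword_def)

end

type_synonym 'i ncpoly = "'i sword \<Rightarrow>\<^sub>0 complex"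

fun letter_adj :: "'i letter \<Rightarrow> 'i letter" where
  "letter_adj (Var i) = Adj i"
| "letter_adj (Adj i) = Var i"

definition sword_adj :: "'i sword \<Rightarrow> 'i sword" where
  "sword_adj w = Word (rev (map letter_adj (letters w)))"

definition ncpoly_adj :: "'i ncpoly \<Rightarrow> 'i ncpoly" where
  "ncpoly_adj P =
     (\<Sum>w\<in>Poly_Mapping.keys P. Poly_Mapping.single (sword_adj w) (cnj (Poly_Mapping.lookup P w)))"

definition ncpoly_var :: "'i \<Rightarrow> 'i ncpoly" where
  "ncpoly_var i = Poly_Mapping.single (Word [Var i]) 1"

definition ncpoly_scale :: "complex \<Rightarrow> 'i ncpoly \<Rightarrow> 'i ncpoly" where
  "ncpoly_scale c P = Poly_Mapping.single 0 c * P"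

definition ncpolys :: "'i set \<Rightarrow> 'i ncpoly set" where
  "ncpolys I = {P. \<forall>w\<in>Poly_Mapping.keys P. set_sword w \<subseteq> I}"

fun letter_eval :: "('i \<Rightarrow> 'b::cstar_algebra) \<Rightarrow> 'i letter \<Rightarrow> 'b" where
  "letter_eval x (Var i) = x i"
| "letter_eval x (Adj i) = adj (x i)"

definition ncpoly_eval :: "('i \<Rightarrow> 'b::cstar_algebra) \<Rightarrow> 'i ncpoly \<Rightarrow> 'b" where
  "ncpoly_eval x P =
     (\<Sum>w\<in>Poly_Mapping.keys P.
        scaleC (Poly_Mapping.lookup P w) (prod_list (map (letter_eval x) (letters w))))"

definition tracial_laws :: "real \<Rightarrow> 'i set \<Rightarrow> ('i ncpoly \<Rightarrow> complex) set" where
  "tracial_laws R I =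
     {\<phi> \<in> extensional (ncpolys I).
        (\<forall>P\<in>ncpolys I. \<forall>Q\<in>ncpolys I. \<phi> (P + Q) = \<phi> P + \<phi> Q) \<and>
        (\<forall>c. \<forall>P\<in>ncpolys I. \<phi> (ncpoly_scale c P) = c * \<phi> P) \<and>
        (\<forall>P\<in>ncpolys I. 0 \<le> \<phi> (ncpoly_adj P * P)) \<and>
        \<phi> 1 = 1 \<and>
        (\<forall>P\<in>ncpolys I. \<forall>Q\<in>ncpolys I. \<phi> (P * Q) = \<phi> (Q * P)) \<and>
        (\<forall>j\<in>I. \<forall>k::nat.
           \<phi> ((ncpoly_adj (ncpoly_var j) * ncpoly_var j) ^ k) \<le> complex_of_real (R ^ (2 * k)))}"

definition law_topology :: "real \<Rightarrow> 'i set \<Rightarrow> ('i ncpoly \<Rightarrow> complex) topology" where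
  "law_topology R I =
     subtopology (product_topology (\<lambda>_. euclidean) (ncpolys I)) (tracial_laws R I)"

definition laws_of ::
    "('b::cstar_algebra \<Rightarrow> complex) set \<Rightarrow> 'i set \<Rightarrow> ('i \<Rightarrow> 'b) \<Rightarrow> ('i ncpoly \<Rightarrow> complex) set" where
  "laws_of T I x = (\<lambda>\<tau>. \<lambda>P\<in>ncpolys I. \<tau> (ncpoly_eval x P)) ` T"


section \<open>Matrix microstates\<close>

definition cvec_norm :: "complex vec \<Rightarrow> real" where
  "cvec_norm v = sqrt (Re (scalar_prod v (conjugate v)))"

definition mat_opnorm :: "complex mat \<Rightarrow> real" where
  "mat_opnorm X =
     (SUP v \<in> {v \<in> carrier_vec (dim_col X). cvec_norm v \<le> 1}. cvec_norm (X *\<^sub>v v))"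

definition normalized_trace :: "nat \<Rightarrow> complex mat \<Rightarrow> complex" where
  "normalized_trace N X = (\<Sum>i<N. X $$ (i, i)) / of_nat N"

definition mat_norm2 :: "nat \<Rightarrow> complex mat \<Rightarrow> real" where
  "mat_norm2 N X = sqrt (Re (normalized_trace N (mat_adjoint X * X)))"

definition unitary_mats :: "nat \<Rightarrow> complex mat set" where
  "unitary_mats N =
     {U \<in> carrier_mat N N. U * mat_adjoint U = 1\<^sub>m N \<and> mat_adjoint U * U = 1\<^sub>m N}"

fun letter_mat :: "('i \<Rightarrow> complex mat) \<Rightarrow> 'i letter \<Rightarrow> complex mat" where
  "letter_mat A (Var i) = A i"
| "letter_mat A (Adj i) = mat_adjoint (A i)"

text \<open>
  The linear combination of words is formed entrywise: the zero of type \<^typ>\<open>complex mat\<close>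
  depends on the dimension, so \<^const>\<open>sum\<close> is not available for matrices.
\<close>

definition ncpoly_mat :: "nat \<Rightarrow> ('i \<Rightarrow> complex mat) \<Rightarrow> 'i ncpoly \<Rightarrow> complex mat" where
  "ncpoly_mat N A P =
     mat N N (\<lambda>(r, s). \<Sum>w\<in>Poly_Mapping.keys P.
       Poly_Mapping.lookup P w * foldr (*) (map (letter_mat A) (letters w)) (1\<^sub>m N) $$ (r, s))"

definition matrix_law ::
    "nat \<Rightarrow> 'i set \<Rightarrow> ('i \<Rightarrow> complex mat) \<Rightarrow> 'i ncpoly \<Rightarrow> complex" where
  "matrix_law N I A = (\<lambda>P\<in>ncpolys I. normalized_trace N (ncpoly_mat N A P))"

definition microstates ::
    "nat \<Rightarrow> real \<Rightarrow> 'i set \<Rightarrow> ('i ncpoly \<Rightarrow> complex) set \<Rightarrow> ('i \<Rightarrow> complex mat) set" where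
  "microstates N R I \<O> =
     {A \<in> I \<rightarrow>\<^sub>E carrier_mat N N. (\<forall>i\<in>I. mat_opnorm (A i) \<le> R) \<and> matrix_law N I A \<in> \<O>}"

definition orbital_cover ::
    "nat \<Rightarrow> 'i set \<Rightarrow> real \<Rightarrow> ('i \<Rightarrow> complex mat) set \<Rightarrow> ('i \<Rightarrow> complex mat) set \<Rightarrow> bool" where
  "orbital_cover N F \<epsilon> \<Omega> \<Omega>\<^sub>0 \<longleftrightarrow>
     \<Omega>\<^sub>0 \<subseteq> \<Omega> \<and>
     (\<forall>C\<in>\<Omega>. \<exists>B\<in>\<Omega>\<^sub>0. \<exists>U\<in>unitary_mats N. \<forall>i\<in>F.
        mat_norm2 N (C i - U * B i * mat_adjoint U) < \<epsilon>)"

text \<open>\<open>\<infinity>\<close> if there is no finite cover.\<close>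

definition orbital_covering_number ::
    "nat \<Rightarrow> 'i set \<Rightarrow> real \<Rightarrow> ('i \<Rightarrow> complex mat) set \<Rightarrow> enat" where
  "orbital_covering_number N F \<epsilon> \<Omega> =
     (INF \<Omega>\<^sub>0 \<in> {\<Omega>\<^sub>0. finite \<Omega>\<^sub>0 \<and> orbital_cover N F \<epsilon> \<Omega> \<Omega>\<^sub>0}. enat (card \<Omega>\<^sub>0))"


section \<open>1-bounded entropy in the presence\<close>

definition log_enat :: "enat \<Rightarrow> ereal" where
  "log_enat k = (case k of enat n \<Rightarrow> if n = 0 then -\<infinity> else ereal (ln (real n)) | \<infinity> \<Rightarrow> \<infinity>)"

text \<open>
  \<open>one_bounded_entropy T R I a J b\<close> is \<open>h(a : b)\<close> with norm cutoff \<open>R\<close>, where \<open>a\<close> and \<open>b\<close> are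
  indexed by \<open>I\<close> and \<open>J\<close>. The joint tuple is indexed by \<open>I <+> J\<close>, but the covering number only
  sees finitely many coordinates in \<open>I\<close>.
\<close>

definition one_bounded_entropy ::
    "('b::cstar_algebra \<Rightarrow> complex) set \<Rightarrow> real \<Rightarrow> 'i set \<Rightarrow> ('i \<Rightarrow> 'b) \<Rightarrow> 'j set \<Rightarrow> ('j \<Rightarrow> 'b) \<Rightarrow> ereal"
  where
  "one_bounded_entropy T R I a J b =
     (SUP (F, \<epsilon>) \<in> {F. finite F \<and> F \<subseteq> I} \<times> {0<..}.
      INF \<O> \<in> {\<O>. openin (law_topology R (I <+> J)) \<O> \<and> laws_of T (I <+> J) (case_sum a b) \<subseteq> \<O>}.
        limsup (\<lambda>N. ereal (1 / (real N)\<^sup>2) *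
          log_enat (orbital_covering_number N (Inl ` F) \<epsilon> (microstates N R (I <+> J) \<O>))))"

end

theory Submission
  imports Defs "HOL-Computational_Algebra.Fundamental_Theorem_Algebra"
begin

text \<open>
  The 1-bounded entropy does not depend on the generators because generating tuples are
  approximate polynomials in each other, and polynomials act on microstates.

  By symmetry it is enough to prove \<open>h(a : b) \<le> h(c : d)\<close> (\<open>one_bounded_entropy_le\<close>). Let finitely many
  coordinates of \<open>a\<close> and an accuracy be given. Since \<open>c\<close> generates an algebra that contains \<open>a\<close>, these
  coordinates are, up to a small error in 2-norm, polynomials \<open>P\<close> in finitely many entries of \<open>c\<close>.
  Since \<open>a\<close> and \<open>b\<close> generate everything, \<open>c\<close> and \<open>d\<close> are approximately polynomials \<open>Q\<close> in \<open>a\<close> and \<open>b\<close>. If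
  the law of a matrix tuple \<open>X\<close> is close to that of \<open>(a, b)\<close> under some trace, then the law of \<open>Q(X)\<close> is
  close to that of \<open>(c, d)\<close>, and \<open>P(Q(X))\<close> is close to the given coordinates of \<open>X\<close>. So \<open>Q\<close> maps
  microstates for \<open>(a, b)\<close> to microstates for \<open>(c, d)\<close>, and an orbital cover of the latter by small balls
  pulls back to one of the former: \<open>P\<close> is Lipschitz in 2-norm on bounded tuples and commutes with
  unitary conjugation (\<open>orbital_covering_number_transport\<close>). Compactness of the set of traces reduces
  closeness of laws to finitely many moments, uniformly over all traces (\<open>law_neighbourhood\<close>).

  The obstacle is the operator norm: approximation in 2-norm does not give \<open>\<parallel>Q(X)\<parallel> \<le> S\<close>, which
  membership in the microstate space requires. It is overcome by truncating \<open>Q\<close> at level \<open>S\<close>. Exact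
  truncation of singular values is the nearest-point projection onto the ball of radius \<open>S\<close>, so it does
  not increase the 2-distance to an element of that ball. It is imitated by a map \<open>x \<mapsto> x p(x\<^sup>* x)\<close> with a
  real polynomial \<open>p\<close> (\<open>cutoff_pair_exists\<close>), for which the bound and, up to a small error, the contraction
  property are inequalities between polynomials on an interval (\<open>bounded_by_cutoff\<close>,
  \<open>cutoff_contraction\<close>). They carry over to operators and matrices because a polynomial that is
  nonnegative on the interval is built from squares, \<open>t\<close> and \<open>K - t\<close> (\<open>interval_positive_nonneg\<close>). Hence one
  polynomial \<open>Q\<close> works for the C*-algebra and for matrices of all sizes (\<open>contractive_approximation\<close>).

  All estimates are made for a positive functional on an abstract star-algebra, with boundedness in
  the GNS representation in place of the operator norm. Traces on the C*-algebra are one instance;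
  vector states and the normalized trace on matrices are others, after lifting matrices to the free
  algebra generated by them.
\<close>

section \<open>Star-algebras and evaluation of noncommutative polynomials\<close>

text \<open>
  A finitely supported function is the finite sum of its monomials, so a property stable under sums
  need only be checked on monomials.
\<close>

lemma poly_mapping_induct [case_names single sum]:
  fixes f :: "'a \<Rightarrow>\<^sub>0 'b::comm_monoid_add"
  assumes single: "\<And>k v. P (Poly_Mapping.single k v)"
    and sum: "\<And>f g. P f \<Longrightarrow> P g \<Longrightarrow> P (f + g)"
  shows "P f"
proof -
  have "P (\<Sum>k\<in>X. Poly_Mapping.single k (Poly_Mapping.lookup f k))" if "finite X" for X
    using that
  proof induction
    case empty
    show ?case using single[of undefined 0] by simp
  qed (auto intro: single sum)
  moreover have "(\<Sum>k\<in>Poly_Mapping.keys f. Poly_Mapping.single k (Poly_Mapping.lookup f k)) = f"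
    by (rule poly_mapping_eqI)
      (auto simp: lookup_sum lookup_single when_def sum.delta in_keys_iff)
  ultimately show ?thesis by (metis finite_keys)
qed

text \<open>
  The estimates are needed in a C*-algebra and in free algebras of noncommutative polynomials, through
  which matrices will be treated; the locale lets them be proved once. It does not demand \<open>0 \<noteq> 1\<close>, since the zero C*-algebra is a legitimate instance.
\<close>

locale star_algebra =
  fixes star :: "'a::{ring,monoid_mult} \<Rightarrow> 'a" and sc :: "complex \<Rightarrow> 'a \<Rightarrow> 'a"
  assumes sc_add_right: "sc c (x + y) = sc c x + sc c y"
    and sc_add_left: "sc (c + d) x = sc c x + sc d x"
    and sc_sc: "sc c (sc d x) = sc (c * d) x"
    and sc_one [simp]: "sc 1 x = x"
    and mult_sc_left: "sc c x * y = sc c (x * y)"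
    and mult_sc_right: "x * sc c y = sc c (x * y)"
    and star_star [simp]: "star (star x) = x"
    and star_add: "star (x + y) = star x + star y"
    and star_sc: "star (sc c x) = sc (cnj c) (star x)"
    and star_mult: "star (x * y) = star y * star x"
begin

lemma sc_zero_left [simp]: "sc 0 x = 0"
  using sc_add_left[of 0 0 x] by simp

lemma sc_zero_right [simp]: "sc c 0 = 0"
  using sc_add_right[of c 0 0] by simp

lemma sc_minus_one: "sc (- 1) x = - x"
  using sc_add_left[of 1 "-1" x] by (simp add: eq_neg_iff_add_eq_0 add.commute)

lemma sc_diff_right: "sc c (x - y) = sc c x - sc c y"
  using sc_add_right[of c "x - y" y] by simp

lemma sc_sum: "sc c (sum f X) = (\<Sum>x\<in>X. sc c (f x))"
  by (induction X rule: infinite_finite_induct) (auto simp: sc_add_right)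

lemma star_zero [simp]: "star 0 = 0"
  using star_add[of 0 0] by simp

lemma star_minus: "star (- x) = - star x"
  using star_sc[of "-1" x] by (simp add: sc_minus_one)

lemma star_diff: "star (x - y) = star x - star y"
  using star_add[of x "- y"] by (simp add: star_minus)

lemma star_one [simp]: "star 1 = 1"
  using star_mult[of "star 1" 1] by simp

lemma star_sum: "star (sum f X) = (\<Sum>x\<in>X. star (f x))"
  by (induction X rule: infinite_finite_induct) (auto simp: star_add)

lemma star_power: "star (x ^ n) = star x ^ n"
  by (induction n) (auto simp: star_mult power_commutes)

text \<open>
  Real polynomials in a single element, by Horner's scheme: the substitute for continuous functional
  calculus throughout.
\<close>

definition rpoly :: "'a \<Rightarrow> real poly \<Rightarrow> 'a" where
  "rpoly z p = fold_coeffs (\<lambda>c y. sc (of_real c) 1 + z * y) p 0"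

lemma rpoly_0 [simp]: "rpoly z 0 = 0"
  by (simp add: rpoly_def)

lemma rpoly_pCons [simp]: "rpoly z (pCons c p) = sc (of_real c) 1 + z * rpoly z p"
  by (cases "p = 0 \<and> c = 0") (auto simp: rpoly_def)

lemma rpoly_1 [simp]: "rpoly z 1 = 1"
  by (simp add: one_pCons)

lemma rpoly_add: "rpoly z (p + q) = rpoly z p + rpoly z q"
  by (induction p q rule: poly_induct2) (auto simp: sc_add_left algebra_simps)

lemma rpoly_smult: "rpoly z (Polynomial.smult c p) = sc (of_real c) (rpoly z p)"
  by (induction p) (auto simp: sc_add_right sc_sc mult_sc_right)

lemma rpoly_minus: "rpoly z (- p) = - rpoly z p"
  using rpoly_smult[of z "-1" p] by (simp add: sc_minus_one)

lemma rpoly_diff: "rpoly z (p - q) = rpoly z p - rpoly z q"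
  using rpoly_add[of z p "- q"] by (simp add: rpoly_minus)

lemma rpoly_mult: "rpoly z (p * q) = rpoly z p * rpoly z q"
  by (induction p) (auto simp: rpoly_add rpoly_smult algebra_simps mult_sc_left)

lemma rpoly_commute: "w * z = z * w \<Longrightarrow> w * rpoly z p = rpoly z p * w"
proof (induction p)
  case (pCons c p)
  have "w * (z * rpoly z p) = z * (rpoly z p * w)"
    using pCons by (metis mult.assoc)
  then show ?case by (simp add: distrib_left distrib_right mult_sc_left mult_sc_right mult.assoc)
qed simp

lemma star_rpoly: "star z = z \<Longrightarrow> star (rpoly z p) = rpoly z p"
  by (induction p) (auto simp: star_add star_sc star_mult rpoly_commute)

text \<open>
  The evaluation \<open>ev x P\<close> agrees with \<open>ncpoly_eval\<close> in a C*-algebra. Taking values in a free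
  algebra it is the substitution of polynomials into a polynomial.
\<close>

definition letter_ev :: "('i \<Rightarrow> 'a) \<Rightarrow> 'i letter \<Rightarrow> 'a" where
  "letter_ev x l = (case l of Var i \<Rightarrow> x i | Adj i \<Rightarrow> star (x i))"

definition word_ev :: "('i \<Rightarrow> 'a) \<Rightarrow> 'i sword \<Rightarrow> 'a" where
  "word_ev x w = prod_list (map (letter_ev x) (letters w))"

definition ev :: "('i \<Rightarrow> 'a) \<Rightarrow> 'i ncpoly \<Rightarrow> 'a" where
  "ev x P = (\<Sum>w\<in>Poly_Mapping.keys P. sc (Poly_Mapping.lookup P w) (word_ev x w))"

lemma word_ev_zero [simp]: "word_ev x 0 = 1"
  by (simp add: word_ev_def zero_sword_def)

lemma word_ev_plus: "word_ev x (v + w) = word_ev x v * word_ev x w"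
  by (simp add: word_ev_def plus_sword_def)

lemma word_ev_adj: "word_ev x (sword_adj w) = star (word_ev x w)"
proof -
  have l: "letter_ev x (letter_adj l) = star (letter_ev x l)" for l
    by (cases l) (auto simp: letter_ev_def)
  have "prod_list (map (letter_ev x) (rev (map letter_adj ls))) = star (prod_list (map (letter_ev x) ls))" for ls
    by (induction ls) (auto simp: star_mult l)
  then show ?thesis by (simp add: word_ev_def sword_adj_def)
qed

lemma ev_add: "ev x (P + Q) = ev x P + ev x Q"
  unfolding ev_def by (rule setsum_keys_plus_distrib) (auto simp: sc_add_left)

lemma ev_single: "ev x (Poly_Mapping.single w c) = sc c (word_ev x w)"
  by (simp add: ev_def)

lemma ev_0 [simp]: "ev x 0 = 0"
  by (simp add: ev_def)

lemma ev_1 [simp]: "ev x 1 = 1"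
  using ev_single[of x 0 1] by simp

lemma ev_var [simp]: "ev x (ncpoly_var i) = x i"
  by (simp add: ev_def ncpoly_var_def word_ev_def letter_ev_def)

lemma ev_mult: "ev x (P * Q) = ev x P * ev x Q"
proof (induction P rule: poly_mapping_induct)
  case (single v c)
  show ?case
  proof (induction Q rule: poly_mapping_induct)
    case (single w d)
    show ?case
      by (simp add: mult_single ev_single word_ev_plus mult_sc_left mult_sc_right sc_sc mult.commute)
  qed (auto simp: distrib_left ev_add)
qed (auto simp: distrib_right ev_add)

lemma ev_scale: "ev x (ncpoly_scale c P) = sc c (ev x P)"
  by (simp add: ncpoly_scale_def ev_mult ev_single mult_sc_left)

lemma ev_sum: "ev x (sum f X) = (\<Sum>i\<in>X. ev x (f i))"
  by (induction X rule: infinite_finite_induct) (auto simp: ev_add)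

lemma ev_adj: "ev x (ncpoly_adj P) = star (ev x P)"
  unfolding ncpoly_adj_def ev_sum ev_single word_ev_adj by (simp add: star_sum star_sc ev_def)

lemma ev_minus: "ev x (- P) = - ev x P"
  using ev_add[of x P "- P"] by (simp add: eq_neg_iff_add_eq_0 add.commute)

lemma ev_diff: "ev x (P - Q) = ev x P - ev x Q"
  using ev_add[of x P "- Q"] by (simp add: ev_minus)

lemma ev_power: "ev x (P ^ n) = ev x P ^ n"
  by (induction n) (auto simp: ev_mult)

end

lemma letter_adj_letter_adj [simp]: "letter_adj (letter_adj l) = l"
  by (cases l) auto

lemma sword_adj_sword_adj [simp]: "sword_adj (sword_adj w) = w"
  by (simp add: sword_adj_def rev_map comp_def)

lemma sword_adj_plus: "sword_adj (v + w) = sword_adj w + sword_adj v"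
  by (simp add: sword_adj_def plus_sword_def)

lemma ncpoly_adj_add: "ncpoly_adj (P + Q) = ncpoly_adj P + ncpoly_adj Q"
  unfolding ncpoly_adj_def by (rule setsum_keys_plus_distrib) (auto simp: single_add)

lemma ncpoly_adj_single [simp]:
  "ncpoly_adj (Poly_Mapping.single w c) = Poly_Mapping.single (sword_adj w) (cnj c)"
  by (simp add: ncpoly_adj_def)

lemma ncpoly_adj_adj: "ncpoly_adj (ncpoly_adj P) = P"
  by (induction P rule: poly_mapping_induct) (auto simp: ncpoly_adj_add)

lemma ncpoly_adj_mult: "ncpoly_adj (P * Q) = ncpoly_adj Q * ncpoly_adj P"
proof (induction P rule: poly_mapping_induct)
  case (single v c)
  show ?case
    by (induction Q rule: poly_mapping_induct)
      (auto simp: mult_single sword_adj_plus distrib_left distrib_right ncpoly_adj_add mult.commute)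
qed (auto simp: distrib_left distrib_right ncpoly_adj_add)

text \<open>
  Scalars are polynomials supported at the empty word; they are central although the free monoid is
  not commutative.
\<close>

lemma scale_single_commute: "P * Poly_Mapping.single 0 c = Poly_Mapping.single 0 c * (P :: 'i ncpoly)"
  by (induction P rule: poly_mapping_induct) (auto simp: mult_single distrib_left distrib_right mult.commute)

global_interpretation free: star_algebra "ncpoly_adj :: 'i ncpoly \<Rightarrow> 'i ncpoly" ncpoly_scale
proof
  show "ncpoly_adj (ncpoly_scale c x) = ncpoly_scale (cnj c) (ncpoly_adj x)" for c and x :: "'i ncpoly"
    using scale_single_commute[of "ncpoly_adj x" "cnj c"]
    by (simp add: ncpoly_scale_def ncpoly_adj_mult sword_adj_def zero_sword_def)
  show "x * ncpoly_scale c y = ncpoly_scale c (x * y)" for c and x y :: "'i ncpoly"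
    unfolding ncpoly_scale_def by (metis mult.assoc scale_single_commute)
qed (auto simp: ncpoly_scale_def distrib_left distrib_right single_add mult_single
    ncpoly_adj_adj ncpoly_adj_add ncpoly_adj_mult mult.assoc[symmetric])

lemma ncpolys_add: "P \<in> ncpolys I \<Longrightarrow> Q \<in> ncpolys I \<Longrightarrow> P + Q \<in> ncpolys I"
  using Poly_Mapping.keys_add[of P Q] by (fastforce simp: ncpolys_def)

lemma ncpolys_0 [simp]: "0 \<in> ncpolys I"
  by (simp add: ncpolys_def)

lemma ncpolys_single [simp]: "set_sword w \<subseteq> I \<Longrightarrow> Poly_Mapping.single w c \<in> ncpolys I"
  by (auto simp: ncpolys_def split: if_splits)

lemma set_sword_zero [simp]: "set_sword 0 = {}"
  by (simp add: zero_sword_def)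

lemma set_sword_plus [simp]: "set_sword (v + w) = set_sword v \<union> set_sword w"
  by (cases v; cases w) (simp add: plus_sword_def)

lemma set_sword_adj [simp]: "set_sword (sword_adj w) = set_sword w"
proof -
  have "set_letter (letter_adj l) = set_letter l" for l :: "'a letter" by (cases l) auto
  then show ?thesis by (cases w) (simp add: sword_adj_def)
qed

lemma set_sword_letters: "set_sword w = (\<Union>a\<in>set (letters w). set_letter a)"
  by (cases w) simp

lemma ncpolys_1 [simp]: "1 \<in> ncpolys I"
  using ncpolys_single[of 0 I 1] by simp

lemma ncpolys_mult: "P \<in> ncpolys I \<Longrightarrow> Q \<in> ncpolys I \<Longrightarrow> P * Q \<in> ncpolys I"
  using Poly_Mapping.keys_mult[of P Q] unfolding ncpolys_def by fastforce

lemma ncpolys_scale: "P \<in> ncpolys I \<Longrightarrow> ncpoly_scale c P \<in> ncpolys I"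
  by (simp add: ncpoly_scale_def ncpolys_mult)

lemma ncpolys_uminus: "P \<in> ncpolys I \<Longrightarrow> - P \<in> ncpolys I"
  by (simp add: ncpolys_def)

lemma ncpolys_diff: "P \<in> ncpolys I \<Longrightarrow> Q \<in> ncpolys I \<Longrightarrow> P - Q \<in> ncpolys I"
  using ncpolys_add[of P I "- Q"] by (simp add: ncpolys_uminus)

lemma ncpolys_sum: "(\<And>x. x \<in> X \<Longrightarrow> f x \<in> ncpolys I) \<Longrightarrow> sum f X \<in> ncpolys I"
  by (induction X rule: infinite_finite_induct) (auto simp: ncpolys_add)

lemma ncpolys_adj: "P \<in> ncpolys I \<Longrightarrow> ncpoly_adj P \<in> ncpolys I"
  unfolding ncpoly_adj_def by (rule ncpolys_sum) (auto simp: ncpolys_def)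

lemma ncpolys_power: "P \<in> ncpolys I \<Longrightarrow> P ^ n \<in> ncpolys I"
  by (induction n) (auto simp: ncpolys_mult)

lemma ncpolys_var [simp]: "i \<in> I \<Longrightarrow> ncpoly_var i \<in> ncpolys I"
  by (simp add: ncpoly_var_def)

lemma ncpolys_mono: "I \<subseteq> J \<Longrightarrow> ncpolys I \<subseteq> ncpolys J"
  by (auto simp: ncpolys_def)

lemma ncpolys_finite_vars:
  assumes "P \<in> ncpolys I"
  obtains G where "finite G" "G \<subseteq> I" "P \<in> ncpolys G"
proof
  let ?G = "\<Union>w\<in>Poly_Mapping.keys P. set_sword w"
  have "finite (set_letter a)" for a :: "'a letter" by (cases a) auto
  then have "finite (set_sword w)" for w :: "'a sword" by (cases w) auto
  then show "finite ?G" by auto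
  show "?G \<subseteq> I" "P \<in> ncpolys ?G" using assms by (auto simp: ncpolys_def)
qed

lemma ncpolys_rpoly: "P \<in> ncpolys I \<Longrightarrow> free.rpoly P p \<in> ncpolys I"
  by (induction p) (auto intro!: ncpolys_add ncpolys_mult ncpolys_scale)

lemma ncpolys_ev:
  assumes "P \<in> ncpolys I" "\<And>i. i \<in> I \<Longrightarrow> Q i \<in> ncpolys J"
  shows "free.ev Q P \<in> ncpolys J"
proof -
  have l: "free.letter_ev Q l \<in> ncpolys J" if "set_letter l \<subseteq> I" for l
    using that assms(2) by (cases l) (auto simp: free.letter_ev_def ncpolys_adj)
  have "prod_list (map (free.letter_ev Q) ls) \<in> ncpolys J" if "(\<Union>l\<in>set ls. set_letter l) \<subseteq> I" for ls
    using that by (induction ls) (auto simp: l ncpolys_mult)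
  then have "free.word_ev Q w \<in> ncpolys J" if "set_sword w \<subseteq> I" for w
    using that by (cases w) (auto simp: free.word_ev_def)
  then show ?thesis
    using assms(1) unfolding free.ev_def by (intro ncpolys_sum ncpolys_scale) (auto simp: ncpolys_def)
qed

context star_algebra
begin

lemma ev_rpoly: "ev x (free.rpoly P p) = rpoly (ev x P) p"
  by (induction p) (auto simp: ev_add ev_mult ev_scale)

text \<open>
  Through this identity the same substitution acts on the generators and on matrix tuples.
\<close>

lemma ev_ev: "ev x (free.ev Q P) = ev (\<lambda>i. ev x (Q i)) P"
proof -
  have l: "ev x (free.letter_ev Q l) = letter_ev (\<lambda>i. ev x (Q i)) l" for l
    by (cases l) (auto simp: free.letter_ev_def letter_ev_def ev_adj)
  have "ev x (prod_list (map (free.letter_ev Q) ls)) = prod_list (map (letter_ev (\<lambda>i. ev x (Q i))) ls)" for ls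
    by (induction ls) (auto simp: l ev_mult)
  then have "ev x (free.word_ev Q w) = word_ev (\<lambda>i. ev x (Q i)) w" for w
    by (simp add: free.word_ev_def word_ev_def)
  then show ?thesis unfolding free.ev_def ev_def[of _ P] by (simp add: ev_sum ev_scale)
qed

end

section \<open>Polynomials that are nonnegative on an interval\<close>

text \<open>
  If \<open>z = x\<^sup>* x\<close> and \<open>x\<close> is bounded by the square root of \<open>K\<close>, then \<open>p \<mapsto> l (w\<^sup>* p(z) w)\<close> has these
  four properties for every positive functional \<open>l\<close>. They are the algebraic content of saying that
  the spectrum of \<open>z\<close> lies in \<open>[0, K]\<close>; the goal is that such a functional is nonnegative on every
  polynomial that is nonnegative on \<open>[0, K]\<close>.
\<close>

definition interval_positive :: "real \<Rightarrow> (real poly \<Rightarrow> real) \<Rightarrow> bool" where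
  "interval_positive K \<phi> \<longleftrightarrow>
     (\<forall>p q. \<phi> (p + q) = \<phi> p + \<phi> q) \<and>
     (\<forall>r. 0 \<le> \<phi> (r * r)) \<and>
     (\<forall>r. 0 \<le> \<phi> ([:0, 1:] * (r * r))) \<and>
     (\<forall>r. 0 \<le> \<phi> ([:K, -1:] * (r * r)))"

lemma interval_positive_const:
  assumes "interval_positive K \<phi>" "0 \<le> c"
  shows "0 \<le> \<phi> ([:c:] * (r * r))"
proof -
  have "[:c:] * (r * r) = ([:sqrt c:] * r) * ([:sqrt c:] * r)"
    using assms(2) by (simp add: smult_smult)
  then show ?thesis using assms(1) unfolding interval_positive_def by metis
qed

text \<open>
  This follows from \<open>K t (K - t) = t\<^sup>2 (K - t) + t (K - t)\<^sup>2\<close>, whose right-hand side consists of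
  squares times \<open>K - t\<close> or \<open>t\<close>.
\<close>

lemma interval_positive_product:
  assumes \<phi>: "interval_positive K \<phi>" and K: "0 < K"
  shows "0 \<le> \<phi> ([:0, 1:] * [:K, -1:] * (r * r))"
proof -
  define u where "u = [:sqrt (1 / K):] * r"
  have uu: "[:K:] * (u * u) = r * r"
  proof -
    have "[:K:] * (u * u) = Polynomial.smult (K * (sqrt (1 / K) * sqrt (1 / K))) (r * r)"
      by (simp add: u_def)
    also have "K * (sqrt (1 / K) * sqrt (1 / K)) = 1"
      using K by (simp add: real_sqrt_mult_self)
    finally show ?thesis by simp
  qed
  have "[:0, 1:] * [:K, -1:] * (r * r) = [:0, 1:] * [:K, -1:] * ([:0, 1:] + [:K, -1:]) * (u * u)"
    unfolding uu[symmetric] by (simp add: algebra_simps)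
  also have "\<dots> = [:K, -1:] * (([:0, 1:] * u) * ([:0, 1:] * u)) + [:0, 1:] * (([:K, -1:] * u) * ([:K, -1:] * u))"
    by (simp only: algebra_simps)
  finally show ?thesis using \<phi> unfolding interval_positive_def
    by (metis add_nonneg_nonneg)
qed

text \<open>
  The three shapes of \<open>f\<close> are the factors that a polynomial nonnegative on \<open>[0, K]\<close> can split off:
  a linear factor for a root to the left of the interval, one for a root to its right, and a sum of
  two squares for a pair of complex roots (or, with \<open>b = 0\<close>, for a double root inside).
\<close>

lemma interval_positive_times:
  assumes \<phi>: "interval_positive K \<phi>" and K: "0 < K"
    and f: "(\<exists>c\<ge>0. f = [:c, 1:]) \<or> (\<exists>c\<ge>0. f = [:K + c, -1:]) \<or> (\<exists>a b. f = [:a, 1:] * [:a, 1:] + [:b:] * [:b:])"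
  shows "interval_positive K (\<lambda>p. \<phi> (f * p))"
proof -
  have add: "\<phi> (p + q) = \<phi> p + \<phi> q" and sq: "0 \<le> \<phi> (r * r)"
    and x: "0 \<le> \<phi> ([:0, 1:] * (r * r))" and y: "0 \<le> \<phi> ([:K, -1:] * (r * r))" for p q r
    using \<phi> unfolding interval_positive_def by auto
  note xy = interval_positive_product[OF \<phi> K]
  have cx: "0 \<le> \<phi> ([:c:] * [:0, 1:] * (r * r))" and cy: "0 \<le> \<phi> ([:c:] * [:K, -1:] * (r * r))"
    if "0 \<le> c" for c r
  proof -
    have *: "[:c:] * p * (r * r) = p * (([:sqrt c:] * r) * ([:sqrt c:] * r))" for p
      using that by (simp add: smult_smult)
    show "0 \<le> \<phi> ([:c:] * [:0, 1:] * (r * r))" "0 \<le> \<phi> ([:c:] * [:K, -1:] * (r * r))"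
      unfolding * by (rule x y)+
  qed
  note c = interval_positive_const[OF \<phi>]
  from f consider (1) c where "0 \<le> c" "f = [:0, 1:] + [:c:]"
    | (2) c where "0 \<le> c" "f = [:K, -1:] + [:c:]"
    | (3) a b where "f = [:a, 1:] * [:a, 1:] + [:b:] * [:b:]"
    by force
  then have "0 \<le> \<phi> (f * (r * r)) \<and> 0 \<le> \<phi> (f * ([:0, 1:] * (r * r))) \<and> 0 \<le> \<phi> (f * ([:K, -1:] * (r * r)))" for r
  proof cases
    case (1 c)
    have "f * (r * r) = [:0, 1:] * (r * r) + [:c:] * (r * r)"
      "f * ([:0, 1:] * (r * r)) = ([:0, 1:] * r) * ([:0, 1:] * r) + [:c:] * [:0, 1:] * (r * r)"
      "f * ([:K, -1:] * (r * r)) = [:0, 1:] * [:K, -1:] * (r * r) + [:c:] * [:K, -1:] * (r * r)"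
      unfolding 1 by (simp_all only: algebra_simps)
    then show ?thesis using add x sq xy cx cy c 1 by (metis add_nonneg_nonneg)
  next
    case (2 c)
    have "f * (r * r) = [:K, -1:] * (r * r) + [:c:] * (r * r)"
      "f * ([:0, 1:] * (r * r)) = [:0, 1:] * [:K, -1:] * (r * r) + [:c:] * [:0, 1:] * (r * r)"
      "f * ([:K, -1:] * (r * r)) = ([:K, -1:] * r) * ([:K, -1:] * r) + [:c:] * [:K, -1:] * (r * r)"
      unfolding 2 by (simp_all only: algebra_simps)
    then show ?thesis using add y sq xy cx cy c 2 by (metis add_nonneg_nonneg)
  next
    case (3 a b)
    have "f * (g * (r * r)) = g * (([:a, 1:] * r) * ([:a, 1:] * r)) + g * (([:b:] * r) * ([:b:] * r))" for g
      unfolding 3 by (simp only: algebra_simps)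
    from this[of 1] this[of "[:0, 1:]"] this[of "[:K, -1:]"]
    show ?thesis using add sq x y by (metis add_nonneg_nonneg mult_1)
  qed
  moreover have "\<phi> (f * (p + q)) = \<phi> (f * p) + \<phi> (f * q)" for p q
    using add by (simp add: distrib_left)
  ultimately show ?thesis unfolding interval_positive_def by blast
qed

text \<open>
  Dividing by a linear factor gives no sign information at its root; continuity supplies it.
\<close>

lemma poly_nonneg_at_exceptional_point:
  fixes q :: "real poly"
  assumes "\<And>t. t \<in> {0..K} \<Longrightarrow> t \<noteq> l \<Longrightarrow> 0 \<le> poly q t" "0 < K" "t \<in> {0..K}"
  shows "0 \<le> poly q t"
proof (rule ccontr)
  assume "\<not> 0 \<le> poly q t"
  then have neg: "poly q t < 0" by simp
  then have tl: "t = l" using assms by force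
  have "poly q \<midarrow>t\<rightarrow> poly q t" using poly_isCont isContD by blast
  then obtain d where d: "d > 0" "\<And>s. s \<noteq> t \<Longrightarrow> \<bar>t - s\<bar> < d \<Longrightarrow> poly q s < 0"
    using LIM_fun_less_zero[OF _ neg, of "poly q" t] by (metis abs_minus_commute)
  define s where "s = (if t < K then min K (t + d / 2) else max 0 (t - d / 2))"
  have "s \<in> {0..K}" "s \<noteq> t" "\<bar>t - s\<bar> < d"
    using d assms(2,3) by (auto simp: s_def min_def max_def)
  with d assms(1)[of s] tl show False by force
qed

text \<open>
  A one-variable Positivstellensatz, by induction on the degree: a root of \<open>s\<close> gives a factor that is
  nonnegative on the interval, and that factor is absorbed into the functional by
  \<open>interval_positive_times\<close>, leaving the quotient of smaller degree.
\<close>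

lemma interval_positive_nonneg:
  assumes "interval_positive K \<phi>" "0 < K" "\<And>t. t \<in> {0..K} \<Longrightarrow> 0 \<le> poly s t"
  shows "0 \<le> \<phi> s"
  using assms(1,3)
proof (induction "degree s" arbitrary: s \<phi> rule: less_induct)
  case less
  note \<phi> = less.prems(1) and s = less.prems(2)
  have step: "0 \<le> \<phi> s" if "s = f * q" "degree q < degree s"
    "(\<exists>c\<ge>0. f = [:c, 1:]) \<or> (\<exists>c\<ge>0. f = [:K + c, -1:]) \<or> (\<exists>a b. f = [:a, 1:] * [:a, 1:] + [:b:] * [:b:])"
    "\<And>t. t \<in> {0..K} \<Longrightarrow> 0 \<le> poly q t" for f q
    using less.hyps[OF that(2) interval_positive_times[OF \<phi> \<open>0 < K\<close> that(3)] that(4)] that(1) by simp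
  show ?case
  proof (cases "degree s = 0")
    case True
    then obtain c where c: "s = [:c:]" by (meson degree_eq_zeroE)
    then have "0 \<le> c" using s[of 0] \<open>0 < K\<close> by simp
    then show ?thesis using interval_positive_const[OF \<phi>, of c 1] c by simp
  next
    case False
    define sC where "sC = map_poly complex_of_real s"
    have "degree sC = degree s" by (simp add: sC_def)
    then have "\<not> constant (poly sC)" using False by (simp add: constant_degree)
    then obtain z where z: "poly sC z = 0"
      using fundamental_theorem_of_algebra by blast
    have s0: "s \<noteq> 0" using False by auto
    show ?thesis
    proof (cases "Im z = 0")
      case True
      define l where "l = Re z"
      have "z = of_real l" using True by (simp add: l_def complex_eq_iff)
      then have "complex_of_real (poly s l) = 0" using z unfolding sC_def by simp
      then have "poly s l = 0" by simp
      then obtain q where q: "s = [:-l, 1:] * q" by (metis dvd_def poly_eq_0_iff_dvd)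
      then have q0: "q \<noteq> 0" using s0 by auto
      have dq: "degree q < degree s"
        unfolding q using q0 by (subst degree_mult_eq) auto
      have sq: "poly s t = (t - l) * poly q t" for t by (simp add: q algebra_simps)
      consider "l \<le> 0" | "l \<ge> K" | "0 < l" "l < K" by linarith
      then show ?thesis
      proof cases
        case 1
        have "0 \<le> poly q t" if "t \<in> {0..K}" for t
        proof (rule poly_nonneg_at_exceptional_point[OF _ \<open>0 < K\<close> that])
          fix t assume "t \<in> {0..K}" "t \<noteq> l"
          then show "0 \<le> poly q t" using s[of t] 1 by (auto simp: sq zero_le_mult_iff)
        qed
        then show ?thesis using step[OF q dq] 1 by force
      next
        case 2
        have "0 \<le> poly (- q) t" if "t \<in> {0..K}" for t
        proof (rule poly_nonneg_at_exceptional_point[OF _ \<open>0 < K\<close> that])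
          fix t assume "t \<in> {0..K}" "t \<noteq> l"
          then show "0 \<le> poly (- q) t" using s[of t] 2 by (auto simp: sq zero_le_mult_iff)
        qed
        moreover have "s = [:K + (l - K), -1:] * (- q)" by (simp add: q)
        moreover have "\<exists>c\<ge>0. [:K + (l - K), -1:] = [:K + c, - 1:]"
          using 2 by (intro exI[of _ "l - K"]) simp
        ultimately show ?thesis using step[of "[:K + (l - K), -1:]" "- q"] dq by simp
      next
        case 3
        \<comment> \<open>The quotient changes sign at the interior root \<open>l\<close>, hence vanishes there: \<open>l\<close> is a double root.\<close>
        have pos: "0 \<le> poly q t" if "l < t" "t \<le> K" for t
          using s[of t] 3 that by (auto simp: sq zero_le_mult_iff)
        have neg: "poly q t \<le> 0" if "0 \<le> t" "t < l" for t
          using s[of t] 3 that by (auto simp: sq zero_le_mult_iff)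
        have "(poly q \<longlongrightarrow> poly q l) (at_right l)" "(poly q \<longlongrightarrow> poly q l) (at_left l)"
          by (auto intro!: tendsto_intros)
        moreover have "\<forall>\<^sub>F t in at_right l. 0 \<le> poly q t"
          unfolding eventually_at_right_field using 3 pos by (intro exI[of _ K]) auto
        moreover have "\<forall>\<^sub>F t in at_left l. poly q t \<le> 0"
          unfolding eventually_at_left_field using 3 neg by (intro exI[of _ 0]) auto
        ultimately have "0 \<le> poly q l" "poly q l \<le> 0"
          by (auto intro: tendsto_lowerbound[where F="at_right l"] tendsto_upperbound[where F="at_left l"])
        then have "poly q l = 0" by simp
        then obtain q2 where q2: "q = [:-l, 1:] * q2" by (metis dvd_def poly_eq_0_iff_dvd)
        have f: "s = ([:-l, 1:] * [:-l, 1:] + [:0:] * [:0:]) * q2"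
          using q unfolding q2 by (simp only: mult.assoc pCons_0_0 mult_zero_left add_0_right)
        have "degree q2 \<le> degree q" unfolding q2 using q0 q2 by (subst degree_mult_eq) auto
        moreover have "0 \<le> poly q2 t" if "t \<in> {0..K}" for t
        proof (rule poly_nonneg_at_exceptional_point[OF _ \<open>0 < K\<close> that])
          fix t assume t: "t \<in> {0..K}" "t \<noteq> l"
          have "poly s t = (t - l)\<^sup>2 * poly q2 t" by (simp add: q q2 power2_eq_square algebra_simps)
          then show "0 \<le> poly q2 t" using s[OF t(1)] t(2)
            by (simp add: zero_le_mult_iff)
        qed
        ultimately show ?thesis using step[OF f] dq by force
      qed
    next
      case False
      \<comment> \<open>The quadratic with roots \<open>z\<close> and \<open>cnj z\<close>; the remainder modulo it is linear and vanishes at \<open>z\<close>.\<close>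
      define a b where "a = - Re z" and "b = Im z"
      define m where "m = [:a, 1:] * [:a, 1:] + [:b:] * [:b:]"
      have m: "m = [:a * a + b * b, 2 * a, 1:]" by (simp add: m_def)
      have dm: "degree m = 2" by (simp add: m)
      define r where "r = s mod m"
      have sm: "s = m * (s div m) + r" by (simp add: r_def)
      have "m \<noteq> 0" using dm by auto
      then have "degree r < 2"
        using degree_mod_less[of m s] dm by (auto simp: r_def)
      then have cr: "coeff r n = 0" if "2 \<le> n" for n
        using that by (intro coeff_eq_0) simp
      have "coeff r n = coeff [:coeff r 0, coeff r 1:] n" for n
      proof -
        consider "n = 0" | "n = 1" | k where "n = Suc (Suc k)"
          by (metis One_nat_def not0_implies_Suc)
        then show ?thesis by cases (simp_all add: cr)
      qed
      then have "r = [:coeff r 0, coeff r 1:]" by (rule poly_eqI)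
      then obtain u v where r: "r = [:u, v:]" by blast
      have "poly (map_poly complex_of_real m) z = 0"
        by (simp add: m a_def b_def complex_eq_iff algebra_simps map_poly_pCons)
      moreover have "sC = map_poly of_real m * map_poly of_real (s div m) + map_poly of_real r"
        unfolding sC_def by (subst sm, rule poly_eqI) (simp add: coeff_map_poly coeff_mult)
      ultimately have "poly (map_poly complex_of_real r) z = 0"
        using z by simp
      moreover have "map_poly complex_of_real r = [:of_real u, of_real v:]"
        unfolding r by (rule poly_eqI) (simp add: coeff_map_poly coeff_pCons split: nat.split)
      ultimately have "complex_of_real u + z * of_real v = 0" by simp
      then have "v = 0 \<and> u = 0" using False by (auto simp: complex_eq_iff)
      then have f: "s = m * (s div m)" using sm r by simp
      have q0: "s div m \<noteq> 0" using f s0 by auto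
      have "degree s = 2 + degree (s div m)" 
        using q0 dm \<open>m \<noteq> 0\<close> by (subst f) (simp add: degree_mult_eq)
      moreover have "0 \<le> poly (s div m) t" if "t \<in> {0..K}" for t
      proof -
        have "poly m t = (t + a)\<^sup>2 + b\<^sup>2"
          by (simp add: m_def power2_eq_square algebra_simps)
        then have "poly m t > 0"
          using False by (simp add: b_def add_nonneg_pos)
        moreover have "poly s t = poly m t * poly (s div m) t" by (subst f) simp
        ultimately show ?thesis using s[OF that] by (simp add: zero_le_mult_iff)
      qed
      ultimately show ?thesis using step[OF f] unfolding m_def by force
    qed
  qed
qed

section \<open>Cutoff polynomials\<close>

lemma polynomial_approximation:
  fixes f :: "real \<Rightarrow> real"
  assumes "continuous_on {0..K} f" "0 < e"
  obtains p :: "real poly" where "\<And>t. t \<in> {0..K} \<Longrightarrow> \<bar>f t - poly p t\<bar> < e"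
proof -
  obtain g where g: "real_polynomial_function g" "\<And>t. t \<in> {0..K} \<Longrightarrow> \<bar>f t - g t\<bar> < e"
    using Stone_Weierstrass_real_polynomial_function[OF compact_Icc assms] by blast
  then obtain a n where "g = (\<lambda>x. \<Sum>i\<le>n. a i * x ^ i)"
    unfolding real_polynomial_function_iff_sum by blast
  then have "g t = poly (\<Sum>i\<le>n. Polynomial.monom (a i) i) t" for t
    by (simp add: poly_sum poly_monom)
  with g(2) that show thesis by metis
qed

text \<open>
  With \<open>p = 1 - u v\<close>, the map \<open>x \<mapsto> x p(x\<^sup>* x)\<close> imitates the truncation of the singular values of \<open>x\<close>
  at level \<open>S\<close>. The first inequality makes its values have norm at most \<open>S\<close>. The second one expresses,
  up to \<open>\<eta>\<close>, that the truncation is the nearest-point projection onto the ball of radius \<open>S\<close>; the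
  factorization \<open>u v\<close> of \<open>1 - p\<close> is there to make a Cauchy-Schwarz estimate sharp.
\<close>

definition cutoff_pair :: "real \<Rightarrow> real \<Rightarrow> real \<Rightarrow> real poly \<Rightarrow> real poly \<Rightarrow> bool" where
  "cutoff_pair S K \<eta> u v \<longleftrightarrow> (\<forall>t\<in>{0..K}.
     t * (1 - poly u t * poly v t)\<^sup>2 \<le> S\<^sup>2 \<and>
     t * (poly v t)\<^sup>2 + S\<^sup>2 * (poly u t)\<^sup>2
       \<le> 2 * t * (1 - poly u t * poly v t) * (poly u t * poly v t) + \<eta>)"

text \<open>
  Let \<open>S\<^sub>0\<close> be slightly smaller than \<open>S\<close> and put \<open>q(t) = 1 - S\<^sub>0 / \<surd>t\<close> for \<open>t \<ge> S\<^sub>0\<^sup>2\<close>, and \<open>0\<close> below. The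
  continuous functions \<open>u\<^sub>0\<close>, \<open>v\<^sub>0\<close> with product \<open>q\<close> are chosen so that \<open>t v\<^sub>0\<^sup>2\<close> and \<open>S\<^sup>2 u\<^sub>0\<^sup>2\<close> are both equal
  to \<open>S \<surd>t q\<close>. Since \<open>\<surd>t (1 - q) = S\<^sub>0\<close> wherever \<open>q\<close> is nonzero, both inequalities hold for them with
  room to spare, and survive approximation by polynomials.
\<close>

lemma cutoff_pair_exists:
  assumes "0 < S" "0 < K" "0 < \<eta>"
  obtains u v where "cutoff_pair S K \<eta> u v"
proof -
  \<comment> \<open>The choice gives \<open>2 \<surd>K (S - S0) \<le> \<eta> / 2\<close>, which is half of the permitted error.\<close>
  define \<theta> where "\<theta> = min (1 / 2) (\<eta> / (4 * S * sqrt K))"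
  define S0 where "S0 = S * (1 - \<theta>)"
  have \<theta>: "0 < \<theta>" "\<theta> \<le> 1 / 2" "\<theta> \<le> \<eta> / (4 * S * sqrt K)"
    using assms by (auto simp: \<theta>_def)
  have S0: "0 < S0" "S0 < S" using \<theta> assms by (auto simp: S0_def)
  have SS0: "2 * sqrt K * (S - S0) \<le> \<eta> / 2"
  proof -
    have "2 * sqrt K * (S - S0) = 2 * sqrt K * S * \<theta>" by (simp add: S0_def algebra_simps)
    also have "\<dots> \<le> 2 * sqrt K * S * (\<eta> / (4 * S * sqrt K))"
      using \<theta>(3) assms by (intro mult_left_mono) auto
    also have "\<dots> = \<eta> / 2" using assms by (simp add: field_simps)
    finally show ?thesis .
  qed
  define m where "m t = max S0 (sqrt t)" for t
  define q where "q t = 1 - S0 / m t" for t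
  define u0 where "u0 t = sqrt (sqrt t * q t / S)" for t
  define v0 where "v0 t = sqrt (S * q t / m t)" for t
  have m: "m t > 0" "S0 \<le> m t" for t using S0 by (auto simp: m_def)
  have q: "0 \<le> q t" "q t \<le> 1" for t using m[of t] S0 by (auto simp: q_def field_simps)
  \<comment> \<open>The maximum in \<open>m\<close> avoids division by zero and matters only where \<open>q\<close> vanishes.\<close>
  have q0: "q t = 0 \<or> m t = sqrt t" for t
    using S0 by (auto simp: q_def m_def max_def)
  have uv: "u0 t * v0 t = q t" if "0 \<le> t" for t
  proof -
    have "u0 t * v0 t = sqrt (sqrt t * q t / S * (S * q t / m t))"
      unfolding u0_def v0_def by (rule real_sqrt_mult[symmetric])
    also have "sqrt t * q t / S * (S * q t / m t) = (q t)\<^sup>2"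
      using q0[of t] m[of t] S0 by (auto simp: power2_eq_square field_simps)
    finally show ?thesis using q by simp
  qed
  have v2: "t * (v0 t)\<^sup>2 = S * sqrt t * q t" if "0 \<le> t" for t
  proof -
    have "(v0 t)\<^sup>2 = S * q t / m t" using q m S0 by (simp add: v0_def less_imp_le)
    then have *: "t * (v0 t)\<^sup>2 = (t / m t) * (S * q t)" by simp
    show ?thesis
    proof (cases "q t = 0")
      case False
      then have "t / m t = sqrt t" using q0[of t] real_div_sqrt[OF that] by auto
      then show ?thesis unfolding * by simp
    qed (simp add: *)
  qed
  have u2: "S\<^sup>2 * (u0 t)\<^sup>2 = S * sqrt t * q t" if "0 \<le> t" for t
    using q S0 that by (simp add: u0_def power2_eq_square)
  have tp: "sqrt t * (1 - q t) \<le> S0" for t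
  proof -
    have "sqrt t * (1 - q t) = S0 * (sqrt t / m t)" by (simp add: q_def)
    also have "\<dots> \<le> S0 * 1" using m[of t] S0 by (intro mult_left_mono) (auto simp: m_def)
    finally show ?thesis by simp
  qed
  have tpq: "t * (1 - q t) * q t = S0 * sqrt t * q t" if "0 \<le> t" for t
  proof -
    have *: "t * (1 - q t) * q t = S0 * (t / m t) * q t" by (simp add: q_def)
    show ?thesis
    proof (cases "q t = 0")
      case False
      then have "t / m t = sqrt t" using q0[of t] real_div_sqrt[OF that] by auto
      then show ?thesis unfolding * by simp
    qed (simp add: *)
  qed
  have cm: "continuous_on {0..K} m"
    unfolding m_def by (intro continuous_intros)
  have cq: "continuous_on {0..K} q"
    unfolding q_def using m(1) by (intro continuous_intros cm) (metis less_irrefl)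
  have cont: "continuous_on {0..K} u0" "continuous_on {0..K} v0"
    unfolding u0_def v0_def using m(1) S0
    by (intro continuous_intros cm cq; simp; metis less_irrefl)+
  have "bounded (u0 ` {0..K} \<union> v0 ` {0..K})"
    using cont by (intro bounded_Un[THEN iffD2] conjI compact_imp_bounded compact_continuous_image compact_Icc)
  then obtain B where "\<forall>x\<in>u0 ` {0..K} \<union> v0 ` {0..K}. \<bar>x\<bar> \<le> B"
    unfolding bounded_real by blast
  then have B: "\<bar>u0 t\<bar> \<le> B" "\<bar>v0 t\<bar> \<le> B" if "t \<in> {0..K}" for t
    using that by blast+
  \<comment> \<open>The two expressions are uniformly continuous where approximants within distance 1 can take values.\<close>
  define C where "C = {0..K} \<times> {-B-1..B+1} \<times> {-B-1..B+1}"
  define f1 where "f1 = (\<lambda>(t, a, b). t * (1 - a * b)\<^sup>2 :: real)"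
  define f2 where "f2 = (\<lambda>(t, a, b). t * b\<^sup>2 + S\<^sup>2 * a\<^sup>2 - 2 * t * (1 - a * b) * (a * b) :: real)"
  have "compact C" unfolding C_def by (intro compact_Times compact_Icc)
  then have uc: "uniformly_continuous_on C f1" "uniformly_continuous_on C f2"
    unfolding f1_def f2_def split_beta
    by (auto intro!: compact_uniformly_continuous continuous_intros)
  have e1: "S\<^sup>2 - S0\<^sup>2 > 0" using S0 by (simp add: power_strict_mono)
  obtain d1 where d1: "d1 > 0" "\<And>x y. x \<in> C \<Longrightarrow> y \<in> C \<Longrightarrow> dist y x < d1 \<Longrightarrow> dist (f1 y) (f1 x) < S\<^sup>2 - S0\<^sup>2"
    using uc(1) e1 unfolding uniformly_continuous_on_def by blast
  obtain d2 where d2: "d2 > 0" "\<And>x y. x \<in> C \<Longrightarrow> y \<in> C \<Longrightarrow> dist y x < d2 \<Longrightarrow> dist (f2 y) (f2 x) < \<eta> / 2"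
    using uc(2) half_gt_zero[OF assms(3)] unfolding uniformly_continuous_on_def by blast
  define e where "e = min 1 (min d1 d2 / 2)"
  have e: "e > 0" "e \<le> 1" "2 * e \<le> d1" "2 * e \<le> d2" using d1 d2 by (auto simp: e_def)
  obtain u where u: "\<And>t. t \<in> {0..K} \<Longrightarrow> \<bar>u0 t - poly u t\<bar> < e"
    using polynomial_approximation[OF cont(1) e(1)] by blast
  obtain v where v: "\<And>t. t \<in> {0..K} \<Longrightarrow> \<bar>v0 t - poly v t\<bar> < e"
    using polynomial_approximation[OF cont(2) e(1)] by blast
  have "t * (1 - poly u t * poly v t)\<^sup>2 \<le> S\<^sup>2 \<and>
     t * (poly v t)\<^sup>2 + S\<^sup>2 * (poly u t)\<^sup>2
       \<le> 2 * t * (1 - poly u t * poly v t) * (poly u t * poly v t) + \<eta>" if t: "t \<in> {0..K}" for t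
  proof -
    let ?x = "(t, poly u t, poly v t)" and ?y = "(t, u0 t, v0 t)"
    have xy: "?x \<in> C" "?y \<in> C" using t B[OF t] u[OF t] v[OF t] e unfolding C_def mem_Times_iff fst_conv snd_conv atLeastAtMost_iff by linarith+
    have "dist ?x ?y \<le> \<bar>u0 t - poly u t\<bar> + \<bar>v0 t - poly v t\<bar>"
      unfolding dist_prod_def dist_real_def
      using sqrt_sum_squares_le_sum_abs[of "u0 t - poly u t" "v0 t - poly v t"]
      by (simp add: dist_real_def abs_minus_commute)
    then have d: "dist ?x ?y < 2 * e" using u[OF t] v[OF t] by linarith
    have "f1 ?y \<le> S0\<^sup>2"
    proof -
      have "f1 ?y = (sqrt t * (1 - q t))\<^sup>2"
        using t by (simp add: f1_def uv power_mult_distrib del: real_sqrt_eq_iff)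
      also have "\<dots> \<le> S0\<^sup>2" using tp[of t] q[of t] t by (intro power_mono) auto
      finally show ?thesis .
    qed
    moreover have "f2 ?y \<le> \<eta> / 2"
    proof -
      have t0: "0 \<le> t" using t by simp
      have "f2 ?y = t * (v0 t)\<^sup>2 + S\<^sup>2 * (u0 t)\<^sup>2 - 2 * (t * (1 - q t) * q t)"
        unfolding f2_def split_beta fst_conv snd_conv uv[OF t0] by (simp only: mult.assoc)
      also have "\<dots> = 2 * (sqrt t * q t) * (S - S0)"
        unfolding v2[OF t0] u2[OF t0] tpq[OF t0] by (simp only: algebra_simps)
      also have "\<dots> \<le> 2 * sqrt K * (S - S0)"
      proof -
        have "sqrt t * q t \<le> sqrt t" using q[of t] t by (intro mult_left_le) auto
        also have "\<dots> \<le> sqrt K" using t by simp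
        finally show ?thesis using S0 by (intro mult_right_mono) auto
      qed
      finally show ?thesis using SS0 by simp
    qed
    moreover have "dist (f1 ?x) (f1 ?y) < S\<^sup>2 - S0\<^sup>2" "dist (f2 ?x) (f2 ?y) < \<eta> / 2"
      using d1(2)[OF xy(2) xy(1)] d2(2)[OF xy(2) xy(1)] d e by linarith+
    ultimately have "f1 ?x \<le> S\<^sup>2" "f2 ?x \<le> \<eta>" unfolding dist_real_def by linarith+
    then show ?thesis by (simp add: f1_def f2_def)
  qed
  then show thesis using that unfolding cutoff_pair_def by blast
qed

section \<open>Positive and tracial functionals\<close>

text \<open>
  Bounds for \<open>P(x)\<close>, and for its variation in \<open>x\<close>, that depend only on \<open>P\<close> and on the bound for the
  entries of \<open>x\<close>. Both must be the same for the C*-algebra and for matrices of every size.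
\<close>

definition ncpoly_bound :: "real \<Rightarrow> 'i ncpoly \<Rightarrow> real" where
  "ncpoly_bound R P = (\<Sum>w\<in>Poly_Mapping.keys P. cmod (Poly_Mapping.lookup P w) * R ^ length (letters w))"

definition Lipschitz_const :: "real \<Rightarrow> 'i ncpoly \<Rightarrow> real" where
  "Lipschitz_const S P = (\<Sum>w\<in>Poly_Mapping.keys P. cmod (Poly_Mapping.lookup P w) *
     (real (length (letters w)) * (max 1 S) ^ length (letters w)))"

lemma Lipschitz_const_nonneg: "0 \<le> Lipschitz_const S P"
  unfolding Lipschitz_const_def by (intro sum_nonneg) auto

locale positive_functional = star_algebra star sc
  for star :: "'a::{ring,monoid_mult} \<Rightarrow> 'a" and sc +
  fixes l :: "'a \<Rightarrow> complex"
  assumes l_add: "l (x + y) = l x + l y"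
    and l_sc: "l (sc c x) = c * l x"
    and l_pos: "0 \<le> l (star x * x)"
begin

lemma l_zero [simp]: "l 0 = 0"
  using l_add[of 0 0] by simp

lemma l_minus: "l (- x) = - l x"
  using l_sc[of "-1" x] by (simp add: sc_minus_one)

lemma l_diff: "l (x - y) = l x - l y"
  using l_add[of x "- y"] by (simp add: l_minus)

lemma Im_pos: "Im (l (star x * x)) = 0" and Re_pos: "0 \<le> Re (l (star x * x))"
  using l_pos[of x] by (auto simp: less_eq_complex_def)

text \<open>
  The values at \<open>(1 + y)\<^sup>* (1 + y)\<close> are real; applying this to \<open>y = x\<close> and \<open>y = i x\<close> compares imaginary and
  real parts.
\<close>

lemma l_star: "l (star x) = cnj (l x)"
proof -
  have *: "Im (l y + l (star y)) = 0" for y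
  proof -
    have "l (star (1 + y) * (1 + y)) = l (star 1 * 1) + (l y + l (star y)) + l (star y * y)"
      by (simp add: star_add distrib_left distrib_right l_add)
    then show ?thesis using Im_pos[of "1 + y"] Im_pos[of 1] Im_pos[of y] by simp
  qed
  from *[of x] *[of "sc \<i> x"] show ?thesis
    by (simp add: star_sc l_sc complex_eq_iff)
qed

text \<open>
  The GNS seminorm, which is the 2-norm when \<open>l\<close> is a trace.
\<close>

definition seminorm :: "'a \<Rightarrow> real" where
  "seminorm x = sqrt (Re (l (star x * x)))"

lemma seminorm_nonneg [simp]: "0 \<le> seminorm x"
  using Re_pos by (simp add: seminorm_def)

lemma seminorm_sq: "(seminorm x)\<^sup>2 = Re (l (star x * x))"
  using Re_pos by (simp add: seminorm_def)

lemma seminorm_zero [simp]: "seminorm 0 = 0"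
  by (simp add: seminorm_def)

lemma seminorm_sc: "seminorm (sc c x) = cmod c * seminorm x"
proof -
  have "l (star (sc c x) * sc c x) = (c * cnj c) * l (star x * x)"
    by (simp add: star_sc mult_sc_left mult_sc_right sc_sc l_sc mult.commute)
  also have "c * cnj c = of_real ((cmod c)\<^sup>2)" by (simp add: complex_norm_square del: of_real_power)
  finally have "Re (l (star (sc c x) * sc c x)) = (cmod c)\<^sup>2 * Re (l (star x * x))"
    by (simp flip: of_real_power)
  then show ?thesis by (simp add: seminorm_def real_sqrt_mult)
qed

lemma seminorm_minus [simp]: "seminorm (- x) = seminorm x"
  using seminorm_sc[of "-1" x] by (simp add: sc_minus_one)

lemma seminorm_minus_commute: "seminorm (x - y) = seminorm (y - x)"
  using seminorm_minus[of "x - y"] by simp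

lemma seminorm_sq_add: "(seminorm (x + y))\<^sup>2 = (seminorm x)\<^sup>2 + (seminorm y)\<^sup>2 + 2 * Re (l (star x * y))"
proof -
  have "l (star y * x) = cnj (l (star x * y))"
    using l_star[of "star x * y"] by (simp add: star_mult)
  then show ?thesis
    by (simp add: seminorm_sq star_add distrib_left distrib_right l_add)
qed

text \<open>
  The usual quadratic argument, with both seminorms increased by \<open>e > 0\<close> so that elements of zero
  seminorm need no separate treatment.
\<close>

lemma Re_Cauchy_Schwarz: "Re (l (star x * y)) \<le> seminorm x * seminorm y"
proof -
  have *: "Re (l (star x * y)) \<le> (seminorm x + e) * (seminorm y + e)" if "0 < e" for e
  proof -
    define a b where "a = seminorm x + e" and "b = seminorm y + e"
    have ab: "seminorm x \<le> a" "seminorm y \<le> b" "0 < a" "0 < b"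
      using that by (auto simp: a_def b_def add_nonneg_pos)
    have "0 \<le> (seminorm (sc (of_real b) x + sc (of_real (- a)) y))\<^sup>2" by simp
    also have "\<dots> = (b * seminorm x)\<^sup>2 + (a * seminorm y)\<^sup>2 - 2 * (a * b) * Re (l (star x * y))"
      using ab unfolding seminorm_sq_add seminorm_sc
      by (simp add: star_sc mult_sc_left mult_sc_right sc_sc l_sc)
    also have "\<dots> \<le> (b * a)\<^sup>2 + (a * b)\<^sup>2 - 2 * (a * b) * Re (l (star x * y))"
      using ab by (intro diff_mono add_mono power_mono mult_left_mono) auto
    also have "\<dots> = 2 * (a * b) * (a * b - Re (l (star x * y)))"
      by (simp add: power2_eq_square algebra_simps)
    finally have "0 \<le> 2 * (a * b) * (a * b - Re (l (star x * y)))" .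
    moreover have "0 < 2 * (a * b)" using ab by simp
    ultimately have "0 \<le> a * b - Re (l (star x * y))"
      by (meson not_le zero_le_mult_iff)
    then show ?thesis by (simp add: a_def b_def)
  qed
  have "((\<lambda>e. (seminorm x + e) * (seminorm y + e)) \<longlongrightarrow> (seminorm x + 0) * (seminorm y + 0)) (at_right 0)"
    by (intro tendsto_intros)
  moreover have "\<forall>\<^sub>F e in at_right 0. Re (l (star x * y)) \<le> (seminorm x + e) * (seminorm y + e)"
    using eventually_at_right_less[of "0::real"] by (rule eventually_mono) (rule *)
  ultimately show ?thesis using tendsto_lowerbound by fastforce
qed

lemma Cauchy_Schwarz: "cmod (l (star x * y)) \<le> seminorm x * seminorm y"
proof (cases "l (star x * y) = 0")
  case False
  define c where "c = cnj (sgn (l (star x * y)))"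
  have "c * l (star x * y) = of_real (cmod (l (star x * y)))"
    using False by (simp add: c_def sgn_eq complex_norm_square[symmetric] power2_eq_square
        mult.commute[of "cnj _"] flip: complex_norm_square)
  then have "cmod (l (star x * y)) = Re (l (star x * sc c y))"
    by (simp add: mult_sc_right l_sc)
  also have "\<dots> \<le> seminorm x * seminorm (sc c y)" by (rule Re_Cauchy_Schwarz)
  also have "seminorm (sc c y) = seminorm y" using False by (simp add: seminorm_sc c_def norm_sgn)
  finally show ?thesis .
qed simp

lemma seminorm_triangle: "seminorm (x + y) \<le> seminorm x + seminorm y"
proof (rule power2_le_imp_le)
  show "(seminorm (x + y))\<^sup>2 \<le> (seminorm x + seminorm y)\<^sup>2"
    using Re_Cauchy_Schwarz[of x y] by (simp add: seminorm_sq_add power2_sum)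
qed simp

lemma seminorm_triangle_diff: "seminorm (x - z) \<le> seminorm (x - y) + seminorm (y - z)"
  using seminorm_triangle[of "x - y" "y - z"] by simp

lemma seminorm_sum: "seminorm (sum f X) \<le> (\<Sum>x\<in>X. seminorm (f x))"
  by (induction X rule: infinite_finite_induct) (auto intro: order_trans[OF seminorm_triangle])

text \<open>
  Boundedness of left multiplication by \<open>x\<close> in the GNS representation. It replaces the operator norm:
  it makes sense in the free algebra, and the operator norm is such a bound both in the C*-algebra and
  for matrices.
\<close>

definition bounded_by :: "real \<Rightarrow> 'a \<Rightarrow> bool" where
  "bounded_by K x \<longleftrightarrow> (\<forall>w. seminorm (x * w) \<le> K * seminorm w)"

lemma bounded_byD: "bounded_by K x \<Longrightarrow> seminorm (x * w) \<le> K * seminorm w"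
  by (simp add: bounded_by_def)

lemma bounded_by_mono: "bounded_by K x \<Longrightarrow> K \<le> L \<Longrightarrow> bounded_by L x"
  unfolding bounded_by_def by (meson mult_right_mono seminorm_nonneg order_trans)

lemma bounded_by_star:
  assumes "bounded_by K x" "0 \<le> K"
  shows "bounded_by K (star x)"
  unfolding bounded_by_def
proof
  fix w
  have "(seminorm (star x * w))\<^sup>2 = Re (l (star w * (x * (star x * w))))"
    by (simp add: seminorm_sq star_mult mult.assoc)
  also have "\<dots> \<le> seminorm w * seminorm (x * (star x * w))" by (rule Re_Cauchy_Schwarz)
  also have "\<dots> \<le> seminorm w * (K * seminorm (star x * w))"
    by (intro mult_left_mono bounded_byD assms) simp
  finally have *: "seminorm (star x * w) * seminorm (star x * w) \<le> (K * seminorm w) * seminorm (star x * w)"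
    by (simp add: power2_eq_square ac_simps)
  show "seminorm (star x * w) \<le> K * seminorm w"
  proof (cases "seminorm (star x * w) = 0")
    case False
    then have "0 < seminorm (star x * w)" using seminorm_nonneg[of "star x * w"] by linarith
    with * show ?thesis by simp
  qed (use assms(2) in simp)
qed

lemma bounded_by_one: "bounded_by 1 1"
  by (simp add: bounded_by_def)

lemma bounded_by_mult:
  assumes "bounded_by K x" "bounded_by L y" "0 \<le> K"
  shows "bounded_by (K * L) (x * y)"
  unfolding bounded_by_def
proof
  fix w
  have "seminorm (x * y * w) \<le> K * seminorm (y * w)"
    using bounded_byD[OF assms(1)] by (simp add: mult.assoc)
  also have "\<dots> \<le> K * (L * seminorm w)"
    by (intro mult_left_mono bounded_byD assms)
  finally show "seminorm (x * y * w) \<le> K * L * seminorm w" by (simp add: mult.assoc)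
qed

lemma bounded_by_add:
  assumes "bounded_by K x" "bounded_by L y"
  shows "bounded_by (K + L) (x + y)"
  unfolding bounded_by_def
proof
  fix w
  show "seminorm ((x + y) * w) \<le> (K + L) * seminorm w"
    using seminorm_triangle[of "x * w" "y * w"] bounded_byD[OF assms(1), of w] bounded_byD[OF assms(2), of w]
    by (simp add: distrib_right)
qed

lemma bounded_by_sc: "bounded_by K x \<Longrightarrow> bounded_by (cmod c * K) (sc c x)"
  unfolding bounded_by_def by (simp add: mult_sc_left seminorm_sc mult.assoc mult_left_mono)

lemma bounded_by_sum: "(\<And>i. i \<in> X \<Longrightarrow> bounded_by (K i) (f i)) \<Longrightarrow> bounded_by (sum K X) (sum f X)"
proof (induction X rule: infinite_finite_induct)
  case (insert i X)
  then show ?case using bounded_by_add by simp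
qed (auto simp: bounded_by_def)

lemma bounded_by_letter_ev:
  assumes "0 \<le> R" "\<And>i. i \<in> set_letter a \<Longrightarrow> bounded_by R (x i)"
  shows "bounded_by R (letter_ev x a)"
  using assms bounded_by_star by (cases a) (auto simp: letter_ev_def)

lemma bounded_by_letters:
  assumes "0 \<le> R" "\<And>i. i \<in> (\<Union>a\<in>set as. set_letter a) \<Longrightarrow> bounded_by R (x i)"
  shows "bounded_by (R ^ length as) (prod_list (map (letter_ev x) as))"
  using assms(2)
proof (induction as)
  case (Cons a as)
  then show ?case
    using bounded_by_mult[OF bounded_by_letter_ev[OF assms(1)] Cons.IH assms(1), of a x] by simp
qed (simp add: bounded_by_one)

lemma bounded_by_ev:
  assumes "0 \<le> R" "\<And>i. i \<in> I \<Longrightarrow> bounded_by R (x i)" "P \<in> ncpolys I"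
  shows "bounded_by (ncpoly_bound R P) (ev x P)"
  unfolding ev_def ncpoly_bound_def word_ev_def
  by (intro bounded_by_sum bounded_by_sc bounded_by_letters assms)
    (use assms(3) in \<open>auto simp: ncpolys_def set_sword_letters\<close>)

text \<open>
  The spectral theorem in the only form that is needed: polynomials nonnegative on \<open>[0, M\<^sup>2]\<close> act as
  positive operators at \<open>x\<^sup>* x\<close>.
\<close>

lemma rpoly_form_nonneg:
  assumes x: "bounded_by M x" and M: "0 < M"
    and s: "\<And>t. t \<in> {0..M\<^sup>2} \<Longrightarrow> 0 \<le> poly s t"
  shows "0 \<le> Re (l (star w * rpoly (star x * x) s * w))"
proof -
  define z where "z = star x * x"
  have z: "star z = z" by (simp add: z_def star_mult)
  have sq: "Re (l (star w * (rpoly z r * g * rpoly z r) * w)) = Re (l (star (rpoly z r * w) * g * (rpoly z r * w)))" for r g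
    by (simp add: star_mult star_rpoly[OF z] mult.assoc)
  have swap: "g * (r * r) = r * g * r" for g r :: "real poly" by (simp only: ac_simps)
  have X: "rpoly z [:0, 1:] = z" by simp
  have Y: "rpoly z [:M\<^sup>2, -1:] = sc (of_real (M\<^sup>2)) 1 - z" by (simp add: sc_minus_one)
  have "interval_positive (M\<^sup>2) (\<lambda>p. Re (l (star w * rpoly z p * w)))"
    unfolding interval_positive_def
  proof (intro conjI allI)
    fix p q r
    show "Re (l (star w * rpoly z (p + q) * w)) = Re (l (star w * rpoly z p * w)) + Re (l (star w * rpoly z q * w))"
      by (simp add: rpoly_add distrib_left distrib_right l_add)
    have "rpoly z (r * r) = rpoly z r * 1 * rpoly z r" by (simp add: rpoly_mult)
    then show "0 \<le> Re (l (star w * rpoly z (r * r) * w))"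
      unfolding sq using Re_pos by (metis mult.right_neutral sq)
    have "rpoly z ([:0, 1:] * (r * r)) = rpoly z r * z * rpoly z r"
      unfolding swap rpoly_mult X ..
    moreover have form: "Re (l (star (rpoly z r * w) * z * (rpoly z r * w))) = (seminorm (x * (rpoly z r * w)))\<^sup>2"
      by (simp add: seminorm_sq z_def star_mult mult.assoc)
    ultimately show "0 \<le> Re (l (star w * rpoly z ([:0, 1:] * (r * r)) * w))"
      by (simp only: sq) simp
    have "rpoly z ([:M\<^sup>2, -1:] * (r * r)) = rpoly z r * (sc (of_real (M\<^sup>2)) 1 - z) * rpoly z r"
      unfolding swap rpoly_mult Y ..
    moreover have "Re (l (star (rpoly z r * w) * (sc (of_real (M\<^sup>2)) 1 - z) * (rpoly z r * w)))
        = M\<^sup>2 * (seminorm (rpoly z r * w))\<^sup>2 - (seminorm (x * (rpoly z r * w)))\<^sup>2"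
      unfolding form[symmetric]
      by (simp add: left_diff_distrib right_diff_distrib l_diff mult_sc_left mult_sc_right l_sc seminorm_sq
          flip: of_real_power)
    moreover have "(seminorm (x * (rpoly z r * w)))\<^sup>2 \<le> M\<^sup>2 * (seminorm (rpoly z r * w))\<^sup>2"
      unfolding power_mult_distrib[symmetric] by (intro power_mono bounded_byD x) simp
    ultimately show "0 \<le> Re (l (star w * rpoly z ([:M\<^sup>2, -1:] * (r * r)) * w))"
      by (simp only: sq)
  qed
  from interval_positive_nonneg[OF this _ s] M show ?thesis by (simp add: z_def)
qed

end

text \<open>
  Truncation by a polynomial in the element and its adjoint, so that it can be performed on
  noncommutative polynomials before they are evaluated at operators or matrices.
\<close>

definition (in star_algebra) cutoff :: "real poly \<Rightarrow> real poly \<Rightarrow> 'a \<Rightarrow> 'a" where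
  "cutoff u v x = x * rpoly (star x * x) (1 - u * v)"

lemma (in star_algebra) ev_cutoff: "ev x (free.cutoff u v P) = cutoff u v (ev x P)"
  by (simp add: free.cutoff_def cutoff_def ev_mult ev_rpoly ev_adj)

lemma ncpolys_cutoff: "P \<in> ncpolys I \<Longrightarrow> free.cutoff u v P \<in> ncpolys I"
  by (simp add: free.cutoff_def ncpolys_mult ncpolys_rpoly ncpolys_adj)

context positive_functional
begin

text \<open>
  Apply \<open>rpoly_form_nonneg\<close> to \<open>S\<^sup>2 - t p(t)\<^sup>2\<close>.
\<close>

lemma bounded_by_cutoff:
  assumes "bounded_by M x" "0 < M" "0 \<le> S" "cutoff_pair S (M\<^sup>2) \<eta> u v"
  shows "bounded_by S (cutoff u v x)"
  unfolding bounded_by_def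
proof
  fix w
  define z where "z = star x * x"
  define p where "p = 1 - u * v"
  have z: "star z = z" by (simp add: z_def star_mult)
  have swap: "g * (r * r) = r * g * r" for g r :: "real poly" by (simp only: ac_simps)
  have X: "rpoly z [:0, 1:] = z" by simp
  have C: "rpoly z [:S\<^sup>2:] = sc (of_real (S\<^sup>2)) 1" by simp
  have "0 \<le> Re (l (star w * rpoly z ([:S\<^sup>2:] - [:0, 1:] * (p * p)) * w))"
    unfolding z_def
    by (rule rpoly_form_nonneg[OF assms(1,2)])
      (use assms(4) in \<open>auto simp: p_def cutoff_pair_def power2_eq_square\<close>)
  also have "rpoly z ([:S\<^sup>2:] - [:0, 1:] * (p * p)) = sc (of_real (S\<^sup>2)) 1 - rpoly z p * z * rpoly z p"
    unfolding swap rpoly_diff rpoly_mult X C ..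
  also have "Re (l (star w * (sc (of_real (S\<^sup>2)) 1 - rpoly z p * z * rpoly z p) * w)) =
      S\<^sup>2 * (seminorm w)\<^sup>2 - (seminorm (cutoff u v x * w))\<^sup>2"
  proof -
    have "star (cutoff u v x * w) * (cutoff u v x * w) = star w * (rpoly z p * z * rpoly z p) * w"
      unfolding cutoff_def z_def[symmetric] p_def[symmetric] star_mult star_rpoly[OF z]
      by (simp add: z_def mult.assoc)
    then show ?thesis
      by (simp add: seminorm_sq left_diff_distrib right_diff_distrib l_diff mult_sc_left mult_sc_right l_sc
          flip: of_real_power)
  qed
  finally have "(seminorm (cutoff u v x * w))\<^sup>2 \<le> (S * seminorm w)\<^sup>2" by (simp add: power_mult_distrib)
  then show "seminorm (cutoff u v x * w) \<le> S * seminorm w"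
    by (rule power2_le_imp_le) (use assms(3) in simp)
qed

end

locale tracial_functional = positive_functional star sc l
  for star :: "'a::{ring,monoid_mult} \<Rightarrow> 'a" and sc l +
  assumes l_comm: "l (x * y) = l (y * x)" and l_one [simp]: "l 1 = 1"
begin

lemma seminorm_star: "seminorm (star x) = seminorm x"
  using l_comm[of x "star x"] by (simp add: seminorm_def)

lemma seminorm_one [simp]: "seminorm 1 = 1"
  by (simp add: seminorm_def)

lemma l_le_seminorm: "cmod (l x) \<le> seminorm x"
  using Cauchy_Schwarz[of 1 x] by simp

text \<open>
  The trace property turns right multiplication into left multiplication by the adjoint.
\<close>

lemma seminorm_mult_right:
  assumes "bounded_by K x" "0 \<le> K"
  shows "seminorm (w * x) \<le> K * seminorm w"
  using bounded_byD[OF bounded_by_star[OF assms], of "star w"] seminorm_star[of "w * x"]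
  by (simp add: star_mult seminorm_star)

text \<open>
  In the Hilbert space of a trace the truncation at level \<open>S\<close> is the nearest-point projection onto
  the convex ball of radius \<open>S\<close>, hence does not increase the distance to a point \<open>c\<close> of that ball.
  Write \<open>x = y + x Q\<close> with \<open>y\<close> the truncation and \<open>Q = (u v)(x\<^sup>* x)\<close>. Expanding \<open>\<parallel>x - c\<parallel>\<^sup>2\<close> around \<open>y - c\<close>, it
  remains to bound the cross term \<open>\<langle>x Q, y - c\<rangle>\<close> from below. Splitting \<open>Q\<close> as \<open>u v\<close> by the trace
  property bounds \<open>\<langle>x Q, c\<rangle>\<close> by Cauchy-Schwarz, and the second inequality of \<open>cutoff_pair\<close> finishes.
\<close>

lemma cutoff_contraction:
  assumes x: "bounded_by M x" and M: "0 < M" and S: "0 \<le> S" and uv: "cutoff_pair S (M\<^sup>2) \<eta> u v"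
    and c: "bounded_by S c"
  shows "(seminorm (cutoff u v x - c))\<^sup>2 \<le> (seminorm (x - c))\<^sup>2 + \<eta>"
proof -
  define z where "z = star x * x"
  define p where "p = 1 - u * v"
  define y where "y = cutoff u v x"
  define Q where "Q = rpoly z (u * v)"
  have z: "star z = z" by (simp add: z_def star_mult)
  note srp = star_rpoly[OF z]
  have swap: "g * (r * r) = r * g * r" for g r :: "real poly" by (simp only: ac_simps)
  have X: "rpoly z [:0, 1:] = z" by simp
  have y: "y = x * rpoly z p" by (simp add: y_def cutoff_def z_def p_def)
  have "x = y + x * Q"
    by (simp add: y Q_def p_def rpoly_diff right_diff_distrib)
  then have "x - c = (y - c) + x * Q" by (simp add: algebra_simps)
  then have "(seminorm (x - c))\<^sup>2 = (seminorm (y - c))\<^sup>2 + (seminorm (x * Q))\<^sup>2 + 2 * Re (l (star (y - c) * (x * Q)))"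
    by (metis seminorm_sq_add)
  moreover have "l (star (y - c) * (x * Q)) = cnj (l (star (x * Q) * (y - c)))"
    using l_star[of "star (x * Q) * (y - c)"] by (simp add: star_mult)
  moreover have "l (star (x * Q) * (y - c)) = l (star (x * Q) * y) - l (star (x * Q) * c)"
    by (simp add: right_diff_distrib l_diff)
  moreover have "l (star (x * Q) * y) = l (rpoly z ([:0, 1:] * p * (u * v)))"
  proof -
    have "star (x * Q) * y = Q * z * rpoly z p"
      unfolding y star_mult Q_def srp by (simp add: z_def mult.assoc)
    also have "\<dots> = rpoly z (u * v * [:0, 1:] * p)" unfolding Q_def rpoly_mult X ..
    finally show ?thesis by (simp only: ac_simps)
  qed
  moreover have "2 * Re (l (star (x * Q) * c)) \<le> Re (l (rpoly z ([:0, 1:] * (v * v)))) + S\<^sup>2 * Re (l (rpoly z (u * u)))"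
  proof -
    have "star (x * Q) * c = rpoly z u * (rpoly z v * star x * c)"
      unfolding star_mult Q_def srp by (simp add: rpoly_mult mult.assoc)
    then have "l (star (x * Q) * c) = l (star (x * rpoly z v) * (c * rpoly z u))"
      using l_comm[of "rpoly z u" "rpoly z v * star x * c"] by (simp add: star_mult srp mult.assoc)
    then have "2 * Re (l (star (x * Q) * c)) \<le> 2 * (seminorm (x * rpoly z v) * seminorm (c * rpoly z u))"
      using Re_Cauchy_Schwarz by simp
    also have "\<dots> \<le> (seminorm (x * rpoly z v))\<^sup>2 + (seminorm (c * rpoly z u))\<^sup>2"
      using sum_squares_bound[of "seminorm (x * rpoly z v)" "seminorm (c * rpoly z u)"] by simp
    also have "(seminorm (c * rpoly z u))\<^sup>2 \<le> (S * seminorm (rpoly z u))\<^sup>2"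
      by (intro power_mono bounded_byD c) simp
    also have "\<dots> = S\<^sup>2 * Re (l (rpoly z (u * u)))"
      by (simp add: power_mult_distrib seminorm_sq srp rpoly_mult)
    also have "(seminorm (x * rpoly z v))\<^sup>2 = Re (l (rpoly z ([:0, 1:] * (v * v))))"
    proof -
      have "star (x * rpoly z v) * (x * rpoly z v) = rpoly z v * z * rpoly z v"
        unfolding star_mult srp by (simp add: z_def mult.assoc)
      also have "\<dots> = rpoly z ([:0, 1:] * (v * v))"
        unfolding swap rpoly_mult X ..
      finally show ?thesis by (simp only: seminorm_sq)
    qed
    finally show ?thesis by simp
  qed
  moreover have "0 \<le> Re (l (rpoly z (Polynomial.smult 2 ([:0, 1:] * p * (u * v)) - [:0, 1:] * (v * v) - Polynomial.smult (S\<^sup>2) (u * u) + [:\<eta>:])))"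
  proof -
    have "0 \<le> Re (l (star 1 * rpoly z (Polynomial.smult 2 ([:0, 1:] * p * (u * v)) - [:0, 1:] * (v * v) - Polynomial.smult (S\<^sup>2) (u * u) + [:\<eta>:]) * 1))"
      unfolding z_def
      by (rule rpoly_form_nonneg[OF x M])
        (use uv in \<open>auto simp: p_def cutoff_pair_def power2_eq_square algebra_simps\<close>)
    then show ?thesis by simp
  qed
  then have "0 \<le> 2 * Re (l (rpoly z ([:0, 1:] * p * (u * v)))) - Re (l (rpoly z ([:0, 1:] * (v * v))))
      - S\<^sup>2 * Re (l (rpoly z (u * u))) + \<eta>"
    unfolding rpoly_add rpoly_diff rpoly_smult
    by (simp add: l_add l_diff l_sc del: rpoly_pCons flip: of_real_power) (simp add: l_sc)
  ultimately have "(seminorm (y - c))\<^sup>2 \<le> (seminorm (x - c))\<^sup>2 + \<eta>"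
    using zero_le_power2[of "seminorm (x * Q)"] by simp
  then show ?thesis by (simp add: y_def)
qed

text \<open>
  Replace one letter at a time. The hypothesis \<open>1 \<le> S\<close> lets all partial products be bounded by the
  same power of \<open>S\<close>.
\<close>

lemma letters_Lipschitz:
  fixes S \<delta> :: real
  assumes "\<And>i. i \<in> (\<Union>a\<in>set as. set_letter a) \<Longrightarrow> bounded_by S (x i) \<and> bounded_by S (y i) \<and> seminorm (x i - y i) \<le> \<delta>"
    and S: "1 \<le> S" and \<delta>: "0 \<le> \<delta>"
  shows "seminorm (prod_list (map (letter_ev x) as) - prod_list (map (letter_ev y) as)) \<le> length as * S ^ length as * \<delta>"
  using assms(1)
proof (induction as)
  case (Cons a as)
  let ?X = "prod_list (map (letter_ev x) as)" and ?Y = "prod_list (map (letter_ev y) as)"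
  have IH: "seminorm (?X - ?Y) \<le> length as * S ^ length as * \<delta>"
    using Cons by simp
  have bY: "bounded_by (S ^ length as) ?Y"
    by (rule bounded_by_letters) (use Cons.prems S in auto)
  have ba: "bounded_by S (letter_ev x a)"
    by (rule bounded_by_letter_ev) (use Cons.prems S in auto)
  have na: "seminorm (letter_ev x a - letter_ev y a) \<le> \<delta>"
    using Cons.prems seminorm_star[of "x _ - y _"] by (cases a) (auto simp: letter_ev_def simp flip: star_diff)
  have "letter_ev x a * ?X - letter_ev y a * ?Y = letter_ev x a * (?X - ?Y) + (letter_ev x a - letter_ev y a) * ?Y"
    by (simp add: algebra_simps)
  then have "seminorm (letter_ev x a * ?X - letter_ev y a * ?Y) \<le>
      seminorm (letter_ev x a * (?X - ?Y)) + seminorm ((letter_ev x a - letter_ev y a) * ?Y)"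
    using seminorm_triangle by simp
  also have "\<dots> \<le> S * (length as * S ^ length as * \<delta>) + S ^ length as * \<delta>"
  proof (rule add_mono)
    show "seminorm (letter_ev x a * (?X - ?Y)) \<le> S * (length as * S ^ length as * \<delta>)"
      using order_trans[OF bounded_byD[OF ba] mult_left_mono[OF IH]] S by simp
    show "seminorm ((letter_ev x a - letter_ev y a) * ?Y) \<le> S ^ length as * \<delta>"
      using order_trans[OF seminorm_mult_right[OF bY] mult_left_mono[OF na]] S by simp
  qed
  also have "\<dots> \<le> S * (length as * S ^ length as * \<delta>) + S * (S ^ length as * \<delta>)"
    using S \<delta> mult_right_mono[OF S, of "S ^ length as * \<delta>"] by simp
  also have "\<dots> = length (a # as) * S ^ length (a # as) * \<delta>"
    by (simp add: algebra_simps)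
  finally show ?case by simp
qed simp

lemma ev_Lipschitz:
  assumes P: "P \<in> ncpolys I"
    and "\<And>i. i \<in> I \<Longrightarrow> bounded_by S (x i)" "\<And>i. i \<in> I \<Longrightarrow> bounded_by S (y i)"
    and "\<And>i. i \<in> I \<Longrightarrow> seminorm (x i - y i) \<le> \<delta>" and \<delta>: "0 \<le> \<delta>"
  shows "seminorm (ev x P - ev y P) \<le> Lipschitz_const S P * \<delta>"
proof -
  have word: "seminorm (word_ev x w - word_ev y w) \<le> length (letters w) * max 1 S ^ length (letters w) * \<delta>"
    if "w \<in> Poly_Mapping.keys P" for w
  proof -
    have "(\<Union>a\<in>set (letters w). set_letter a) \<subseteq> I"
      using P that by (auto simp: ncpolys_def set_sword_letters)
    then show ?thesis
      unfolding word_ev_def using assms(2-5) bounded_by_mono[of S _ "max 1 S"]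
      by (intro letters_Lipschitz) (auto simp: subset_iff)
  qed
  have "ev x P - ev y P = (\<Sum>w\<in>Poly_Mapping.keys P. sc (Poly_Mapping.lookup P w) (word_ev x w - word_ev y w))"
    unfolding ev_def sum_subtractf[symmetric]
    by (rule sum.cong) (auto simp: sc_diff_right)
  also have "seminorm \<dots> \<le> (\<Sum>w\<in>Poly_Mapping.keys P. seminorm (sc (Poly_Mapping.lookup P w) (word_ev x w - word_ev y w)))"
    by (rule seminorm_sum)
  also have "\<dots> \<le> (\<Sum>w\<in>Poly_Mapping.keys P. cmod (Poly_Mapping.lookup P w) *
     (length (letters w) * (max 1 S) ^ length (letters w) * \<delta>))"
    unfolding seminorm_sc by (intro sum_mono mult_left_mono word) auto
  finally show ?thesis by (simp add: Lipschitz_const_def sum_distrib_right mult.assoc)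
qed

lemma bounded_by_power:
  assumes "bounded_by S x" "0 \<le> S"
  shows "bounded_by (S\<^sup>2 ^ m) ((star x * x) ^ m)"
proof (induction m)
  case (Suc m)
  have "bounded_by (S * S) (star x * x)"
    using assms bounded_by_mult bounded_by_star by blast
  then show ?case using bounded_by_mult[OF _ Suc.IH] by (simp add: power2_eq_square)
qed (simp add: bounded_by_one)

text \<open>
  Both for even and for odd \<open>k\<close> the element is of the form \<open>g\<^sup>* g\<close>: with \<open>h = (x\<^sup>* x)^(k div 2)\<close>, take \<open>g\<close>
  to be \<open>h\<close> or \<open>x h\<close>.
\<close>

lemma moment_le:
  assumes "bounded_by S x" "0 \<le> S"
  shows "l ((star x * x) ^ k) \<le> complex_of_real (S ^ (2 * k))"
proof -
  define h where "h = (star x * x) ^ (k div 2)"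
  have h: "star h = h" unfolding h_def star_power by (simp add: star_mult)
  have "\<exists>g. (star x * x) ^ k = star g * g \<and> seminorm g \<le> S ^ k"
  proof (cases "even k")
    case True
    then have "(star x * x) ^ k = star h * h"
      unfolding h by (auto simp: h_def mult_2 simp flip: power_add elim: evenE)
    moreover have "seminorm h \<le> S ^ k"
      using bounded_byD[OF bounded_by_power[OF assms, of "k div 2"], of 1] True
      by (simp add: h_def flip: power_mult)
    ultimately show ?thesis by blast
  next
    case False
    then obtain m where m: "k = Suc (2 * m)" by (auto elim: oddE)
    have hm: "h = (star x * x) ^ m" by (simp add: h_def m)
    have "(star x * x) ^ k = h * (star x * x) * h"
      by (simp add: m hm mult_2 power_add power_commutes mult.assoc flip: power_Suc2)
    also have "\<dots> = star (x * h) * (x * h)" by (simp add: star_mult h mult.assoc)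
    finally have "(star x * x) ^ k = star (x * h) * (x * h)" .
    moreover have "seminorm h \<le> S\<^sup>2 ^ m"
      using bounded_byD[OF bounded_by_power[OF assms, of m], of 1] by (simp add: hm)
    then have "seminorm (x * h) \<le> S ^ k"
      using order_trans[OF bounded_byD[OF assms(1)] mult_left_mono[OF _ assms(2)], of h "S\<^sup>2 ^ m"]
      by (simp add: m power_mult)
    ultimately show ?thesis by blast
  qed
  then obtain g where g: "(star x * x) ^ k = star g * g" "seminorm g \<le> S ^ k" by blast
  have "Re (l (star g * g)) \<le> (S ^ k)\<^sup>2"
    using power_mono[OF g(2), of 2] by (simp add: seminorm_sq)
  then show ?thesis using Im_pos[of g] unfolding g(1)
    by (simp add: less_eq_complex_def power_mult[symmetric] mult.commute)
qed

text \<open>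
  Covers both the laws of traces and the laws of matrix microstates.
\<close>

lemma law_in_tracial_laws:
  assumes "\<And>i. i \<in> I \<Longrightarrow> bounded_by R (x i)" "0 \<le> R"
  shows "(\<lambda>P\<in>ncpolys I. l (ev x P)) \<in> tracial_laws R I"
  unfolding tracial_laws_def
  using assms
  by (auto simp: ncpolys_add ncpolys_mult ncpolys_scale ncpolys_adj ncpolys_power ev_add l_add ev_scale l_sc
      ev_mult ev_adj ev_power l_pos simp del: of_real_power intro: l_comm moment_le)

end

section \<open>Tracial states on C*-algebras\<close>

lemma scaleC_one: "scaleC 1 x = (x :: 'b::cstar_algebra)"
  using scaleC_of_real[of 1 x] by simp

global_interpretation cstar: star_algebra "adj :: 'b::cstar_algebra \<Rightarrow> 'b" scaleC
  by standard (rule scaleC_add_right scaleC_add_left scaleC_scaleC scaleC_one mult_scaleC_left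
      mult_scaleC_right adj_adj adj_add adj_scaleC adj_mult)+

lemma ncpoly_eval_eq_ev: "ncpoly_eval x P = cstar.ev x P"
proof -
  have "letter_eval x = cstar.letter_ev x"
    by (rule ext, rename_tac a, case_tac a) (auto simp: cstar.letter_ev_def)
  then show ?thesis by (simp add: ncpoly_eval_def cstar.ev_def cstar.word_ev_def)
qed

lemma norm_adj: "norm (adj x) = norm (x :: 'b::cstar_algebra)"
proof -
  have "norm y \<le> norm (adj y)" for y :: 'b
  proof (cases "norm y = 0")
    case False
    have "norm y * norm y \<le> norm (adj y) * norm y"
      using norm_adj_mult[of y] norm_mult_ineq[of "adj y" y] by (simp add: power2_eq_square)
    then show ?thesis using False by simp
  qed simp
  from this[of x] this[of "adj x"] show ?thesis by (simp add: adj_adj)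
qed

lemma adj_scaleR: "adj (r *\<^sub>R x) = r *\<^sub>R adj (x :: 'b::cstar_algebra)"
  using adj_scaleC[of "of_real r" x] by (simp add: scaleC_of_real)

lemma bounded_linear_adj: "bounded_linear (adj :: 'b::cstar_algebra \<Rightarrow> 'b)"
  by (rule bounded_linear_intro[where K=1]) (auto simp: adj_add adj_scaleR norm_adj)

lemma bounded_linear_scaleC: "bounded_linear (scaleC c :: 'b::cstar_algebra \<Rightarrow> 'b)"
proof (rule bounded_linear_intro[where K="cmod c"])
  show "scaleC c (r *\<^sub>R x) = r *\<^sub>R scaleC c x" for r and x :: 'b
    by (simp add: scaleC_scaleC mult.commute flip: scaleC_of_real)
qed (auto simp: scaleC_add_right norm_scaleC)

text \<open>
  For \<open>w = 1 - v\<close> the equation \<open>w\<^sup>2 = 1 - z\<close> reads \<open>v = (z + v\<^sup>2) / 2\<close>. The right-hand side maps the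
  selfadjoint part of the ball of radius \<open>\<rho>\<close>, the smaller root of \<open>\<rho> = (\<parallel>z\<parallel> + \<rho>\<^sup>2) / 2\<close>, to itself and is a
  contraction with constant \<open>\<rho> < 1\<close>.
\<close>

lemma selfadjoint_sqrt:
  fixes z :: "'b::cstar_algebra"
  assumes z: "adj z = z" "norm z < 1"
  obtains w where "adj w = w" "w * w = 1 - z"
proof -
  define \<rho> where "\<rho> = 1 - sqrt (1 - norm z)"
  have \<rho>: "0 \<le> \<rho>" "\<rho> < 1" using z(2) by (auto simp: \<rho>_def)
  have "(1 - \<rho>)\<^sup>2 = 1 - norm z" using z(2) by (simp add: \<rho>_def)
  then have \<rho>2: "norm z + \<rho> * \<rho> = 2 * \<rho>" by (simp add: power2_eq_square algebra_simps)
  define B where "B = {v :: 'b. norm v \<le> \<rho> \<and> adj v = v}"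
  define f where "f v = (1 / 2) *\<^sub>R (z + v * v)" for v
  have "closed {v :: 'b. adj v = v}"
    by (intro closed_Collect_eq linear_continuous_on[OF bounded_linear_adj] continuous_on_id)
  moreover have "B = cball 0 \<rho> \<inter> {v. adj v = v}" by (auto simp: B_def)
  ultimately have "complete B" by (auto simp: complete_eq_closed intro: closed_Int)
  moreover have "B \<noteq> {}" using \<rho> cstar.star_zero by (auto simp: B_def intro!: exI[of _ 0])
  moreover have "f ` B \<subseteq> B"
  proof (rule image_subsetI)
    fix v assume v: "v \<in> B"
    have "norm (z + v * v) \<le> norm z + norm v * norm v"
      by (intro order_trans[OF norm_triangle_ineq] add_mono norm_mult_ineq order_refl)
    also have "\<dots> \<le> norm z + \<rho> * \<rho>" using v \<rho> by (auto simp: B_def intro!: mult_mono)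
    finally have "norm (f v) \<le> \<rho>" using \<rho>2 by (simp add: f_def)
    moreover have "adj (f v) = f v"
      using v z by (simp add: f_def B_def adj_add adj_mult adj_scaleR)
    ultimately show "f v \<in> B" by (simp add: B_def)
  qed
  moreover have "dist (f v) (f w) \<le> \<rho> * dist v w" if "v \<in> B" "w \<in> B" for v w
  proof -
    have "f v - f w = (1 / 2) *\<^sub>R (v * (v - w) + (v - w) * w)"
      by (simp add: f_def algebra_simps)
    then have "dist (f v) (f w) = norm (v * (v - w) + (v - w) * w) / 2"
      by (simp add: dist_norm)
    also have "\<dots> \<le> (norm v * norm (v - w) + norm (v - w) * norm w) / 2"
      by (intro divide_right_mono order_trans[OF norm_triangle_ineq] add_mono norm_mult_ineq) simp
    also have "\<dots> \<le> (\<rho> * norm (v - w) + norm (v - w) * \<rho>) / 2"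
      using that by (intro divide_right_mono add_mono mult_mono) (auto simp: B_def \<rho>)
    finally show ?thesis by (simp add: dist_norm)
  qed
  ultimately obtain v where v: "v \<in> B" "f v = v"
    using Banach_fix[of B \<rho> f] \<rho> by blast
  have "2 *\<^sub>R v = 2 *\<^sub>R f v" using v(2) by simp
  also have "\<dots> = z + v * v" by (simp add: f_def)
  finally have "2 *\<^sub>R v = z + v * v" .
  then have "(1 - v) * (1 - v) = 1 - z" by (simp add: algebra_simps scaleR_2)
  moreover have "adj (1 - v) = 1 - v" using v(1) by (simp add: B_def cstar.star_diff)
  ultimately show thesis using that by blast
qed

lemma tracial_state_functional:
  assumes "\<tau> \<in> tracial_states UNIV"
  shows "tracial_functional adj scaleC \<tau>"
  using assms by unfold_locales (auto simp: tracial_states_def)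

text \<open>
  For \<open>r > \<parallel>x\<parallel>\<close> the element \<open>1 - x\<^sup>* x / r\<^sup>2\<close> is the square of a selfadjoint \<open>v\<close>, so that
  \<open>0 \<le> \<tau> ((v w)\<^sup>* (v w))\<close> is the desired inequality with \<open>r\<close> in place of \<open>\<parallel>x\<parallel>\<close>.
\<close>

lemma tracial_state_bounded_by_norm:
  fixes x :: "'b::cstar_algebra"
  assumes "\<tau> \<in> tracial_states UNIV"
  shows "positive_functional.bounded_by adj \<tau> (norm x) x"
proof -
  interpret t: tracial_functional adj scaleC \<tau> by (rule tracial_state_functional) fact
  have *: "t.seminorm (x * w) \<le> r * t.seminorm w" if r: "norm x < r" for r w
  proof -
    have r0: "0 < r" using r norm_ge_zero[of x] by linarith
    define z where "z = scaleC (of_real (1 / r\<^sup>2)) (adj x * x)"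
    have "norm z = (norm x / r)\<^sup>2"
      by (simp add: z_def norm_scaleC norm_adj_mult power_divide norm_divide norm_power)
    also have "\<dots> < 1" using r r0 by (simp add: power_less_one_iff abs_square_less_1)
    finally have "norm z < 1" .
    moreover have "adj z = z" by (simp add: z_def adj_scaleC adj_mult adj_adj)
    ultimately obtain v where v: "adj v = v" "v * v = 1 - z" using selfadjoint_sqrt by blast
    have "0 \<le> Re (\<tau> (adj (v * w) * (v * w)))" by (rule t.Re_pos)
    also have "adj (v * w) * (v * w) = adj w * (v * v) * w" by (simp only: adj_mult v(1) mult.assoc)
    also have "\<dots> = adj w * w - scaleC (of_real (1 / r\<^sup>2)) (adj (x * w) * (x * w))"
      unfolding v(2) z_def
      by (simp only: left_diff_distrib right_diff_distrib mult_scaleC_left mult_scaleC_right adj_mult mult.assoc mult_1_left)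
    also have "Re (\<tau> \<dots>) = (t.seminorm w)\<^sup>2 - (1 / r\<^sup>2) * (t.seminorm (x * w))\<^sup>2"
      by (simp only: t.l_diff t.l_sc t.seminorm_sq minus_complex.sel Re_complex_of_real times_complex.sel Im_complex_of_real)
    finally have "(t.seminorm (x * w))\<^sup>2 \<le> (r * t.seminorm w)\<^sup>2"
      using r0 by (simp add: field_simps power_mult_distrib)
    then show ?thesis by (rule power2_le_imp_le) (use r0 in simp)
  qed
  show ?thesis
    unfolding t.bounded_by_def
  proof
    fix w
    show "t.seminorm (x * w) \<le> norm x * t.seminorm w"
    proof (cases "t.seminorm w = 0")
      case True
      then show ?thesis using *[of "norm x + 1" w] by simp
    next
      case False
      then have w: "0 < t.seminorm w" using t.seminorm_nonneg[of w] by linarith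
      have "t.seminorm (x * w) / t.seminorm w \<le> norm x"
        by (rule dense_ge) (use * w in \<open>simp add: field_simps\<close>)
      then show ?thesis using w by (simp add: field_simps)
    qed
  qed
qed

abbreviation trace_seminorm :: "('b::cstar_algebra \<Rightarrow> complex) \<Rightarrow> 'b \<Rightarrow> real" where
  "trace_seminorm \<equiv> positive_functional.seminorm adj"

lemma trace_seminorm_le_norm:
  assumes "\<tau> \<in> tracial_states UNIV"
  shows "trace_seminorm \<tau> x \<le> norm x"
proof -
  interpret t: tracial_functional adj scaleC \<tau> by (rule tracial_state_functional) fact
  show ?thesis
    using t.bounded_byD[OF tracial_state_bounded_by_norm[OF assms], of x 1] by simp
qed

lemma trace_seminorm_le_norm2:
  assumes "T \<subseteq> tracial_states UNIV" "\<tau> \<in> T"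
  shows "trace_seminorm \<tau> x \<le> norm2 T x"
proof -
  have eq: "sqrt (Re (\<sigma> (adj x * x))) = trace_seminorm \<sigma> x" if "\<sigma> \<in> T" for \<sigma>
  proof -
    interpret t: tracial_functional adj scaleC \<sigma> by (rule tracial_state_functional) (use assms that in blast)
    show ?thesis by (simp add: t.seminorm_def)
  qed
  have "bdd_above (insert 0 ((\<lambda>\<tau>. sqrt (Re (\<tau> (adj x * x)))) ` T))"
    unfolding bdd_above_def using eq assms(1) trace_seminorm_le_norm[of _ x]
    by (intro exI[of _ "norm x"]) (auto simp: subset_iff)
  then have "sqrt (Re (\<tau> (adj x * x))) \<le> norm2 T x"
    unfolding norm2_def using assms(2) by (intro cSup_upper) auto
  with eq assms(2) show ?thesis by simp
qed

text \<open>
  The closure of the values of polynomials is a C*-subalgebra, so the C*-algebra generated by a tuple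
  is contained in it.
\<close>

lemma unital_cstar_subalgebra_closure:
  "unital_cstar_subalgebra (closure (cstar.ev x ` ncpolys I))"
  unfolding unital_cstar_subalgebra_def
proof (intro conjI ballI allI)
  let ?S = "cstar.ev x ` ncpolys I"
  show "1 \<in> closure ?S"
    using closure_subset by (metis cstar.ev_1 imageI ncpolys_1 subsetD)
  show "closed (closure ?S)" by simp
  fix y z assume yz: "y \<in> closure ?S" "z \<in> closure ?S"
  obtain f where f: "\<And>n. f n \<in> ?S" "f \<longlonglongrightarrow> y"
    using yz(1) unfolding closure_sequential by blast
  obtain g where g: "\<And>n. g n \<in> ?S" "g \<longlonglongrightarrow> z"
    using yz(2) unfolding closure_sequential by blast
  have op: "(\<lambda>n. f n + g n) \<longlonglongrightarrow> y + z" "(\<lambda>n. f n * g n) \<longlonglongrightarrow> y * z"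
    using f g by (auto intro: tendsto_intros)
  have "f n + g n \<in> ?S" "f n * g n \<in> ?S" for n
    using f(1)[of n] g(1)[of n] by (auto simp: ncpolys_add ncpolys_mult simp flip: cstar.ev_add cstar.ev_mult)
  then show "y + z \<in> closure ?S" "y * z \<in> closure ?S"
    unfolding closure_sequential
    by (rule_tac exI[of _ "\<lambda>n. f n + g n"], simp add: op, rule_tac exI[of _ "\<lambda>n. f n * g n"], simp add: op)
next
  let ?S = "cstar.ev x ` ncpolys I"
  fix c y assume y: "y \<in> closure ?S"
  obtain f where f: "\<And>n. f n \<in> ?S" "f \<longlonglongrightarrow> y"
    using y unfolding closure_sequential by blast
  have "(\<lambda>n. scaleC c (f n)) \<longlonglongrightarrow> scaleC c y" "(\<lambda>n. adj (f n)) \<longlonglongrightarrow> adj y"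
    using f bounded_linear.tendsto[OF bounded_linear_scaleC] bounded_linear.tendsto[OF bounded_linear_adj] by auto
  moreover have "scaleC c (f n) \<in> ?S" "adj (f n) \<in> ?S" for n
    using f(1)[of n] by (auto simp: ncpolys_scale ncpolys_adj simp flip: cstar.ev_scale cstar.ev_adj)
  ultimately show "scaleC c y \<in> closure ?S" "adj y \<in> closure ?S"
    unfolding closure_sequential
    by (rule_tac exI[of _ "\<lambda>n. scaleC c (f n)"], simp, rule_tac exI[of _ "\<lambda>n. adj (f n)"], simp)
qed

lemma hull_approximation:
  assumes "y \<in> unital_cstar_subalgebra hull (x ` I)" "0 < \<epsilon>"
  obtains P where "P \<in> ncpolys I" "norm (y - cstar.ev x P) < \<epsilon>"
proof -
  have "x ` I \<subseteq> closure (cstar.ev x ` ncpolys I)"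
    using closure_subset by (smt (verit) cstar.ev_var image_subset_iff ncpolys_var subsetD)
  then have "y \<in> closure (cstar.ev x ` ncpolys I)"
    using hull_minimal[where S=unital_cstar_subalgebra, OF _ unital_cstar_subalgebra_closure] assms(1) by blast
  then show thesis using that assms(2) unfolding closure_approachable by (metis dist_commute dist_norm imageE)
qed

text \<open>
  An element of the generated C*-algebra is a norm limit of polynomials, and the seminorm of each trace is
  dominated by the operator norm and by the uniform 2-norm. The operator norm of \<open>P\<close> at \<open>x\<close> is not
  controlled; that is what the cutoff is for.
\<close>

lemma generator_approximation:
  assumes T: "T \<subseteq> tracial_states UNIV" and A: "unital_cstar_subalgebra A"
    and gen: "generates A (restrict_functionals A T) I x" and y: "y \<in> A" and \<epsilon>: "0 < \<epsilon>"
  shows "\<exists>P\<in>ncpolys I. \<forall>\<tau>\<in>T. trace_seminorm \<tau> (y - cstar.ev x P) < \<epsilon>"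
proof -
  obtain z where z: "z \<in> unital_cstar_subalgebra hull (x ` I)"
    "norm2 (restrict_functionals A T) (y - z) < \<epsilon> / 2"
    using gen y half_gt_zero[OF \<epsilon>] unfolding generates_def by blast
  have "unital_cstar_subalgebra hull (x ` I) \<subseteq> A"
    using gen A by (intro hull_minimal) (auto simp: generates_def)
  then have "z \<in> A" using z by blast
  then have "y + scaleC (- 1) z \<in> A" using A y by (simp add: unital_cstar_subalgebra_def)
  then have "y - z \<in> A" by (simp add: cstar.sc_minus_one)
  then have "adj (y - z) * (y - z) \<in> A" using A by (simp add: unital_cstar_subalgebra_def)
  then have n2: "norm2 (restrict_functionals A T) (y - z) = norm2 T (y - z)"
    unfolding norm2_def image_image by simp
  obtain P where P: "P \<in> ncpolys I" "norm (z - cstar.ev x P) < \<epsilon> / 2"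
    using hull_approximation[OF z(1) half_gt_zero[OF \<epsilon>]] by blast
  have "trace_seminorm \<tau> (y - cstar.ev x P) < \<epsilon>" if "\<tau> \<in> T" for \<tau>
  proof -
    have \<tau>: "\<tau> \<in> tracial_states UNIV" using T that by blast
    interpret t: tracial_functional adj scaleC \<tau> by (rule tracial_state_functional) fact
    show ?thesis
      using t.seminorm_triangle_diff[of y "cstar.ev x P" z] trace_seminorm_le_norm[OF \<tau>, of "z - cstar.ev x P"]
        trace_seminorm_le_norm2[OF T that, of "y - z"] z(2) P(2) n2 by simp
  qed
  with P(1) show ?thesis by blast
qed

section \<open>Matrices as quotients of a free algebra\<close>

lemma mat_adjoint_dim [simp]: "dim_row (mat_adjoint B) = dim_col B" "dim_col (mat_adjoint B) = dim_row B"
  by (auto simp: mat_adjoint_def)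

lemma mat_adjoint_carrier [simp]: "B \<in> carrier_mat N N \<Longrightarrow> mat_adjoint B \<in> carrier_mat N N"
  by (intro carrier_matI) auto

lemma mat_adjoint_index [simp]:
  "i < dim_col B \<Longrightarrow> j < dim_row B \<Longrightarrow> mat_adjoint B $$ (i, j) = cnj (B $$ (j, i))"
  by (simp add: mat_adjoint_def mat_of_rows_index)

lemma mat_adjoint_adjoint: "mat_adjoint (mat_adjoint B) = (B :: complex mat)"
  by (rule eq_matI) auto

lemma mat_mult_index_sum:
  "A \<in> carrier_mat N N \<Longrightarrow> B \<in> carrier_mat N N \<Longrightarrow> i < N \<Longrightarrow> j < N \<Longrightarrow>
    (A * B) $$ (i, j) = (\<Sum>k<N. A $$ (i, k) * (B $$ (k, j) :: complex))"
  by (simp add: scalar_prod_def atLeast0LessThan)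

lemma mat_adjoint_mult:
  assumes A: "A \<in> carrier_mat N N" and B: "B \<in> carrier_mat N N"
  shows "mat_adjoint (A * B) = mat_adjoint B * (mat_adjoint A :: complex mat)"
proof (rule eq_matI)
  fix i j assume "i < dim_row (mat_adjoint B * mat_adjoint A)" "j < dim_col (mat_adjoint B * mat_adjoint A)"
  then have ij: "i < N" "j < N" using A B by auto
  then have "mat_adjoint (A * B) $$ (i, j) = cnj ((A * B) $$ (j, i))"
    using A B by (intro mat_adjoint_index) auto
  also have "\<dots> = (mat_adjoint B * mat_adjoint A) $$ (i, j)"
    using ij A B by (auto simp: mat_mult_index_sum[where N=N] mult.commute simp del: index_mult_mat intro!: sum.cong)
  finally show "mat_adjoint (A * B) $$ (i, j) = (mat_adjoint B * mat_adjoint A) $$ (i, j)" .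
qed (use A B in auto)

lemma mat_adjoint_add:
  assumes "A \<in> carrier_mat N N" "B \<in> carrier_mat N N"
  shows "mat_adjoint (A + B) = mat_adjoint A + (mat_adjoint B :: complex mat)"
  using assms by (intro eq_matI) auto

lemma mat_adjoint_smult: "mat_adjoint (c \<cdot>\<^sub>m A) = cnj c \<cdot>\<^sub>m (mat_adjoint A :: complex mat)"
  by (intro eq_matI) auto

lemma mat_adjoint_one: "mat_adjoint (1\<^sub>m N) = (1\<^sub>m N :: complex mat)"
  by (intro eq_matI) auto

definition word_mat :: "nat \<Rightarrow> ('i \<Rightarrow> complex mat) \<Rightarrow> 'i letter list \<Rightarrow> complex mat" where
  "word_mat N A as = foldr (*) (map (letter_mat A) as) (1\<^sub>m N)"

context
  fixes N :: nat and A :: "'i \<Rightarrow> complex mat"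
  assumes A: "\<And>i. A i \<in> carrier_mat N N"
begin

lemma letter_mat_carrier: "letter_mat A a \<in> carrier_mat N N"
  using A by (cases a) auto

lemma word_mat_Nil [simp]: "word_mat N A [] = 1\<^sub>m N"
  by (simp add: word_mat_def)

lemma word_mat_Cons [simp]: "word_mat N A (a # as) = letter_mat A a * word_mat N A as"
  by (simp add: word_mat_def)

lemma word_mat_carrier [simp]: "word_mat N A as \<in> carrier_mat N N"
  by (induction as) (auto intro: mult_carrier_mat[OF letter_mat_carrier])

lemma ncpoly_mat_carrier [simp]: "ncpoly_mat N A P \<in> carrier_mat N N"
  by (simp add: ncpoly_mat_def)

lemma ncpoly_mat_dim [simp]: "dim_row (ncpoly_mat N A P) = N" "dim_col (ncpoly_mat N A P) = N"
  by (simp_all add: ncpoly_mat_def)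

lemma ncpoly_mat_index: "r < N \<Longrightarrow> s < N \<Longrightarrow> ncpoly_mat N A P $$ (r, s) =
   (\<Sum>w\<in>Poly_Mapping.keys P. Poly_Mapping.lookup P w * word_mat N A (letters w) $$ (r, s))"
  by (simp add: ncpoly_mat_def word_mat_def)

lemma ncpoly_mat_add: "ncpoly_mat N A (P + Q) = ncpoly_mat N A P + ncpoly_mat N A Q"
proof (rule eq_matI)
  fix r s assume "r < dim_row (ncpoly_mat N A P + ncpoly_mat N A Q)"
    "s < dim_col (ncpoly_mat N A P + ncpoly_mat N A Q)"
  then have rs: "r < N" "s < N" by (auto simp: ncpoly_mat_def)
  have "(\<Sum>w\<in>Poly_Mapping.keys (P + Q). Poly_Mapping.lookup (P + Q) w * word_mat N A (letters w) $$ (r, s)) =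
     (\<Sum>w\<in>Poly_Mapping.keys P. Poly_Mapping.lookup P w * word_mat N A (letters w) $$ (r, s)) +
     (\<Sum>w\<in>Poly_Mapping.keys Q. Poly_Mapping.lookup Q w * word_mat N A (letters w) $$ (r, s))"
    by (rule setsum_keys_plus_distrib) (auto simp: distrib_right)
  moreover have "(ncpoly_mat N A P + ncpoly_mat N A Q) $$ (r, s) = ncpoly_mat N A P $$ (r, s) + ncpoly_mat N A Q $$ (r, s)"
    using rs by (simp add: ncpoly_mat_def)
  ultimately show "ncpoly_mat N A (P + Q) $$ (r, s) = (ncpoly_mat N A P + ncpoly_mat N A Q) $$ (r, s)"
    using rs by (simp only: ncpoly_mat_index)
qed (auto simp: ncpoly_mat_def)

lemma ncpoly_mat_single: "ncpoly_mat N A (Poly_Mapping.single w c) = c \<cdot>\<^sub>m word_mat N A (letters w)"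
proof (rule eq_matI)
  have d: "dim_row (word_mat N A (letters w)) = N" "dim_col (word_mat N A (letters w)) = N"
    using carrier_matD[OF word_mat_carrier] by blast+
  show "dim_row (ncpoly_mat N A (Poly_Mapping.single w c)) = dim_row (c \<cdot>\<^sub>m word_mat N A (letters w))"
    "dim_col (ncpoly_mat N A (Poly_Mapping.single w c)) = dim_col (c \<cdot>\<^sub>m word_mat N A (letters w))"
    using d by (auto simp: ncpoly_mat_def)
  fix r s assume "r < dim_row (c \<cdot>\<^sub>m word_mat N A (letters w))" "s < dim_col (c \<cdot>\<^sub>m word_mat N A (letters w))"
  then show "ncpoly_mat N A (Poly_Mapping.single w c) $$ (r, s) = (c \<cdot>\<^sub>m word_mat N A (letters w)) $$ (r, s)"
    using d by (simp add: ncpoly_mat_index)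
qed

lemma ncpoly_mat_one: "ncpoly_mat N A 1 = 1\<^sub>m N"
  using ncpoly_mat_single[of 0 1] carrier_matD[OF word_mat_carrier[of "[]"]]
  by (auto simp: zero_sword_def simp flip: single_one intro!: eq_matI)

lemma word_mat_append: "word_mat N A (as @ bs) = word_mat N A as * word_mat N A bs"
  by (induction as) (auto simp: assoc_mult_mat[OF letter_mat_carrier word_mat_carrier word_mat_carrier]
      left_mult_one_mat[OF word_mat_carrier])

lemma ncpoly_mat_mult: "ncpoly_mat N A (P * Q) = ncpoly_mat N A P * ncpoly_mat N A Q"
proof (induction P rule: poly_mapping_induct)
  case (single v c)
  show ?case
  proof (induction Q rule: poly_mapping_induct)
    case (single w d)
    have smult_smult: "a \<cdot>\<^sub>m (b \<cdot>\<^sub>m M) = (a * b) \<cdot>\<^sub>m M" for a b and M :: "complex mat"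
      by (intro eq_matI) (auto simp: mult.assoc)
    note C = word_mat_carrier[of "letters v"] word_mat_carrier[of "letters w"]
    show ?case
      unfolding mult_single ncpoly_mat_single
      by (simp add: plus_sword_def word_mat_append mult_smult_assoc_mat[OF C(1) smult_carrier_mat[OF C(2)]]
          mult_smult_distrib[OF C] smult_smult)
  next
    case (sum f g)
    then show ?case
      by (simp add: distrib_left ncpoly_mat_add
          mult_add_distrib_mat[OF ncpoly_mat_carrier ncpoly_mat_carrier ncpoly_mat_carrier])
  qed
next
  case (sum f g)
  then show ?case
    by (simp add: distrib_right ncpoly_mat_add
          add_mult_distrib_mat[OF ncpoly_mat_carrier ncpoly_mat_carrier ncpoly_mat_carrier])
qed

lemma letter_mat_adj: "letter_mat A (letter_adj a) = mat_adjoint (letter_mat A a)"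
  by (cases a) (auto simp: mat_adjoint_adjoint)

lemma word_mat_adj: "word_mat N A (rev (map letter_adj as)) = mat_adjoint (word_mat N A as)"
proof (induction as)
  case (Cons a as)
  have "word_mat N A [letter_adj a] = mat_adjoint (letter_mat A a)"
    by (simp add: letter_mat_adj right_mult_one_mat[OF mat_adjoint_carrier[OF letter_mat_carrier]])
  with Cons show ?case
    by (simp only: rev.simps list.map word_mat_append word_mat_Cons mat_adjoint_mult[OF letter_mat_carrier word_mat_carrier])
qed (simp add: mat_adjoint_one)

lemma ncpoly_mat_adj: "ncpoly_mat N A (ncpoly_adj P) = mat_adjoint (ncpoly_mat N A P)"
proof (induction P rule: poly_mapping_induct)
  case (single w c)
  show ?case
    by (simp add: ncpoly_mat_single sword_adj_def word_mat_adj mat_adjoint_smult)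
next
  case (sum f g)
  then show ?case
    by (simp add: ncpoly_adj_add ncpoly_mat_add mat_adjoint_add[OF ncpoly_mat_carrier ncpoly_mat_carrier])
qed

lemma ncpoly_mat_scale: "ncpoly_mat N A (ncpoly_scale c P) = c \<cdot>\<^sub>m ncpoly_mat N A P"
proof -
  have "(c \<cdot>\<^sub>m 1\<^sub>m N) * ncpoly_mat N A P = c \<cdot>\<^sub>m (1\<^sub>m N * ncpoly_mat N A P)"
    by (rule mult_smult_assoc_mat[OF one_carrier_mat ncpoly_mat_carrier])
  then show ?thesis
    by (simp add: ncpoly_scale_def ncpoly_mat_mult ncpoly_mat_single zero_sword_def
        left_mult_one_mat[OF ncpoly_mat_carrier])
qed

lemma ncpoly_mat_var: "ncpoly_mat N A (ncpoly_var i) = A i"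
  using A[of i] by (auto simp: ncpoly_var_def ncpoly_mat_single intro!: eq_matI)

text \<open>
  The sum over words is compared entrywise, like in the definition of \<open>ncpoly_mat\<close>.
\<close>

lemma ncpoly_mat_ev: "ncpoly_mat N A (free.ev Q P) = ncpoly_mat N (\<lambda>i. ncpoly_mat N A (Q i)) P"
proof -
  let ?B = "\<lambda>i. ncpoly_mat N A (Q i)"
  have l: "ncpoly_mat N A (free.letter_ev Q a) = letter_mat ?B a" for a
    by (cases a) (auto simp: free.letter_ev_def ncpoly_mat_adj)
  have "ncpoly_mat N A (prod_list (map (free.letter_ev Q) as)) = foldr (*) (map (letter_mat ?B) as) (1\<^sub>m N)" for as
    by (induction as) (auto simp: ncpoly_mat_one ncpoly_mat_mult l)
  then have w: "ncpoly_mat N A (free.word_ev Q w) = foldr (*) (map (letter_mat ?B) (letters w)) (1\<^sub>m N)" for w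
    by (simp add: free.word_ev_def)
  have sum: "ncpoly_mat N A (sum f X) $$ (r, s) = (\<Sum>x\<in>X. ncpoly_mat N A (f x) $$ (r, s))"
    if "finite X" "r < N" "s < N" for f :: "_ \<Rightarrow> 'i ncpoly" and X :: "'k sword set" and r s
    using that
  proof (induction X)
    case empty
    then show ?case by (simp add: ncpoly_mat_def)
  next
    case (insert x X)
    then have "ncpoly_mat N A (sum f (insert x X)) = ncpoly_mat N A (f x) + ncpoly_mat N A (sum f X)"
      by (simp add: ncpoly_mat_add)
    with insert show ?case by (simp add: ncpoly_mat_def)
  qed
  show ?thesis
  proof (rule eq_matI)
    fix r s assume "r < dim_row (ncpoly_mat N ?B P)" "s < dim_col (ncpoly_mat N ?B P)"
    then have rs: "r < N" "s < N" by (auto simp: ncpoly_mat_def)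
    have "ncpoly_mat N A (ncpoly_scale c (free.word_ev Q w)) $$ (r, s) =
        c * foldr (*) (map (letter_mat ?B) (letters w)) (1\<^sub>m N) $$ (r, s)" for c w
    proof -
      show ?thesis using rs unfolding ncpoly_mat_scale w[symmetric]
        by (simp add: ncpoly_mat_dim)
    qed
    then show "ncpoly_mat N A (free.ev Q P) $$ (r, s) = ncpoly_mat N ?B P $$ (r, s)"
      unfolding free.ev_def using rs by (simp add: sum) (simp add: ncpoly_mat_def)
  qed (auto simp: ncpoly_mat_def)
qed

end

lemma ncpoly_mat_cong:
  assumes P: "P \<in> ncpolys I" and "\<And>i. i \<in> I \<Longrightarrow> A i = B i"
  shows "ncpoly_mat N A P = ncpoly_mat N B P"
proof -
  have *: "map (letter_mat A) (letters w) = map (letter_mat B) (letters w)" if "w \<in> Poly_Mapping.keys P" for w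
  proof (rule map_cong[OF refl])
    fix a assume a: "a \<in> set (letters w)"
    have "set_sword w \<subseteq> I" using P that by (auto simp: ncpolys_def)
    then have "set_letter a \<subseteq> I" using a by (cases w) auto
    then show "letter_mat A a = letter_mat B a" using assms(2) by (cases a) auto
  qed
  show ?thesis unfolding ncpoly_mat_def
    by (intro cong_mat refl, simp only: prod.case, rule sum.cong, rule refl, simp only: *)
qed

lemma cscalar_prod_self:
  assumes "v \<in> carrier_vec N"
  shows "scalar_prod v (conjugate v) = of_real (\<Sum>i<N. (cmod (v $ i))\<^sup>2)"
proof -
  have "scalar_prod v (conjugate v) = (\<Sum>i<N. v $ i * cnj (v $ i))"
    using assms by (simp add: scalar_prod_def atLeast0LessThan)
  then show ?thesis by (simp only: of_real_sum complex_norm_square)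
qed

lemma cvec_norm_eq: "v \<in> carrier_vec N \<Longrightarrow> cvec_norm v = sqrt (\<Sum>i<N. (cmod (v $ i))\<^sup>2)"
  by (simp only: cvec_norm_def cscalar_prod_self Re_complex_of_real)

lemma cvec_norm_sq: "v \<in> carrier_vec N \<Longrightarrow> (cvec_norm v)\<^sup>2 = (\<Sum>i<N. (cmod (v $ i))\<^sup>2)"
  by (simp add: cvec_norm_eq sum_nonneg)

lemma cvec_norm_nonneg: "v \<in> carrier_vec N \<Longrightarrow> 0 \<le> cvec_norm v"
  by (simp add: cvec_norm_eq sum_nonneg)

lemma cvec_norm_smult: "v \<in> carrier_vec N \<Longrightarrow> cvec_norm (c \<cdot>\<^sub>v v) = cmod c * cvec_norm v"
  by (simp add: cvec_norm_eq[of _ N] norm_mult power_mult_distrib real_sqrt_mult flip: sum_distrib_left)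

text \<open>
  The supremum of an unbounded set of reals is an unspecified number, so this is what makes the operator
  norm an upper bound.
\<close>

lemma opnorm_bdd_above:
  assumes X: "X \<in> carrier_mat N N"
  shows "bdd_above ((\<lambda>v. cvec_norm (X *\<^sub>v v)) ` {v \<in> carrier_vec (dim_col X). cvec_norm v \<le> 1})"
proof (rule bdd_aboveI2)
  fix v assume "v \<in> {v \<in> carrier_vec (dim_col X). cvec_norm v \<le> 1}"
  then have v: "v \<in> carrier_vec N" "cvec_norm v \<le> 1" using X by auto
  have v1: "cmod (v $ j) \<le> 1" if "j < N" for j
  proof -
    have "(cmod (v $ j))\<^sup>2 \<le> (cvec_norm v)\<^sup>2"
      unfolding cvec_norm_sq[OF v(1)] using that by (intro member_le_sum) auto
    also have "\<dots> \<le> 1" using v(2) by (rule power_le_one[OF cvec_norm_nonneg[OF v(1)]])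
    finally show ?thesis by (simp add: abs_square_le_1)
  qed
  have "cmod ((X *\<^sub>v v) $ i) \<le> (\<Sum>j<N. cmod (X $$ (i, j)))" if "i < N" for i
  proof -
    have "(X *\<^sub>v v) $ i = (\<Sum>j<N. X $$ (i, j) * v $ j)"
      using X v that by (simp add: scalar_prod_def atLeast0LessThan)
    also have "cmod \<dots> \<le> (\<Sum>j<N. cmod (X $$ (i, j) * v $ j))" by (rule norm_sum)
    also have "\<dots> \<le> (\<Sum>j<N. cmod (X $$ (i, j)))"
      using v1 by (intro sum_mono) (simp add: norm_mult mult_left_le)
    finally show ?thesis .
  qed
  then show "cvec_norm (X *\<^sub>v v) \<le> sqrt (\<Sum>i<N. (\<Sum>j<N. cmod (X $$ (i, j)))\<^sup>2)"
    using X v by (subst cvec_norm_eq[of _ N]) (auto intro!: sum_mono power_mono)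
qed

lemma opnorm_bound:
  assumes X: "X \<in> carrier_mat N N" and R: "mat_opnorm X \<le> R" and v: "v \<in> carrier_vec N"
  shows "cvec_norm (X *\<^sub>v v) \<le> R * cvec_norm v"
proof (cases "cvec_norm v = 0")
  case True
  have "(\<Sum>i<N. (cmod (v $ i))\<^sup>2) = 0" using True cvec_norm_sq[OF v] by simp
  then have "v $ i = 0" if "i < N" for i using that by (simp add: sum_nonneg_eq_0_iff)
  then have "X *\<^sub>v v = 0\<^sub>v N" using X v by (intro eq_vecI) (auto simp: scalar_prod_def)
  then show ?thesis using True by (simp add: cvec_norm_eq[of _ N])
next
  case False
  then have n: "0 < cvec_norm v" using cvec_norm_eq[OF v] by (simp add: sum_nonneg order_less_le)
  define u where "u = of_real (1 / cvec_norm v) \<cdot>\<^sub>v v"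
  have u: "u \<in> carrier_vec N" "cvec_norm u \<le> 1"
    using v n unfolding u_def by (auto simp: cvec_norm_smult[OF v] norm_divide)
  then have "cvec_norm (X *\<^sub>v u) \<le> R"
    using R X unfolding mat_opnorm_def
    by (intro order_trans[OF cSUP_upper[OF _ opnorm_bdd_above[OF X]]]) auto
  moreover have "X *\<^sub>v u = of_real (1 / cvec_norm v) \<cdot>\<^sub>v (X *\<^sub>v v)"
    unfolding u_def using X v by (rule mult_mat_vec)
  moreover have "X *\<^sub>v v \<in> carrier_vec N" using X v by simp
  ultimately show ?thesis using n by (simp add: cvec_norm_smult[where N=N] norm_divide field_simps)
qed

lemma opnorm_leI:
  assumes X: "X \<in> carrier_mat N N" and R: "0 \<le> R"
    and le: "\<And>v. v \<in> carrier_vec N \<Longrightarrow> cvec_norm (X *\<^sub>v v) \<le> R * cvec_norm v"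
  shows "mat_opnorm X \<le> R"
  unfolding mat_opnorm_def
proof (rule cSUP_least)
  show "{v \<in> carrier_vec (dim_col X). cvec_norm v \<le> 1} \<noteq> {}"
    by (auto intro!: exI[of _ "0\<^sub>v (dim_col X)"] simp: cvec_norm_def)
  fix v assume "v \<in> {v \<in> carrier_vec (dim_col X). cvec_norm v \<le> 1}"
  then show "cvec_norm (X *\<^sub>v v) \<le> R"
    using le[of v] X mult_left_le[OF _ R, of "cvec_norm v"] by (auto intro: order_trans)
qed

text \<open>
  Matrices of a given size do not form a type, but they are the image of the free algebra with one
  variable for every complex matrix: the variable of a matrix of the right size goes to that matrix,
  all others to zero. Functionals on matrices become functionals on this algebra, and everything
  proved for star-algebras applies to matrices of every size \<open>N\<close>.
\<close>

definition mat_rep :: "nat \<Rightarrow> complex mat ncpoly \<Rightarrow> complex mat" where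
  "mat_rep N = ncpoly_mat N (\<lambda>M. if M \<in> carrier_mat N N then M else 0\<^sub>m N N)"

lemma mat_rep_carrier [simp]: "mat_rep N P \<in> carrier_mat N N"
  and mat_rep_add: "mat_rep N (P + Q) = mat_rep N P + mat_rep N Q"
  and mat_rep_mult: "mat_rep N (P * Q) = mat_rep N P * mat_rep N Q"
  and mat_rep_one: "mat_rep N 1 = 1\<^sub>m N"
  and mat_rep_adj: "mat_rep N (ncpoly_adj P) = mat_adjoint (mat_rep N P)"
  and mat_rep_scale: "mat_rep N (ncpoly_scale c P) = c \<cdot>\<^sub>m mat_rep N P"
  and mat_rep_ev: "mat_rep N (free.ev X S) = ncpoly_mat N (\<lambda>i. mat_rep N (X i)) S"
  unfolding mat_rep_def
  by (simp_all add: ncpoly_mat_carrier ncpoly_mat_add ncpoly_mat_mult ncpoly_mat_one ncpoly_mat_adj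
      ncpoly_mat_scale ncpoly_mat_ev)

lemma mat_rep_dim [simp]: "dim_row (mat_rep N P) = N" "dim_col (mat_rep N P) = N"
  using carrier_matD[OF mat_rep_carrier] by blast+

lemma mat_rep_var: "M \<in> carrier_mat N N \<Longrightarrow> mat_rep N (ncpoly_var M) = M"
  unfolding mat_rep_def by (subst ncpoly_mat_var) auto

definition vector_state :: "nat \<Rightarrow> complex vec \<Rightarrow> complex mat ncpoly \<Rightarrow> complex" where
  "vector_state N v P = scalar_prod (mat_rep N P *\<^sub>v v) (conjugate v)"

definition mat_trace :: "nat \<Rightarrow> complex mat ncpoly \<Rightarrow> complex" where
  "mat_trace N P = normalized_trace N (mat_rep N P)"

lemma scalar_prod_adjoint:
  assumes B: "B \<in> carrier_mat N N" and u: "u \<in> carrier_vec N" and v: "v \<in> carrier_vec N"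
  shows "scalar_prod (mat_adjoint B *\<^sub>v u) (conjugate v) = scalar_prod u (conjugate (B *\<^sub>v v :: complex vec))"
proof -
  have "scalar_prod (mat_adjoint B *\<^sub>v u) (conjugate v) = (\<Sum>i<N. \<Sum>j<N. cnj (B $$ (j, i)) * u $ j * cnj (v $ i))"
    using B u v by (simp add: scalar_prod_def atLeast0LessThan sum_distrib_right)
  also have "\<dots> = (\<Sum>j<N. \<Sum>i<N. cnj (B $$ (j, i)) * u $ j * cnj (v $ i))" by (rule sum.swap)
  also have "\<dots> = scalar_prod u (conjugate (B *\<^sub>v v))"
    using B u v by (simp add: scalar_prod_def atLeast0LessThan sum_distrib_left ac_simps)
  finally show ?thesis .
qed

lemma vector_state_star_mult:
  assumes v: "v \<in> carrier_vec N"
  shows "vector_state N v (ncpoly_adj P * Q) = scalar_prod (mat_rep N Q *\<^sub>v v) (conjugate (mat_rep N P *\<^sub>v v))"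
proof -
  have "mat_rep N (ncpoly_adj P * Q) *\<^sub>v v = mat_adjoint (mat_rep N P) *\<^sub>v (mat_rep N Q *\<^sub>v v)"
    unfolding mat_rep_mult mat_rep_adj
    by (rule assoc_mult_mat_vec[OF mat_adjoint_carrier[OF mat_rep_carrier] mat_rep_carrier v])
  then show ?thesis
    unfolding vector_state_def using scalar_prod_adjoint[OF mat_rep_carrier _ v, of "mat_rep N Q *\<^sub>v v" P]
      mult_mat_vec_carrier[OF mat_rep_carrier v] by simp
qed

lemma vector_state_functional:
  assumes v: "v \<in> carrier_vec N"
  shows "positive_functional ncpoly_adj ncpoly_scale (vector_state N v)"
proof (unfold_locales)
  note C = mult_mat_vec_carrier[OF mat_rep_carrier v]
  fix x y :: "complex mat ncpoly" and c
  show "vector_state N v (x + y) = vector_state N v x + vector_state N v y"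
    unfolding vector_state_def mat_rep_add
    using v by (subst add_mult_distrib_mat_vec[OF mat_rep_carrier mat_rep_carrier v])
      (rule add_scalar_prod_distrib[OF C C], simp)
  show "vector_state N v (ncpoly_scale c x) = c * vector_state N v x"
  proof -
    have "(c \<cdot>\<^sub>m mat_rep N x) *\<^sub>v v = c \<cdot>\<^sub>v (mat_rep N x *\<^sub>v v)"
      using v by (intro eq_vecI) (auto simp: scalar_prod_def sum_distrib_left mult.assoc intro!: sum.cong)
    then show ?thesis unfolding vector_state_def mat_rep_scale using C[of x] v by simp
  qed
  show "0 \<le> vector_state N v (ncpoly_adj x * x)"
    unfolding vector_state_star_mult[OF v] cscalar_prod_self[OF C] less_eq_complex_def by (simp add: sum_nonneg)
qed

lemma vector_state_seminorm:
  assumes v: "v \<in> carrier_vec N"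
  shows "positive_functional.seminorm ncpoly_adj (vector_state N v) P = cvec_norm (mat_rep N P *\<^sub>v v)"
proof -
  interpret v: positive_functional ncpoly_adj ncpoly_scale "vector_state N v"
    by (rule vector_state_functional) fact
  show ?thesis by (simp add: v.seminorm_def vector_state_star_mult[OF v] cvec_norm_def)
qed

abbreviation vector_bounded :: "nat \<Rightarrow> complex vec \<Rightarrow> real \<Rightarrow> complex mat ncpoly \<Rightarrow> bool" where
  "vector_bounded N v \<equiv> positive_functional.bounded_by ncpoly_adj (vector_state N v)"

lemma opnorm_imp_vector_bounded:
  assumes "mat_opnorm (mat_rep N x) \<le> K" and v: "v \<in> carrier_vec N"
  shows "vector_bounded N v K x"
proof -
  interpret v: positive_functional ncpoly_adj ncpoly_scale "vector_state N v"
    by (rule vector_state_functional) fact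
  have "mat_rep N (x * w) *\<^sub>v v = mat_rep N x *\<^sub>v (mat_rep N w *\<^sub>v v)" for w
    unfolding mat_rep_mult by (rule assoc_mult_mat_vec[OF mat_rep_carrier mat_rep_carrier v])
  then show ?thesis
    unfolding v.bounded_by_def vector_state_seminorm[OF v]
    using opnorm_bound[OF mat_rep_carrier assms(1) mult_mat_vec_carrier[OF mat_rep_carrier v]] by simp
qed

text \<open>
  The bound at \<open>w = 1\<close> in the vector state of \<open>v\<close> is the bound for the matrix applied to \<open>v\<close>.
\<close>

lemma vector_bounded_imp_opnorm:
  assumes "\<And>v. v \<in> carrier_vec N \<Longrightarrow> vector_bounded N v K x" and K: "0 \<le> K"
  shows "mat_opnorm (mat_rep N x) \<le> K"
proof (rule opnorm_leI[OF mat_rep_carrier K])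
  fix v :: "complex vec" assume v: "v \<in> carrier_vec N"
  interpret v: positive_functional ncpoly_adj ncpoly_scale "vector_state N v"
    by (rule vector_state_functional) fact
  have "1\<^sub>m N *\<^sub>v v = v" using v by simp
  then show "cvec_norm (mat_rep N x *\<^sub>v v) \<le> K * cvec_norm v"
    using v.bounded_byD[OF assms(1)[OF v], of 1] by (simp add: vector_state_seminorm[OF v] mat_rep_one)
qed

text \<open>
  Through this the normalized trace inherits positivity and bounds from the vector states.
\<close>

lemma mat_trace_eq_vector_states:
  "mat_trace N P = (\<Sum>i<N. vector_state N (unit_vec N i) P) / of_nat N"
proof -
  have "vector_state N (unit_vec N i) P = mat_rep N P $$ (i, i)" if "i < N" for i
  proof -
    have *: "(mat_rep N P *\<^sub>v unit_vec N i) $ j = mat_rep N P $$ (j, i)" if "j < N" for j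
    proof -
      have "(mat_rep N P *\<^sub>v unit_vec N i) $ j = (\<Sum>k<N. mat_rep N P $$ (j, k) * (if k = i then 1 else 0))"
        using that \<open>i < N\<close>
        by (auto simp: scalar_prod_def atLeast0LessThan unit_vec_def intro!: sum.cong)
      then show ?thesis using \<open>i < N\<close> by (simp add: if_distrib sum.delta cong: if_cong)
    qed
    have "vector_state N (unit_vec N i) P = (\<Sum>j<N. mat_rep N P $$ (j, i) * (if j = i then 1 else 0))"
      unfolding vector_state_def using * that
      by (auto simp: scalar_prod_def atLeast0LessThan unit_vec_def intro!: sum.cong)
    then show ?thesis using that by (simp add: if_distrib sum.delta cong: if_cong)
  qed
  then show ?thesis by (simp add: mat_trace_def normalized_trace_def)
qed

lemma mat_trace_functional:
  assumes N: "0 < N"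
  shows "tracial_functional ncpoly_adj ncpoly_scale (mat_trace N)"
proof (unfold_locales)
  have vs: "positive_functional ncpoly_adj ncpoly_scale (vector_state N (unit_vec N i))" for i
    by (rule vector_state_functional) simp
  fix x y :: "complex mat ncpoly" and c
  show "mat_trace N (x + y) = mat_trace N x + mat_trace N y"
    unfolding mat_trace_eq_vector_states
    by (simp add: positive_functional.l_add[OF vs] sum.distrib add_divide_distrib)
  show "mat_trace N (ncpoly_scale c x) = c * mat_trace N x"
    unfolding mat_trace_eq_vector_states
    by (simp add: positive_functional.l_sc[OF vs] sum_distrib_left)
  have "0 \<le> (\<Sum>i<N. vector_state N (unit_vec N i) (ncpoly_adj x * x))"
    by (intro sum_nonneg positive_functional.l_pos[OF vs])
  then show "0 \<le> mat_trace N (ncpoly_adj x * x)"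
    unfolding mat_trace_eq_vector_states by (simp add: less_eq_complex_def)
  show "mat_trace N (x * y) = mat_trace N (y * x)"
  proof -
    have "(\<Sum>i<N. (mat_rep N x * mat_rep N y) $$ (i, i)) = (\<Sum>i<N. \<Sum>k<N. mat_rep N x $$ (i, k) * mat_rep N y $$ (k, i))"
      by (intro sum.cong refl mat_mult_index_sum) auto
    also have "\<dots> = (\<Sum>k<N. \<Sum>i<N. mat_rep N y $$ (k, i) * mat_rep N x $$ (i, k))"
      by (subst sum.swap) (simp add: mult.commute)
    also have "\<dots> = (\<Sum>i<N. (mat_rep N y * mat_rep N x) $$ (i, i))"
      by (intro sum.cong refl mat_mult_index_sum[symmetric]) auto
    finally show ?thesis by (simp only: mat_trace_def mat_rep_mult normalized_trace_def)
  qed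
  show "mat_trace N 1 = 1"
    using N by (simp add: mat_trace_def mat_rep_one normalized_trace_def)
qed

abbreviation mat_seminorm :: "nat \<Rightarrow> complex mat ncpoly \<Rightarrow> real" where
  "mat_seminorm N \<equiv> positive_functional.seminorm ncpoly_adj (mat_trace N)"

abbreviation mat_bounded :: "nat \<Rightarrow> real \<Rightarrow> complex mat ncpoly \<Rightarrow> bool" where
  "mat_bounded N \<equiv> positive_functional.bounded_by ncpoly_adj (mat_trace N)"

lemma mat_seminorm_eq:
  assumes N: "0 < N"
  shows "mat_seminorm N P = mat_norm2 N (mat_rep N P)"
proof -
  interpret m: tracial_functional ncpoly_adj ncpoly_scale "mat_trace N"
    by (rule mat_trace_functional) fact
  show ?thesis by (simp add: m.seminorm_def mat_norm2_def mat_trace_def mat_rep_mult mat_rep_adj)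
qed

lemma vector_bounded_imp_mat_bounded:
  assumes b: "\<And>v. v \<in> carrier_vec N \<Longrightarrow> vector_bounded N v K x" and K: "0 \<le> K" and N: "0 < N"
  shows "mat_bounded N K x"
proof -
  interpret m: tracial_functional ncpoly_adj ncpoly_scale "mat_trace N"
    by (rule mat_trace_functional) fact
  have vs: "positive_functional ncpoly_adj ncpoly_scale (vector_state N (unit_vec N i))" for i
    by (rule vector_state_functional) simp
  let ?n = "\<lambda>i. positive_functional.seminorm ncpoly_adj (vector_state N (unit_vec N i))"
  have sq: "(m.seminorm w)\<^sup>2 = (\<Sum>i<N. (?n i w)\<^sup>2) / real N" for w
    unfolding m.seminorm_sq positive_functional.seminorm_sq[OF vs] mat_trace_eq_vector_states
    by simp
  show ?thesis
    unfolding m.bounded_by_def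
  proof
    fix w
    have "?n i (x * w) \<le> K * ?n i w" for i
      using positive_functional.bounded_byD[OF vs b] by simp
    then have "(m.seminorm (x * w))\<^sup>2 \<le> (\<Sum>i<N. (K * ?n i w)\<^sup>2) / real N"
      unfolding sq using positive_functional.seminorm_nonneg[OF vs]
      by (intro divide_right_mono sum_mono power_mono) auto
    also have "\<dots> = (K * m.seminorm w)\<^sup>2"
      by (simp add: power_mult_distrib sq sum_distrib_left)
    finally show "m.seminorm (x * w) \<le> K * m.seminorm w"
      by (rule power2_le_imp_le) (use K in simp)
  qed
qed

lemma opnorm_imp_mat_bounded:
  "mat_opnorm (mat_rep N x) \<le> K \<Longrightarrow> 0 \<le> K \<Longrightarrow> 0 < N \<Longrightarrow> mat_bounded N K x"
  using vector_bounded_imp_mat_bounded opnorm_imp_vector_bounded by blast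

section \<open>Neighbourhoods of the set of laws\<close>

text \<open>
  A uniform version of the definition of the weak-* topology: by compactness of \<open>T\<close>, finitely many test
  polynomials and one tolerance serve for all traces at once. Each trace has its own tests with
  tolerance \<open>e\<close>; traces are covered with half of it, the other half being left for \<open>\<phi>\<close>.
\<close>

lemma law_neighbourhood:
  fixes T :: "('b::cstar_algebra \<Rightarrow> complex) set"
  assumes T: "compactin (product_topology (\<lambda>_. euclidean) UNIV) T"
    and O: "openin (law_topology S I) \<O>" "laws_of T I x \<subseteq> \<O>"
  shows "\<exists>W \<kappa>. finite W \<and> W \<subseteq> ncpolys I \<and> 0 < \<kappa> \<and>
    (\<forall>\<tau>\<in>T. \<forall>\<phi>\<in>tracial_laws S I. (\<forall>P\<in>W. cmod (\<phi> P - \<tau> (cstar.ev x P)) < \<kappa>) \<longrightarrow> \<phi> \<in> \<O>)"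
proof -
  obtain U where U: "openin (product_topology (\<lambda>_. euclidean) (ncpolys I)) U" "\<O> = U \<inter> tracial_laws S I"
    using O(1) unfolding law_topology_def openin_subtopology by blast
  define good where "good \<tau> W e \<longleftrightarrow> finite W \<and> W \<subseteq> ncpolys I \<and> 0 < e \<and>
     (\<forall>\<phi>\<in>extensional (ncpolys I). (\<forall>P\<in>W. cmod (\<phi> P - \<tau> (cstar.ev x P)) < e) \<longrightarrow> \<phi> \<in> U)"
    for \<tau> W and e :: real
  have "\<exists>W e. good \<tau> W e" if "\<tau> \<in> T" for \<tau>
  proof -
    define l where "l = (\<lambda>P\<in>ncpolys I. \<tau> (cstar.ev x P))"
    have "l \<in> U"
      using O(2) that U(2) by (auto simp: laws_of_def l_def ncpoly_eval_eq_ev)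
    then obtain V where V: "finite {P \<in> ncpolys I. V P \<noteq> UNIV}" "\<And>P. P \<in> ncpolys I \<Longrightarrow> open (V P)"
      "l \<in> Pi\<^sub>E (ncpolys I) V" "Pi\<^sub>E (ncpolys I) V \<subseteq> U"
      using U(1) unfolding openin_product_topology_alt by auto
    define W where "W = {P \<in> ncpolys I. V P \<noteq> UNIV}"
    have "\<exists>e>0. \<forall>c. cmod (c - l P) < e \<longrightarrow> c \<in> V P" if "P \<in> W" for P
      using V(2)[of P] V(3) that unfolding open_dist W_def by (fastforce simp: dist_norm PiE_iff)
    then obtain d where d: "\<And>P. P \<in> W \<Longrightarrow> 0 < d P" "\<And>P c. P \<in> W \<Longrightarrow> cmod (c - l P) < d P \<Longrightarrow> c \<in> V P"
      by metis
    define e where "e = Min (insert 1 (d ` W))"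
    have W: "finite W" "W \<subseteq> ncpolys I" using V(1) by (auto simp: W_def)
    have e: "0 < e" "\<And>P. P \<in> W \<Longrightarrow> e \<le> d P" using W d(1) by (auto simp: e_def)
    have "\<phi> \<in> U" if \<phi>: "\<phi> \<in> extensional (ncpolys I)" "\<forall>P\<in>W. cmod (\<phi> P - \<tau> (cstar.ev x P)) < e" for \<phi>
    proof -
      have "\<phi> P \<in> V P" if P: "P \<in> ncpolys I" for P
      proof (cases "P \<in> W")
        case True
        then have "cmod (\<phi> P - l P) < d P" using \<phi>(2) e(2)[OF True] P by (fastforce simp: l_def)
        then show ?thesis by (rule d(2)[OF True])
      qed (use P in \<open>auto simp: W_def\<close>)
      then have "\<phi> \<in> Pi\<^sub>E (ncpolys I) V" using \<phi>(1) by (simp add: PiE_iff)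
      then show ?thesis using V(4) by blast
    qed
    then show ?thesis using W e(1) unfolding good_def by blast
  qed
  then obtain W e where "\<And>\<tau>. \<tau> \<in> T \<Longrightarrow> good \<tau> (W \<tau>) (e \<tau>)"
    by metis
  then have W: "finite (W \<tau>)" "W \<tau> \<subseteq> ncpolys I" and e: "0 < e \<tau>"
    and in_U: "\<And>\<phi>. \<phi> \<in> extensional (ncpolys I) \<Longrightarrow>
      (\<And>P. P \<in> W \<tau> \<Longrightarrow> cmod (\<phi> P - \<tau> (cstar.ev x P)) < e \<tau>) \<Longrightarrow> \<phi> \<in> U" if "\<tau> \<in> T" for \<tau>
    using that unfolding good_def by blast+
  define B where "B \<tau> = (\<Inter>P\<in>W \<tau>. {\<sigma>. cmod (\<sigma> (cstar.ev x P) - \<tau> (cstar.ev x P)) < e \<tau> / 2})" for \<tau>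
  have "compact T" using T by (simp add: euclidean_product_topology)
  moreover have "open (B \<tau>)" if "\<tau> \<in> T" for \<tau>
  proof -
    have "continuous_on UNIV (\<lambda>\<sigma> :: 'b \<Rightarrow> complex. \<sigma> y)" for y
      by (rule continuous_on_product_coordinates)
    then have "open {\<sigma> :: 'b \<Rightarrow> complex. cmod (\<sigma> y - c) < r}" for y c r
      by (intro open_Collect_less continuous_intros)
    then show ?thesis unfolding B_def using W(1)[OF that] by (intro open_INT ballI) blast+
  qed
  moreover have "T \<subseteq> (\<Union>\<tau>\<in>T. B \<tau>)" using e by (fastforce simp: B_def)
  ultimately obtain T' where T': "T' \<subseteq> T" "finite T'" "T \<subseteq> (\<Union>\<tau>\<in>T'. B \<tau>)"
    by (rule compactE_image)
  define \<kappa> where "\<kappa> = Min (insert 1 ((\<lambda>\<tau>. e \<tau> / 2) ` T'))"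
  have \<kappa>: "0 < \<kappa>" unfolding \<kappa>_def using T'(1,2) e by (subst Min_gr_iff) auto
  have \<kappa>_le: "\<kappa> \<le> e \<tau> / 2" if "\<tau> \<in> T'" for \<tau>
    unfolding \<kappa>_def by (rule Min_le) (use T'(2) that in auto)
  show ?thesis
  proof (intro exI[of _ "\<Union>\<tau>\<in>T'. W \<tau>"] exI[of _ \<kappa>] conjI ballI impI)
    show "finite (\<Union>\<tau>\<in>T'. W \<tau>)" "(\<Union>\<tau>\<in>T'. W \<tau>) \<subseteq> ncpolys I" using T' W by blast+
    show "0 < \<kappa>" by (rule \<kappa>)
    fix \<sigma> \<phi> assume \<sigma>: "\<sigma> \<in> T" and \<phi>: "\<phi> \<in> tracial_laws S I"
      "\<forall>P\<in>(\<Union>\<tau>\<in>T'. W \<tau>). cmod (\<phi> P - \<sigma> (cstar.ev x P)) < \<kappa>"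
    obtain \<tau> where \<tau>: "\<tau> \<in> T'" "\<sigma> \<in> B \<tau>" using T'(3) \<sigma> by blast
    have "cmod (\<phi> P - \<tau> (cstar.ev x P)) < e \<tau>" if "P \<in> W \<tau>" for P
    proof -
      have "cmod (\<phi> P - \<sigma> (cstar.ev x P)) < e \<tau> / 2"
        using bspec[OF \<phi>(2) UN_I[of \<tau> T' P W, OF \<tau>(1) that]] \<kappa>_le[OF \<tau>(1)] by linarith
      moreover have "cmod (\<sigma> (cstar.ev x P) - \<tau> (cstar.ev x P)) < e \<tau> / 2"
        using \<tau>(2) that by (auto simp: B_def)
      ultimately show ?thesis
        using norm_diff_triangle_less[of "\<phi> P" "\<sigma> (cstar.ev x P)" "e \<tau> / 2" "\<tau> (cstar.ev x P)" "e \<tau> / 2"] by simp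
    qed
    moreover have "\<phi> \<in> extensional (ncpolys I)" using \<phi>(1) by (simp add: tracial_laws_def)
    ultimately have "\<phi> \<in> U" using in_U[of \<tau>] \<tau>(1) T'(1) by blast
    then show "\<phi> \<in> \<O>" using U(2) \<phi>(1) by simp
  qed
qed

text \<open>
  For finite \<open>W\<close> these are neighbourhoods of the set of all laws of \<open>x\<close>, in the shape that
  \<open>law_neighbourhood\<close> extracts from an arbitrary one.
\<close>

definition law_tube :: "real \<Rightarrow> 'i set \<Rightarrow> ('b::cstar_algebra \<Rightarrow> complex) set \<Rightarrow> ('i \<Rightarrow> 'b) \<Rightarrow>
    'i ncpoly set \<Rightarrow> real \<Rightarrow> ('i ncpoly \<Rightarrow> complex) set" where
  "law_tube R I T x W \<kappa> = {\<phi> \<in> tracial_laws R I. \<exists>\<tau>\<in>T. \<forall>P\<in>W. cmod (\<phi> P - \<tau> (cstar.ev x P)) < \<kappa>}"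

lemma openin_law_tube:
  assumes W: "finite W" "W \<subseteq> ncpolys I"
  shows "openin (law_topology R I) (law_tube R I T x W \<kappa>)"
proof -
  let ?X = "product_topology (\<lambda>_. euclidean :: complex topology) (ncpolys I)"
  have "openin ?X ((\<Inter>P\<in>W. {\<phi> \<in> topspace ?X. cmod (\<phi> P - c P) < \<kappa>}) \<inter> topspace ?X)" for c
  proof (rule openin_INT[OF W(1)])
    fix P assume P: "P \<in> W"
    have "open {z. cmod (z - c P) < \<kappa>}"
      by (intro open_Collect_less continuous_intros)
    then have "openin ?X {\<phi> \<in> topspace ?X. \<phi> P \<in> {z. cmod (z - c P) < \<kappa>}}"
      using P W(2) by (intro openin_continuous_map_preimage[OF continuous_map_product_projection]) auto
    then show "openin ?X {\<phi> \<in> topspace ?X. cmod (\<phi> P - c P) < \<kappa>}" by simp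
  qed
  then have "openin ?X (\<Union>\<tau>\<in>T. (\<Inter>P\<in>W. {\<phi> \<in> topspace ?X. cmod (\<phi> P - \<tau> (cstar.ev x P)) < \<kappa>}) \<inter> topspace ?X)"
    by (intro openin_Union) auto
  moreover have "law_tube R I T x W \<kappa> =
    (\<Union>\<tau>\<in>T. (\<Inter>P\<in>W. {\<phi> \<in> topspace ?X. cmod (\<phi> P - \<tau> (cstar.ev x P)) < \<kappa>}) \<inter> topspace ?X) \<inter> tracial_laws R I"
    by (auto simp: law_tube_def tracial_laws_def PiE_UNIV_domain extensional_def)
  ultimately show ?thesis unfolding law_topology_def openin_subtopology by blast
qed

lemma laws_of_subset_law_tube:
  assumes T: "T \<subseteq> tracial_states UNIV" and x: "\<And>i. i \<in> I \<Longrightarrow> norm (x i) \<le> R"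
    and W: "W \<subseteq> ncpolys I" and pos: "0 < \<kappa>" "0 \<le> R"
  shows "laws_of T I x \<subseteq> law_tube R I T x W \<kappa>"
proof
  fix \<phi> assume "\<phi> \<in> laws_of T I x"
  then obtain \<tau> where \<tau>: "\<tau> \<in> T" "\<phi> = (\<lambda>P\<in>ncpolys I. \<tau> (cstar.ev x P))"
    by (auto simp: laws_of_def ncpoly_eval_eq_ev)
  have \<tau>': "\<tau> \<in> tracial_states UNIV" using T \<tau>(1) by blast
  interpret t: tracial_functional adj scaleC \<tau> by (rule tracial_state_functional) fact
  have "\<phi> \<in> tracial_laws R I"
    unfolding \<tau>(2) by (rule t.law_in_tracial_laws)
      (use x tracial_state_bounded_by_norm[OF \<tau>'] t.bounded_by_mono pos in blast)+
  moreover have "\<forall>P\<in>W. cmod (\<phi> P - \<tau> (cstar.ev x P)) < \<kappa>"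
    using W pos by (auto simp: \<tau>(2) subset_iff)
  ultimately show "\<phi> \<in> law_tube R I T x W \<kappa>" using \<tau>(1) by (auto simp: law_tube_def)
qed

section \<open>Unitary conjugation and transport of orbital covers\<close>

text \<open>
  A matrix tuple lifted to the free algebra. Outside \<open>I\<close>, where a tuple is \<open>undefined\<close>, the zero
  matrix is used.
\<close>

definition tuple_vars :: "nat \<Rightarrow> 'i set \<Rightarrow> ('i \<Rightarrow> complex mat) \<Rightarrow> 'i \<Rightarrow> complex mat ncpoly" where
  "tuple_vars N I X i = ncpoly_var (if i \<in> I then X i else 0\<^sub>m N N)"

lemma mat_rep_tuple_vars:
  assumes "X \<in> I \<rightarrow>\<^sub>E carrier_mat N N"
  shows "mat_rep N (tuple_vars N I X i) = (if i \<in> I then X i else 0\<^sub>m N N)"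
  unfolding tuple_vars_def using assms by (intro mat_rep_var) (auto simp: PiE_iff)

lemma mat_rep_ev_tuple_vars:
  assumes "X \<in> I \<rightarrow>\<^sub>E carrier_mat N N" "P \<in> ncpolys I"
  shows "mat_rep N (free.ev (tuple_vars N I X) P) = ncpoly_mat N X P"
  unfolding mat_rep_ev by (rule ncpoly_mat_cong[OF assms(2)]) (simp add: mat_rep_tuple_vars[OF assms(1)])

lemma matrix_law_eq:
  assumes "X \<in> I \<rightarrow>\<^sub>E carrier_mat N N"
  shows "matrix_law N I X = (\<lambda>P\<in>ncpolys I. mat_trace N (free.ev (tuple_vars N I X) P))"
  unfolding matrix_law_def mat_trace_def
  by (rule restrict_ext) (simp add: mat_rep_ev_tuple_vars[OF assms])

lemma matrix_law_in_tracial_laws: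
  assumes X: "X \<in> I \<rightarrow>\<^sub>E carrier_mat N N" and R: "\<And>i. i \<in> I \<Longrightarrow> mat_opnorm (X i) \<le> R" "0 \<le> R" and N: "0 < N"
  shows "matrix_law N I X \<in> tracial_laws R I"
proof -
  interpret m: tracial_functional ncpoly_adj ncpoly_scale "mat_trace N"
    by (rule mat_trace_functional) fact
  show ?thesis unfolding matrix_law_eq[OF X]
    by (rule m.law_in_tracial_laws)
      (use R N in \<open>auto intro!: opnorm_imp_mat_bounded simp: mat_rep_tuple_vars[OF X]\<close>)
qed

lemma mat_rep_diff: "mat_rep N (x - y) = mat_rep N x - mat_rep N y"
proof -
  have "mat_rep N x = mat_rep N (x - y) + mat_rep N y" by (simp flip: mat_rep_add)
  then have "mat_rep N x - mat_rep N y = mat_rep N (x - y) + mat_rep N y - mat_rep N y" by simp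
  also have "\<dots> = mat_rep N (x - y)" by (intro eq_matI) auto
  finally show ?thesis by simp
qed

lemma mat_norm2_conj:
  assumes "0 < N"
  shows "mat_norm2 N (mat_rep N c - mat_rep N u * mat_rep N b * mat_adjoint (mat_rep N u)) =
    mat_seminorm N (c - u * b * ncpoly_adj u)"
  by (simp add: mat_seminorm_eq[OF assms] mat_rep_diff mat_rep_mult mat_rep_adj)

lemma mat_seminorm_cong: "0 < N \<Longrightarrow> mat_rep N x = mat_rep N y \<Longrightarrow> mat_seminorm N x = mat_seminorm N y"
  by (simp add: mat_seminorm_eq)

text \<open>
  Elements of the free algebra that act as unitaries. The relations \<open>u\<^sup>* u = 1 = u u\<^sup>*\<close> hold only after
  applying \<open>mat_rep\<close>, so identities that use them are statements about images under \<open>mat_rep\<close>.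
\<close>

definition rep_unitary :: "nat \<Rightarrow> complex mat ncpoly \<Rightarrow> bool" where
  "rep_unitary N u \<longleftrightarrow> mat_rep N u \<in> unitary_mats N"

lemma rep_unitaryD:
  assumes "rep_unitary N u"
  shows "mat_rep N (ncpoly_adj u * u) = 1\<^sub>m N" "mat_rep N (u * ncpoly_adj u) = 1\<^sub>m N"
  using assms by (auto simp: rep_unitary_def unitary_mats_def mat_rep_mult mat_rep_adj)

lemma rep_unitaryI:
  "mat_rep N (ncpoly_adj u * u) = 1\<^sub>m N \<Longrightarrow> mat_rep N (u * ncpoly_adj u) = 1\<^sub>m N \<Longrightarrow> rep_unitary N u"
  by (auto simp: rep_unitary_def unitary_mats_def mat_rep_mult mat_rep_adj)

lemma rep_unitary_adj: "rep_unitary N u \<Longrightarrow> rep_unitary N (ncpoly_adj u)"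
  using rep_unitaryD by (intro rep_unitaryI) (auto simp: ncpoly_adj_adj)

lemma mat_rep_cancel:
  assumes "mat_rep N e = 1\<^sub>m N"
  shows "mat_rep N (x * (e * y)) = mat_rep N (x * y)"
  using assms by (simp add: mat_rep_mult left_mult_one_mat[OF mat_rep_carrier])

lemma mat_rep_cong_mult:
  "mat_rep N x = mat_rep N x' \<Longrightarrow> mat_rep N y = mat_rep N y' \<Longrightarrow> mat_rep N (x * y) = mat_rep N (x' * y')"
  by (simp add: mat_rep_mult)

lemma rep_unitary_mult:
  assumes "rep_unitary N u" "rep_unitary N v"
  shows "rep_unitary N (u * v)"
proof (rule rep_unitaryI)
  have "mat_rep N (ncpoly_adj v * ((ncpoly_adj u * u) * v)) = mat_rep N (ncpoly_adj v * v)"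
    by (rule mat_rep_cancel[OF rep_unitaryD(1)[OF assms(1)]])
  then show "mat_rep N (ncpoly_adj (u * v) * (u * v)) = 1\<^sub>m N"
    by (simp add: ncpoly_adj_mult mult.assoc rep_unitaryD[OF assms(2)])
  have "mat_rep N (u * ((v * ncpoly_adj v) * ncpoly_adj u)) = mat_rep N (u * ncpoly_adj u)"
    by (rule mat_rep_cancel[OF rep_unitaryD(2)[OF assms(2)]])
  then show "mat_rep N (u * v * ncpoly_adj (u * v)) = 1\<^sub>m N"
    by (simp add: ncpoly_adj_mult mult.assoc rep_unitaryD[OF assms(1)])
qed

lemma rep_unitary_bounded:
  assumes u: "rep_unitary N u" and N: "0 < N"
  shows "mat_bounded N 1 u"
proof -
  interpret m: tracial_functional ncpoly_adj ncpoly_scale "mat_trace N"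
    by (rule mat_trace_functional) fact
  have "mat_trace N (ncpoly_adj (u * w) * (u * w)) = mat_trace N (ncpoly_adj w * w)" for w
  proof -
    have "mat_rep N (ncpoly_adj w * ((ncpoly_adj u * u) * w)) = mat_rep N (ncpoly_adj w * w)"
      by (rule mat_rep_cancel[OF rep_unitaryD(1)[OF u]])
    then show ?thesis by (simp add: mat_trace_def ncpoly_adj_mult mult.assoc)
  qed
  then show ?thesis by (simp add: m.bounded_by_def m.seminorm_def)
qed

lemma mat_seminorm_conj_le:
  assumes u: "rep_unitary N u" and N: "0 < N"
  shows "mat_seminorm N (u * x * ncpoly_adj u) \<le> mat_seminorm N x"
proof -
  interpret m: tracial_functional ncpoly_adj ncpoly_scale "mat_trace N"
    by (rule mat_trace_functional) fact
  have "m.seminorm (u * x * ncpoly_adj u) \<le> m.seminorm (u * x)"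
    using m.seminorm_mult_right[OF rep_unitary_bounded[OF rep_unitary_adj[OF u] N]] by simp
  also have "\<dots> \<le> m.seminorm x"
    using m.bounded_byD[OF rep_unitary_bounded[OF u N]] by simp
  finally show ?thesis .
qed

text \<open>
  In a product of conjugated letters the inner factors \<open>u\<^sup>* u\<close> cancel.
\<close>

lemma mat_rep_ev_conj:
  assumes u: "rep_unitary N u"
  shows "mat_rep N (free.ev (\<lambda>i. u * x i * ncpoly_adj u) P) = mat_rep N (u * free.ev x P * ncpoly_adj u)"
proof -
  let ?c = "\<lambda>y. u * y * ncpoly_adj u"
  have l: "free.letter_ev (\<lambda>i. ?c (x i)) a = ?c (free.letter_ev x a)" for a
    by (cases a) (auto simp: free.letter_ev_def ncpoly_adj_mult ncpoly_adj_adj mult.assoc)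
  have "mat_rep N (prod_list (map (free.letter_ev (\<lambda>i. ?c (x i))) as)) = mat_rep N (?c (prod_list (map (free.letter_ev x) as)))" for as
  proof (induction as)
    case (Cons a as)
    let ?A = "free.letter_ev x a" and ?B = "prod_list (map (free.letter_ev x) as)"
    have "mat_rep N (prod_list (map (free.letter_ev (\<lambda>i. ?c (x i))) (a # as))) = mat_rep N (?c ?A * ?c ?B)"
      using Cons unfolding list.map prod_list.Cons l by (rule mat_rep_cong_mult[OF refl])
    also have "?c ?A * ?c ?B = u * ?A * ((ncpoly_adj u * u) * (?B * ncpoly_adj u))"
      by (simp add: mult.assoc)
    also have "mat_rep N \<dots> = mat_rep N (u * ?A * (?B * ncpoly_adj u))"
      by (rule mat_rep_cancel[OF rep_unitaryD(1)[OF u]])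
    finally show ?case by (simp add: mult.assoc)
  qed (simp add: rep_unitaryD[OF u] mat_rep_one)
  then have w: "mat_rep N (free.word_ev (\<lambda>i. ?c (x i)) w) = mat_rep N (?c (free.word_ev x w))" for w
    by (simp add: free.word_ev_def)
  have sum: "mat_rep N (sum f X) = mat_rep N (sum g X)" if "\<And>k. mat_rep N (f k) = mat_rep N (g k)"
    for f g :: "_ \<Rightarrow> complex mat ncpoly" and X
    by (induction X rule: infinite_finite_induct) (auto simp: mat_rep_add that)
  have "?c (free.ev x P) = (\<Sum>w\<in>Poly_Mapping.keys P. ncpoly_scale (Poly_Mapping.lookup P w) (?c (free.word_ev x w)))"
    by (simp add: free.ev_def sum_distrib_left sum_distrib_right free.mult_sc_left free.mult_sc_right)
  moreover have "mat_rep N (free.ev (\<lambda>i. ?c (x i)) P) =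
      mat_rep N (\<Sum>w\<in>Poly_Mapping.keys P. ncpoly_scale (Poly_Mapping.lookup P w) (?c (free.word_ev x w)))"
    unfolding free.ev_def by (rule sum) (simp only: mat_rep_scale w)
  ultimately show ?thesis by (simp only:)
qed

text \<open>
  Evaluation commutes with conjugation, and conjugation preserves the bounds on \<open>y\<close>, so that the Lipschitz
  estimate applies to \<open>x\<close> and the conjugated tuple.
\<close>

lemma ev_conj_Lipschitz:
  assumes N: "0 < N" and S: "0 \<le> S" and u: "rep_unitary N u" and P: "P \<in> ncpolys G"
    and x: "\<And>i. i \<in> G \<Longrightarrow> mat_bounded N S (x i)" and y: "\<And>i. i \<in> G \<Longrightarrow> mat_bounded N S (y i)"
    and xy: "\<And>i. i \<in> G \<Longrightarrow> mat_seminorm N (x i - u * y i * ncpoly_adj u) \<le> \<eta>" and \<eta>: "0 \<le> \<eta>"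
  shows "mat_seminorm N (free.ev x P - u * free.ev y P * ncpoly_adj u) \<le> Lipschitz_const S P * \<eta>"
proof -
  interpret m: tracial_functional ncpoly_adj ncpoly_scale "mat_trace N"
    by (rule mat_trace_functional) fact
  have "mat_bounded N S (u * y i * ncpoly_adj u)" if "i \<in> G" for i
  proof -
    have "mat_bounded N (1 * S * 1) (u * y i * ncpoly_adj u)"
      by (intro m.bounded_by_mult rep_unitary_bounded rep_unitary_adj u N y that) (use S in auto)
    then show ?thesis by simp
  qed
  then have "mat_seminorm N (free.ev x P - free.ev (\<lambda>i. u * y i * ncpoly_adj u) P) \<le> Lipschitz_const S P * \<eta>"
    using x xy \<eta> by (intro m.ev_Lipschitz[OF P])
  moreover have "mat_seminorm N (free.ev x P - free.ev (\<lambda>i. u * y i * ncpoly_adj u) P) =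
      mat_seminorm N (free.ev x P - u * free.ev y P * ncpoly_adj u)"
    by (intro mat_seminorm_cong N) (simp add: mat_rep_diff mat_rep_ev_conj[OF u])
  ultimately show ?thesis by simp
qed

text \<open>
  Conjugation by \<open>u u'\<^sup>*\<close> takes the conjugate of \<open>b\<close> by \<open>u'\<close> to its conjugate by \<open>u\<close> and does not increase
  the 2-norm.
\<close>

lemma mat_seminorm_conj_triangle:
  assumes N: "0 < N" and u: "rep_unitary N u" and u': "rep_unitary N u'"
  shows "mat_seminorm N (z - (u * ncpoly_adj u') * z' * ncpoly_adj (u * ncpoly_adj u')) \<le>
     mat_seminorm N (z - u * b * ncpoly_adj u) + mat_seminorm N (z' - u' * b * ncpoly_adj u')"
proof -
  interpret m: tracial_functional ncpoly_adj ncpoly_scale "mat_trace N"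
    by (rule mat_trace_functional) fact
  define v where "v = u * ncpoly_adj u'"
  have v: "rep_unitary N v" unfolding v_def by (intro rep_unitary_mult rep_unitary_adj u u')
  have "mat_rep N (v * (u' * b * ncpoly_adj u') * ncpoly_adj v) = mat_rep N (u * b * ncpoly_adj u)"
  proof -
    have "v * (u' * b * ncpoly_adj u') * ncpoly_adj v =
      u * ((ncpoly_adj u' * u') * (b * ((ncpoly_adj u' * u') * ncpoly_adj u)))"
      by (simp add: v_def ncpoly_adj_mult ncpoly_adj_adj mult.assoc)
    also have "mat_rep N \<dots> = mat_rep N (u * b * ((ncpoly_adj u' * u') * ncpoly_adj u))"
      using mat_rep_cancel[OF rep_unitaryD(1)[OF u']] by (simp add: mult.assoc)
    also have "\<dots> = mat_rep N (u * b * ncpoly_adj u)"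
      by (rule mat_rep_cancel[OF rep_unitaryD(1)[OF u']])
    finally show ?thesis .
  qed
  then have "mat_seminorm N (u * b * ncpoly_adj u - v * z' * ncpoly_adj v) =
      mat_seminorm N (v * (u' * b * ncpoly_adj u' - z') * ncpoly_adj v)"
    by (intro mat_seminorm_cong N) (simp add: right_diff_distrib left_diff_distrib mat_rep_diff)
  also have "\<dots> \<le> mat_seminorm N (u' * b * ncpoly_adj u' - z')" by (rule mat_seminorm_conj_le[OF v N])
  also have "\<dots> = mat_seminorm N (z' - u' * b * ncpoly_adj u')" by (rule m.seminorm_minus_commute)
  finally show ?thesis
    using m.seminorm_triangle_diff[of z "v * z' * ncpoly_adj v" "u * b * ncpoly_adj u"] unfolding v_def[symmetric] by simp
qed

text \<open>
  A map \<open>\<Phi>\<close> between sets of tuples carries covers of the target back to covers of the source as soon as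
  the relevant coordinates of \<open>X\<close> can be recovered, approximately, as polynomials in \<open>\<Phi> X\<close>. The members
  of a cover of \<open>\<Omega>'\<close> need not be in the image of \<open>\<Phi>\<close>; each one is replaced by some \<open>X\<close> whose image is close
  to it, if there is one, which accounts for the factor 2 in front of \<open>\<delta>\<close>.
\<close>

lemma orbital_covering_number_transport:
  fixes \<Phi> :: "('n \<Rightarrow> complex mat) \<Rightarrow> 'm \<Rightarrow> complex mat"
  assumes N: "0 < N" and S: "0 \<le> S"
    and \<Omega>: "\<And>X i. X \<in> \<Omega> \<Longrightarrow> i \<in> F \<Longrightarrow> X i \<in> carrier_mat N N"
    and \<Phi>: "\<And>X. X \<in> \<Omega> \<Longrightarrow> \<Phi> X \<in> \<Omega>'"
    and \<Omega>': "\<And>Y m. Y \<in> \<Omega>' \<Longrightarrow> m \<in> G \<Longrightarrow> Y m \<in> carrier_mat N N \<and> mat_opnorm (Y m) \<le> S"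
    and P: "\<And>i. i \<in> F \<Longrightarrow> P i \<in> ncpolys G"
    and near: "\<And>X i. X \<in> \<Omega> \<Longrightarrow> i \<in> F \<Longrightarrow> mat_norm2 N (X i - ncpoly_mat N (\<Phi> X) (P i)) \<le> \<epsilon>'"
    and small: "\<And>i. i \<in> F \<Longrightarrow> 2 * \<epsilon>' + Lipschitz_const S (P i) * (2 * \<delta>) < \<epsilon>" and \<delta>: "0 < \<delta>"
  shows "orbital_covering_number N F \<epsilon> \<Omega> \<le> orbital_covering_number N G \<delta> \<Omega>'"
  unfolding orbital_covering_number_def
proof (rule INF_greatest)
  interpret m: tracial_functional ncpoly_adj ncpoly_scale "mat_trace N"
    by (rule mat_trace_functional) fact
  fix \<Omega>0' assume "\<Omega>0' \<in> {\<Omega>0. finite \<Omega>0 \<and> orbital_cover N G \<delta> \<Omega>' \<Omega>0}"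
  then have fin: "finite \<Omega>0'" and sub: "\<Omega>0' \<subseteq> \<Omega>'"
    and cov: "\<And>C. C \<in> \<Omega>' \<Longrightarrow> \<exists>B\<in>\<Omega>0'. \<exists>U\<in>unitary_mats N. \<forall>m\<in>G. mat_norm2 N (C m - U * B m * mat_adjoint U) < \<delta>"
    unfolding orbital_cover_def by blast+
  define rel where "rel X B U \<longleftrightarrow> U \<in> unitary_mats N \<and> (\<forall>m\<in>G. mat_norm2 N (\<Phi> X m - U * B m * mat_adjoint U) < \<delta>)" for X B U
  define pick where "pick B = (SOME X. X \<in> \<Omega> \<and> (\<exists>U. rel X B U))" for B
  define \<Omega>0 where "\<Omega>0 = pick ` {B \<in> \<Omega>0'. \<exists>X\<in>\<Omega>. \<exists>U. rel X B U}"
  have pick: "pick B \<in> \<Omega> \<and> (\<exists>U. rel (pick B) B U)" if "X \<in> \<Omega>" "rel X B U" for X B U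
    unfolding pick_def using someI_ex[of "\<lambda>X. X \<in> \<Omega> \<and> (\<exists>U. rel X B U)"] that by blast
  have "orbital_cover N F \<epsilon> \<Omega> \<Omega>0"
    unfolding orbital_cover_def
  proof (intro conjI ballI)
    show "\<Omega>0 \<subseteq> \<Omega>" using pick by (auto simp: \<Omega>0_def)
    fix C assume C: "C \<in> \<Omega>"
    obtain B U where B: "B \<in> \<Omega>0'" and U: "rel C B U"
      using cov[OF \<Phi>[OF C]] unfolding rel_def by blast
    define X where "X = pick B"
    obtain U' where X: "X \<in> \<Omega>" and U': "rel X B U'"
      using pick[OF C U] unfolding X_def by blast
    have X0: "X \<in> \<Omega>0" unfolding \<Omega>0_def X_def using B C U by blast
    define u u' v where "u = ncpoly_var U" and "u' = ncpoly_var U'" and "v = u * ncpoly_adj u'"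
    have rep: "mat_rep N u = U" "mat_rep N u' = U'"
      using U U' by (auto simp: u_def u'_def rel_def unitary_mats_def intro!: mat_rep_var)
    have un: "rep_unitary N u" "rep_unitary N u'"
      using U U' by (auto simp: rep_unitary_def rep rel_def)
    then have v: "rep_unitary N v" by (simp add: v_def rep_unitary_mult rep_unitary_adj)
    define y y' where "y = tuple_vars N G (\<Phi> C)" and "y' = tuple_vars N G (\<Phi> X)"
    have rep_y: "mat_rep N (y m) = (if m \<in> G then \<Phi> C m else 0\<^sub>m N N)"
      "mat_rep N (y' m) = (if m \<in> G then \<Phi> X m else 0\<^sub>m N N)" for m
      using \<Omega>'[OF \<Phi>[OF C], of m] \<Omega>'[OF \<Phi>[OF X], of m]
      by (auto simp: y_def y'_def tuple_vars_def intro!: mat_rep_var)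
    have yy': "mat_seminorm N (y m - v * y' m * ncpoly_adj v) \<le> 2 * \<delta>" if m: "m \<in> G" for m
    proof -
      have b: "mat_rep N (ncpoly_var (B m)) = B m"
        using \<Omega>'[of B m] B sub m by (intro mat_rep_var) auto
      have "mat_seminorm N (y m - u * ncpoly_var (B m) * ncpoly_adj u) < \<delta>"
        unfolding mat_norm2_conj[OF N, symmetric] rep b using U m by (simp add: rel_def rep_y)
      moreover have "mat_seminorm N (y' m - u' * ncpoly_var (B m) * ncpoly_adj u') < \<delta>"
        unfolding mat_norm2_conj[OF N, symmetric] rep b using U' m by (simp add: rel_def rep_y)
      ultimately show ?thesis
        using mat_seminorm_conj_triangle[OF N un, of "y m" "y' m" "ncpoly_var (B m)"] by (simp add: v_def)
    qed
    have "mat_norm2 N (C i - mat_rep N v * X i * mat_adjoint (mat_rep N v)) < \<epsilon>" if i: "i \<in> F" for i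
    proof -
      have rc: "mat_rep N (ncpoly_var (C i)) = C i" "mat_rep N (ncpoly_var (X i)) = X i"
        using \<Omega> C X i by (auto intro!: mat_rep_var)
      have rp: "mat_rep N (free.ev y (P i)) = ncpoly_mat N (\<Phi> C) (P i)"
        "mat_rep N (free.ev y' (P i)) = ncpoly_mat N (\<Phi> X) (P i)"
        unfolding mat_rep_ev by (rule ncpoly_mat_cong[OF P[OF i]], simp add: rep_y)+
      define c x p p' where "c = (ncpoly_var (C i) :: complex mat ncpoly)" and "x = (ncpoly_var (X i) :: complex mat ncpoly)"
        and "p = free.ev y (P i)" and "p' = free.ev y' (P i)"
      \<comment> \<open>\<open>C i\<close> is close to \<open>p\<close>, which is close to the conjugate of \<open>p'\<close>, and \<open>p'\<close> is close to \<open>X i\<close>.\<close>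
      have "mat_seminorm N (c - p) \<le> \<epsilon>'" "mat_seminorm N (x - p') \<le> \<epsilon>'"
        using near[OF C i] near[OF X i] by (simp_all add: mat_seminorm_eq[OF N] mat_rep_diff rc rp c_def x_def p_def p'_def)
      moreover have "mat_seminorm N (v * p' * ncpoly_adj v - v * x * ncpoly_adj v) \<le> mat_seminorm N (x - p')"
        using mat_seminorm_conj_le[OF v N, of "p' - x"] m.seminorm_minus_commute[of p' x]
        by (simp add: right_diff_distrib left_diff_distrib)
      moreover have "mat_seminorm N (p - v * p' * ncpoly_adj v) \<le> Lipschitz_const S (P i) * (2 * \<delta>)"
        unfolding p_def p'_def
      proof (rule ev_conj_Lipschitz[OF N S v P[OF i] _ _ yy'])
        show "mat_bounded N S (y m)" "mat_bounded N S (y' m)" if "m \<in> G" for m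
          using \<Omega>'[OF \<Phi>[OF C] that] \<Omega>'[OF \<Phi>[OF X] that] S N that
          by (auto intro!: opnorm_imp_mat_bounded simp: rep_y)
      qed (use \<delta> in auto)
      ultimately have "mat_seminorm N (c - v * x * ncpoly_adj v) < \<epsilon>"
        using m.seminorm_triangle_diff[of c "v * x * ncpoly_adj v" p]
          m.seminorm_triangle_diff[of p "v * x * ncpoly_adj v" "v * p' * ncpoly_adj v"] small[OF i] by linarith
      then show ?thesis
        unfolding mat_norm2_conj[OF N, symmetric] c_def x_def rc .
    qed
    then show "\<exists>B\<in>\<Omega>0. \<exists>U\<in>unitary_mats N. \<forall>i\<in>F. mat_norm2 N (C i - U * B i * mat_adjoint U) < \<epsilon>"
      using X0 v unfolding rep_unitary_def by blast
  qed
  moreover have "finite \<Omega>0" "card \<Omega>0 \<le> card \<Omega>0'"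
    unfolding \<Omega>0_def using fin by (auto intro: order_trans[OF card_image_le] card_mono)
  ultimately show "(INF \<Omega>0\<in>{\<Omega>0. finite \<Omega>0 \<and> orbital_cover N F \<epsilon> \<Omega> \<Omega>0}. enat (card \<Omega>0)) \<le> enat (card \<Omega>0')"
    by (intro INF_lower2[of \<Omega>0]) auto
qed

section \<open>Independence of the generating tuples\<close>

text \<open>
  A Kaplansky density theorem with a single polynomial for all models: \<open>Q\<close> is close to \<open>y\<close> when evaluated
  at \<open>x\<close> and has norm at most \<open>S\<close> at \<^emph>\<open>every\<close> \<open>R\<close>-bounded tuple of matrices. This makes it possible to
  turn microstates with cutoff \<open>R\<close> into microstates with cutoff \<open>S\<close>. Truncate a polynomial \<open>P\<close> that
  approximates \<open>y\<close>; the bound \<open>M\<close> on \<open>P\<close> depends only on \<open>R\<close>, and the error \<open>\<delta>\<^sup>2 / 4 + \<delta>\<^sup>2 / 2\<close> is below \<open>\<delta>\<^sup>2\<close>.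
\<close>

lemma contractive_approximation:
  fixes x :: "'i \<Rightarrow> 'b::cstar_algebra"
  assumes T: "T \<subseteq> tracial_states UNIV" and gen: "generates UNIV T K x"
    and x: "\<And>i. i \<in> K \<Longrightarrow> norm (x i) \<le> R" and R: "0 < R"
    and y: "norm y \<le> S" and S: "0 < S" and \<delta>: "0 < \<delta>"
  shows "\<exists>Q\<in>ncpolys K.
    (\<forall>\<tau>\<in>T. trace_seminorm \<tau> (cstar.ev x Q - y) \<le> \<delta> \<and> positive_functional.bounded_by adj \<tau> S (cstar.ev x Q)) \<and>
    (\<forall>N X. X \<in> K \<rightarrow>\<^sub>E carrier_mat N N \<longrightarrow> (\<forall>i\<in>K. mat_opnorm (X i) \<le> R) \<longrightarrow>
      mat_opnorm (ncpoly_mat N X Q) \<le> S)"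
proof -
  have "restrict_functionals UNIV T = T" by (auto simp: restrict_def)
  then have gen': "generates UNIV (restrict_functionals UNIV T) K x" using gen by simp
  have "unital_cstar_subalgebra (UNIV :: 'b set)" by (simp add: unital_cstar_subalgebra_def)
  from generator_approximation[OF T this gen' UNIV_I half_gt_zero[OF \<delta>]]
  obtain P where P: "P \<in> ncpolys K" "\<And>\<tau>. \<tau> \<in> T \<Longrightarrow> trace_seminorm \<tau> (y - cstar.ev x P) < \<delta> / 2"
    by blast
  \<comment> \<open>Adding 1 makes the bound positive.\<close>
  define M where "M = ncpoly_bound R P + 1"
  have "0 \<le> ncpoly_bound R P"
    unfolding ncpoly_bound_def using R by (intro sum_nonneg) auto
  then have M: "0 < M" "ncpoly_bound R P \<le> M" by (auto simp: M_def)
  obtain u v where uv: "cutoff_pair S (M\<^sup>2) (\<delta>\<^sup>2 / 2) u v"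
    using cutoff_pair_exists[OF S, of "M\<^sup>2" "\<delta>\<^sup>2 / 2"] M \<delta> by (metis half_gt_zero zero_less_power)
  define Q where "Q = free.cutoff u v P"
  show ?thesis
  proof (intro bexI[of _ Q] conjI ballI allI impI)
    show Q: "Q \<in> ncpolys K" unfolding Q_def by (rule ncpolys_cutoff[OF P(1)])
    fix \<tau> assume \<tau>: "\<tau> \<in> T"
    then have \<tau>': "\<tau> \<in> tracial_states UNIV" using T by blast
    interpret t: tracial_functional adj scaleC \<tau> by (rule tracial_state_functional) fact
    have nb: "t.bounded_by r z" if "norm z \<le> r" for z r
      using t.bounded_by_mono[OF tracial_state_bounded_by_norm[OF \<tau>'] that] .
    have b: "t.bounded_by M (cstar.ev x P)"
      by (rule t.bounded_by_mono[OF t.bounded_by_ev[OF _ _ P(1)] M(2)]) (use R x nb in auto)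
    show "t.bounded_by S (cstar.ev x Q)"
      unfolding Q_def cstar.ev_cutoff using t.bounded_by_cutoff[OF b M(1) _ uv] S by simp
    have "(t.seminorm (cstar.ev x Q - y))\<^sup>2 \<le> (t.seminorm (cstar.ev x P - y))\<^sup>2 + \<delta>\<^sup>2 / 2"
      unfolding Q_def cstar.ev_cutoff using t.cutoff_contraction[OF b M(1) _ uv nb[OF y]] S by simp
    also have "\<dots> \<le> (\<delta> / 2)\<^sup>2 + \<delta>\<^sup>2 / 2"
      using P(2)[OF \<tau>] t.seminorm_minus_commute[of y] by (intro add_right_mono power_mono) auto
    also have "\<dots> \<le> \<delta>\<^sup>2" by (simp add: power2_eq_square)
    finally show "t.seminorm (cstar.ev x Q - y) \<le> \<delta>" by (rule power2_le_imp_le) (use \<delta> in simp)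
  next
    fix N and X :: "'i \<Rightarrow> complex mat"
    assume X: "X \<in> K \<rightarrow>\<^sub>E carrier_mat N N" and XR: "\<forall>i\<in>K. mat_opnorm (X i) \<le> R"
    let ?x = "tuple_vars N K X"
    have "vector_bounded N w S (free.ev ?x Q)" if w: "w \<in> carrier_vec N" for w
    proof -
      interpret v: positive_functional ncpoly_adj ncpoly_scale "vector_state N w"
        by (rule vector_state_functional) fact
      have "v.bounded_by M (free.ev ?x P)"
        by (rule v.bounded_by_mono[OF v.bounded_by_ev[OF _ _ P(1)] M(2)])
          (use R XR w in \<open>auto intro!: opnorm_imp_vector_bounded simp: mat_rep_tuple_vars[OF X]\<close>)
      then show ?thesis
        unfolding Q_def free.ev_cutoff using v.bounded_by_cutoff[OF _ M(1) _ uv] S by simp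
    qed
    then have "mat_opnorm (mat_rep N (free.ev ?x Q)) \<le> S"
      by (rule vector_bounded_imp_opnorm) (use S in auto)
    then show "mat_opnorm (ncpoly_mat N X Q) \<le> S"
      using mat_rep_ev_tuple_vars[OF X] ncpolys_cutoff[OF P(1)] by (simp add: Q_def)
  qed
qed

lemma log_enat_mono: "m \<le> n \<Longrightarrow> log_enat m \<le> log_enat n"
  by (cases m; cases n) (auto simp: log_enat_def)

definition subst_tuple :: "nat \<Rightarrow> 'm set \<Rightarrow> ('m \<Rightarrow> 'n ncpoly) \<Rightarrow> ('n \<Rightarrow> complex mat) \<Rightarrow> 'm \<Rightarrow> complex mat" where
  "subst_tuple N K' Q X = (\<lambda>m\<in>K'. ncpoly_mat N X (Q m))"

lemma ncpoly_mat_subst_tuple: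
  assumes X: "X \<in> K \<rightarrow>\<^sub>E carrier_mat N N" and Q: "\<And>m. m \<in> K' \<Longrightarrow> Q m \<in> ncpolys K" and P: "P \<in> ncpolys K'"
  shows "ncpoly_mat N (subst_tuple N K' Q X) P = ncpoly_mat N X (free.ev Q P)"
proof -
  have "ncpoly_mat N X (free.ev Q P) = mat_rep N (free.ev (tuple_vars N K X) (free.ev Q P))"
    by (rule mat_rep_ev_tuple_vars[OF X ncpolys_ev[OF P Q], symmetric])
  also have "\<dots> = ncpoly_mat N (\<lambda>m. mat_rep N (free.ev (tuple_vars N K X) (Q m))) P"
    unfolding free.ev_ev by (rule mat_rep_ev)
  also have "\<dots> = ncpoly_mat N (subst_tuple N K' Q X) P"
    by (rule ncpoly_mat_cong[OF P]) (simp add: subst_tuple_def mat_rep_ev_tuple_vars[OF X Q])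
  finally show ?thesis by simp
qed

text \<open>
  The heart of the comparison. Polynomials \<open>Q\<close> express \<open>y\<close> in terms of \<open>x\<close> within \<open>\<eta>\<close>, and \<open>P\<close> expresses
  finitely many coordinates of \<open>x\<close> in terms of \<open>y\<close>. The map \<open>X \<mapsto> Q(X)\<close> sends microstates of \<open>x\<close> to
  microstates of \<open>y\<close>, and \<open>X\<close> is nearly \<open>P(Q(X))\<close> on \<open>F\<close>; both facts are statements about finitely many
  moments of \<open>X\<close>, and \<open>\<O>\<close> is chosen to control exactly these moments. Then covers are transported.
\<close>

lemma orbital_covering_number_microstates_le:
  fixes x :: "'n \<Rightarrow> 'b::cstar_algebra" and y :: "'m \<Rightarrow> 'b"
  assumes T: "T \<subseteq> tracial_states UNIV" and Tc: "compactin (product_topology (\<lambda>_. euclidean) UNIV) T"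
    and R: "0 < R" and S: "0 < S"
    and x: "\<And>i. i \<in> K \<Longrightarrow> norm (x i) \<le> R" and y: "\<And>m. m \<in> K' \<Longrightarrow> norm (y m) \<le> S"
    and gen: "generates UNIV T K x"
    and F: "finite F" "F \<subseteq> K" and G: "G \<subseteq> K'"
    and P: "\<And>i. i \<in> F \<Longrightarrow> P i \<in> ncpolys G"
    and xP: "\<And>i \<tau>. i \<in> F \<Longrightarrow> \<tau> \<in> T \<Longrightarrow> trace_seminorm \<tau> (x i - cstar.ev y (P i)) \<le> \<epsilon>"
    and \<epsilon>: "0 < \<epsilon>" and \<delta>: "0 < \<delta>" and small: "\<And>i. i \<in> F \<Longrightarrow> Lipschitz_const S (P i) * \<delta> \<le> \<epsilon>"
    and O': "openin (law_topology S K') \<O>'" "laws_of T K' y \<subseteq> \<O>'"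
  obtains \<O> where "openin (law_topology R K) \<O>" "laws_of T K x \<subseteq> \<O>"
    "\<And>N. 0 < N \<Longrightarrow> orbital_covering_number N F (10 * \<epsilon>) (microstates N R K \<O>)
       \<le> orbital_covering_number N G \<delta> (microstates N S K' \<O>')"
proof -
  obtain W \<kappa> where W: "finite W" "W \<subseteq> ncpolys K'" "0 < \<kappa>"
    and in_O': "\<And>\<tau> \<phi>. \<tau> \<in> T \<Longrightarrow> \<phi> \<in> tracial_laws S K' \<Longrightarrow>
       \<forall>P\<in>W. cmod (\<phi> P - \<tau> (cstar.ev y P)) < \<kappa> \<Longrightarrow> \<phi> \<in> \<O>'"
    using law_neighbourhood[OF Tc O'] by blast
  define L where "L = (\<Sum>p\<in>W. Lipschitz_const S p)"
  have L: "0 \<le> L" "\<And>p. p \<in> W \<Longrightarrow> Lipschitz_const S p \<le> L"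
    unfolding L_def using W(1) by (auto intro!: sum_nonneg member_le_sum Lipschitz_const_nonneg)
  define \<eta> where "\<eta> = min \<delta> (\<kappa> / (2 * (L + 1)))"
  have \<eta>: "0 < \<eta>" "\<eta> \<le> \<delta>" "\<eta> \<le> \<kappa> / (2 * (L + 1))" using \<delta> W(3) L(1) by (auto simp: \<eta>_def)
  have LW: "Lipschitz_const S p * \<eta> < \<kappa> / 2" if "p \<in> W" for p
  proof -
    have "Lipschitz_const S p * \<eta> \<le> L * (\<kappa> / (2 * (L + 1)))"
      using L \<eta> that Lipschitz_const_nonneg by (intro mult_mono) auto
    also have "\<dots> < \<kappa> / 2" using L(1) W(3) by (simp add: field_simps)
    finally show ?thesis .
  qed
  define good where "good m q \<longleftrightarrow> q \<in> ncpolys K \<and>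
    (\<forall>\<tau>\<in>T. trace_seminorm \<tau> (cstar.ev x q - y m) \<le> \<eta> \<and> positive_functional.bounded_by adj \<tau> S (cstar.ev x q)) \<and>
    (\<forall>N X. X \<in> K \<rightarrow>\<^sub>E carrier_mat N N \<longrightarrow> (\<forall>i\<in>K. mat_opnorm (X i) \<le> R) \<longrightarrow>
      mat_opnorm (ncpoly_mat N X q) \<le> S)" for m q
  have "\<exists>q. good m q" if "m \<in> K'" for m
    using contractive_approximation[OF T gen x R y[OF that] S \<eta>(1)] unfolding good_def by blast
  then obtain Q where good: "\<And>m. m \<in> K' \<Longrightarrow> good m (Q m)" by metis
  then have Q: "\<And>m. m \<in> K' \<Longrightarrow> Q m \<in> ncpolys K"
    and Qy: "\<And>m \<tau>. m \<in> K' \<Longrightarrow> \<tau> \<in> T \<Longrightarrow> trace_seminorm \<tau> (cstar.ev x (Q m) - y m) \<le> \<eta>"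
    and QS: "\<And>m \<tau>. m \<in> K' \<Longrightarrow> \<tau> \<in> T \<Longrightarrow> positive_functional.bounded_by adj \<tau> S (cstar.ev x (Q m))"
    and QX: "\<And>m N X. m \<in> K' \<Longrightarrow> X \<in> K \<rightarrow>\<^sub>E carrier_mat N N \<Longrightarrow> (\<forall>i\<in>K. mat_opnorm (X i) \<le> R) \<Longrightarrow>
        mat_opnorm (ncpoly_mat N X (Q m)) \<le> S"
    unfolding good_def by blast+
  have PK: "P i \<in> ncpolys K'" if "i \<in> F" for i
    using P[OF that] ncpolys_mono[OF G] by blast
  have evQ: "free.ev Q p \<in> ncpolys K" if "p \<in> ncpolys K'" for p
    using that Q by (rule ncpolys_ev)
  define D where "D i = ncpoly_var i - free.ev Q (P i)" for i
  have D: "D i \<in> ncpolys K" if "i \<in> F" for i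
    unfolding D_def using that F(2) by (intro ncpolys_diff evQ PK) auto
  \<comment> \<open>The moments that decide whether \<open>Q(X)\<close> has its law in \<open>\<O>'\<close>, and the distance from \<open>X i\<close> to \<open>P(Q(X))\<close>.\<close>
  define V where "V = free.ev Q ` W \<union> (\<lambda>i. ncpoly_adj (D i) * D i) ` F"
  define \<kappa>' where "\<kappa>' = min (\<kappa> / 2) (\<epsilon>\<^sup>2)"
  have \<kappa>': "0 < \<kappa>'" "\<kappa>' \<le> \<kappa> / 2" "\<kappa>' \<le> \<epsilon>\<^sup>2" using W(3) \<epsilon> by (auto simp: \<kappa>'_def)
  have V: "finite V" "V \<subseteq> ncpolys K"
  proof -
    show "finite V" unfolding V_def using W(1) F(1) by simp
    show "V \<subseteq> ncpolys K"
      unfolding V_def using W(2) Q D by (auto intro!: ncpolys_mult ncpolys_adj ncpolys_ev)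
  qed
  have subst_close: "trace_seminorm \<tau> (cstar.ev (\<lambda>m. cstar.ev x (Q m)) p - cstar.ev y p) \<le> Lipschitz_const S p * \<eta>"
    if "\<tau> \<in> T" "p \<in> ncpolys K'" for \<tau> p
  proof -
    have \<tau>': "\<tau> \<in> tracial_states UNIV" using T that by blast
    interpret t: tracial_functional adj scaleC \<tau> by (rule tracial_state_functional) fact
    show ?thesis
      by (rule t.ev_Lipschitz[OF that(2)])
        (use QS Qy that \<eta> y t.bounded_by_mono[OF tracial_state_bounded_by_norm[OF \<tau>']] in auto)
  qed
  define \<O> where "\<O> = law_tube R K T x V \<kappa>'"
  show thesis
  proof (rule that[of \<O>])
    show "openin (law_topology R K) \<O>" unfolding \<O>_def by (rule openin_law_tube[OF V])
    show "laws_of T K x \<subseteq> \<O>" unfolding \<O>_def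
      by (rule laws_of_subset_law_tube[OF T x V(2) \<kappa>'(1)]) (use R in auto)
    fix N :: nat assume N: "0 < N"
    interpret m: tracial_functional ncpoly_adj ncpoly_scale "mat_trace N"
      by (rule mat_trace_functional) fact
    let ?\<Omega> = "microstates N R K \<O>" and ?\<Omega>' = "microstates N S K' \<O>'"
    let ?\<Phi> = "subst_tuple N K' Q"
    have mem: "X \<in> K \<rightarrow>\<^sub>E carrier_mat N N \<and> (\<forall>i\<in>K. mat_opnorm (X i) \<le> R) \<and> matrix_law N K X \<in> \<O>"
      if "X \<in> ?\<Omega>" for X using that by (simp add: microstates_def)
    have \<Phi>c: "?\<Phi> X \<in> K' \<rightarrow>\<^sub>E carrier_mat N N" for X :: "'n \<Rightarrow> complex mat"
      by (auto simp: subst_tuple_def ncpoly_mat_def)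
    have subst: "ncpoly_mat N (?\<Phi> X) p = ncpoly_mat N X (free.ev Q p)"
      if "X \<in> ?\<Omega>" "p \<in> ncpolys K'" for X p
      by (rule ncpoly_mat_subst_tuple[OF _ Q that(2)]) (use mem[OF that(1)] in auto)
    have law: "matrix_law N K' (?\<Phi> X) p = matrix_law N K X (free.ev Q p)"
      if "X \<in> ?\<Omega>" "p \<in> ncpolys K'" for X p
      using evQ[OF that(2)] that(2) by (simp add: matrix_law_def subst[OF that])
    have \<Phi>: "?\<Phi> X \<in> ?\<Omega>'" if X: "X \<in> ?\<Omega>" for X
    proof -
      have op: "mat_opnorm (?\<Phi> X m) \<le> S" if "m \<in> K'" for m
        using QX[OF that] mem[OF X] that by (simp add: subst_tuple_def)
      obtain \<tau> where \<tau>: "\<tau> \<in> T" "\<And>p. p \<in> V \<Longrightarrow> cmod (matrix_law N K X p - \<tau> (cstar.ev x p)) < \<kappa>'"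
        using mem[OF X] unfolding \<O>_def law_tube_def by blast
      have \<tau>': "\<tau> \<in> tracial_states UNIV" using T \<tau> by blast
      interpret t: tracial_functional adj scaleC \<tau> by (rule tracial_state_functional) fact
      have "matrix_law N K' (?\<Phi> X) \<in> \<O>'"
      proof (intro in_O'[OF \<tau>(1)] ballI)
        show "matrix_law N K' (?\<Phi> X) \<in> tracial_laws S K'"
          by (rule matrix_law_in_tracial_laws[OF \<Phi>c]) (use op S N in auto)
        fix p assume p: "p \<in> W"
        then have pK: "p \<in> ncpolys K'" using W(2) by blast
        have "cmod (matrix_law N K' (?\<Phi> X) p - \<tau> (cstar.ev x (free.ev Q p))) < \<kappa> / 2"
          using \<tau>(2)[of "free.ev Q p"] p \<kappa>' unfolding law[OF X pK] V_def by fastforce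
        moreover have "cmod (\<tau> (cstar.ev x (free.ev Q p)) - \<tau> (cstar.ev y p)) < \<kappa> / 2"
          using t.l_le_seminorm[of "cstar.ev x (free.ev Q p) - cstar.ev y p"] subst_close[OF \<tau>(1) pK] LW[OF p]
          by (simp add: t.l_diff cstar.ev_ev)
        ultimately show "cmod (matrix_law N K' (?\<Phi> X) p - \<tau> (cstar.ev y p)) < \<kappa>"
          using norm_diff_triangle_less[of _ _ "\<kappa> / 2" _ "\<kappa> / 2"] by fastforce
      qed
      then show ?thesis using \<Phi>c op by (simp add: microstates_def)
    qed
    show "orbital_covering_number N F (10 * \<epsilon>) ?\<Omega> \<le> orbital_covering_number N G \<delta> ?\<Omega>'"
    proof (rule orbital_covering_number_transport[where S=S and \<epsilon>'="3 * \<epsilon>" and P=P and \<Phi>="?\<Phi>"])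
      show "0 < N" "0 \<le> S" "0 < \<delta>" using N S \<delta> by auto
      show "X i \<in> carrier_mat N N" if "X \<in> ?\<Omega>" "i \<in> F" for X i
        using mem[OF that(1)] that(2) F(2) by auto
      show "?\<Phi> X \<in> ?\<Omega>'" if "X \<in> ?\<Omega>" for X by (rule \<Phi>[OF that])
      show "Y m \<in> carrier_mat N N \<and> mat_opnorm (Y m) \<le> S" if "Y \<in> ?\<Omega>'" "m \<in> G" for Y m
        using that G by (auto simp: microstates_def)
      show "P i \<in> ncpolys G" if "i \<in> F" for i by (rule P[OF that])
      show "2 * (3 * \<epsilon>) + Lipschitz_const S (P i) * (2 * \<delta>) < 10 * \<epsilon>" if "i \<in> F" for i
      proof -
        have "Lipschitz_const S (P i) * (2 * \<delta>) = 2 * (Lipschitz_const S (P i) * \<delta>)" by simp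
        then show ?thesis using small[OF that] \<epsilon> by linarith
      qed
      fix X i assume X: "X \<in> ?\<Omega>" and i: "i \<in> F"
      let ?x = "tuple_vars N K X"
      have Xc: "X \<in> K \<rightarrow>\<^sub>E carrier_mat N N" using mem[OF X] by blast
      obtain \<tau> where \<tau>: "\<tau> \<in> T" "\<And>p. p \<in> V \<Longrightarrow> cmod (matrix_law N K X p - \<tau> (cstar.ev x p)) < \<kappa>'"
        using mem[OF X] unfolding \<O>_def law_tube_def by blast
      have \<tau>': "\<tau> \<in> tracial_states UNIV" using T \<tau> by blast
      interpret t: tracial_functional adj scaleC \<tau> by (rule tracial_state_functional) fact
      have rep: "mat_rep N (free.ev ?x (D i)) = X i - ncpoly_mat N (?\<Phi> X) (P i)"
        using i F(2)
        by (auto simp: D_def free.ev_diff mat_rep_diff mat_rep_tuple_vars[OF Xc]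
            mat_rep_ev_tuple_vars[OF Xc evQ[OF PK[OF i]]] subst[OF X PK[OF i]])
      have "t.seminorm (cstar.ev x (D i)) \<le> 2 * \<epsilon>"
      proof -
        have "t.seminorm (cstar.ev x (D i)) = t.seminorm (x i - cstar.ev (\<lambda>m. cstar.ev x (Q m)) (P i))"
          by (simp add: D_def cstar.ev_diff cstar.ev_ev)
        also have "\<dots> \<le> t.seminorm (x i - cstar.ev y (P i)) + t.seminorm (cstar.ev (\<lambda>m. cstar.ev x (Q m)) (P i) - cstar.ev y (P i))"
          using t.seminorm_triangle_diff[of "x i" "cstar.ev (\<lambda>m. cstar.ev x (Q m)) (P i)" "cstar.ev y (P i)"]
          by (simp add: t.seminorm_minus_commute)
        also have "\<dots> \<le> \<epsilon> + Lipschitz_const S (P i) * \<eta>"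
          by (intro add_mono xP[OF i \<tau>(1)] subst_close[OF \<tau>(1) PK[OF i]])
        also have "Lipschitz_const S (P i) * \<eta> \<le> Lipschitz_const S (P i) * \<delta>"
          by (intro mult_left_mono \<eta> Lipschitz_const_nonneg)
        finally show ?thesis using small[OF i] by simp
      qed
      then have n2: "(t.seminorm (cstar.ev x (D i)))\<^sup>2 \<le> (2 * \<epsilon>)\<^sup>2" by (intro power_mono) auto
      let ?p = "ncpoly_adj (D i) * D i"
      have pV: "?p \<in> V" using i by (auto simp: V_def)
      then have pK: "?p \<in> ncpolys K" using V(2) by blast
      have "(m.seminorm (free.ev ?x (D i)))\<^sup>2 = Re (matrix_law N K X ?p)"
        using pK by (simp add: m.seminorm_sq matrix_law_eq[OF Xc] free.ev_mult free.ev_adj)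
      also have "\<dots> \<le> Re (\<tau> (cstar.ev x ?p)) + \<kappa>'"
        using \<tau>(2)[OF pV] abs_Re_le_cmod[of "matrix_law N K X ?p - \<tau> (cstar.ev x ?p)"] by simp
      also have "Re (\<tau> (cstar.ev x ?p)) = (t.seminorm (cstar.ev x (D i)))\<^sup>2"
        by (simp add: t.seminorm_sq cstar.ev_mult cstar.ev_adj)
      also have "(t.seminorm (cstar.ev x (D i)))\<^sup>2 + \<kappa>' \<le> (2 * \<epsilon>)\<^sup>2 + \<epsilon>\<^sup>2" using n2 \<kappa>' by simp
      also have "\<dots> \<le> (3 * \<epsilon>)\<^sup>2" by (simp add: power2_eq_square)
      finally have "m.seminorm (free.ev ?x (D i)) \<le> 3 * \<epsilon>"
        by (rule power2_le_imp_le) (use \<epsilon> in simp)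
      then show "mat_norm2 N (X i - ncpoly_mat N (?\<Phi> X) (P i)) \<le> 3 * \<epsilon>"
        by (simp add: mat_seminorm_eq[OF N] rep)
    qed
  qed
qed

text \<open>
  Since \<open>c\<close> generates \<open>A\<close>, the polynomials \<open>P\<close> for the entries of \<open>a\<close> involve finitely many entries of
  \<open>c\<close> and no entry of \<open>d\<close>, so the cover of the target is measured in coordinates of \<open>c\<close>, as the
  definition of the entropy requires.
\<close>

lemma one_bounded_entropy_le:
  fixes A :: "'b::cstar_algebra set" and T :: "('b \<Rightarrow> complex) set"
    and a :: "'i \<Rightarrow> 'b" and b :: "'j \<Rightarrow> 'b" and c :: "'k \<Rightarrow> 'b" and d :: "'l \<Rightarrow> 'b"
  assumes incl: "tracially_complete_inclusion A T"
    and R: "R > 0" and S: "S > 0"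
    and a: "bounded_tuple R I a" and b: "bounded_tuple R J b" and aA: "a ` I \<subseteq> A"
    and gen_ab: "generates UNIV T (I <+> J) (case_sum a b)"
    and c: "bounded_tuple S I' c" and d: "bounded_tuple S J' d"
    and gen_c: "generates A (restrict_functionals A T) I' c"
  shows "one_bounded_entropy T R I a J b \<le> one_bounded_entropy T S I' c J' d"
proof -
  let ?x = "case_sum a b" and ?y = "case_sum c d" and ?K = "I <+> J" and ?K' = "I' <+> J'"
  let ?f = "\<lambda>F \<epsilon> R K \<O>. limsup (\<lambda>N. ereal (1 / (real N)\<^sup>2) * log_enat (orbital_covering_number N F \<epsilon> (microstates N R K \<O>)))"
  let ?h = "\<lambda>F \<epsilon>. INF \<O>\<in>{\<O>. openin (law_topology R ?K) \<O> \<and> laws_of T ?K ?x \<subseteq> \<O>}. ?f (Inl ` F) \<epsilon> R ?K \<O>"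
  let ?h' = "\<lambda>F \<epsilon>. INF \<O>\<in>{\<O>. openin (law_topology S ?K') \<O> \<and> laws_of T ?K' ?y \<subseteq> \<O>}. ?f (Inl ` F) \<epsilon> S ?K' \<O>"
  have key: "\<exists>H \<delta>. finite H \<and> H \<subseteq> I' \<and> 0 < \<delta> \<and> ?h F \<epsilon>0 \<le> ?h' H \<delta>"
    if F: "finite F" "F \<subseteq> I" and \<epsilon>0: "0 < \<epsilon>0" for F \<epsilon>0
  proof -
    have T: "T \<subseteq> tracial_states UNIV" "compactin (product_topology (\<lambda>_. euclidean) UNIV) T"
      and A: "unital_cstar_subalgebra A"
      using incl by (auto simp: tracially_complete_inclusion_def tracially_complete_def)
    \<comment> \<open>The ten parts: 3 for each of two recoveries of \<open>X i\<close>, 2 for the Lipschitz estimate, and a margin.\<close>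
    define \<epsilon> where "\<epsilon> = \<epsilon>0 / 10"
    have \<epsilon>: "0 < \<epsilon>" "\<epsilon>0 = 10 * \<epsilon>" using \<epsilon>0 by (auto simp: \<epsilon>_def)
    have gen_c': "generates A (restrict_functionals A T) (Inl ` I') ?y"
      using gen_c by (simp add: generates_def image_image)
    have "\<exists>P G. finite G \<and> G \<subseteq> I' \<and> P \<in> ncpolys (Inl ` G) \<and> (\<forall>\<tau>\<in>T. trace_seminorm \<tau> (a i - cstar.ev ?y P) \<le> \<epsilon>)"
      if "i \<in> F" for i
    proof -
      have "a i \<in> A" using aA F(2) that by blast
      from generator_approximation[OF T(1) A gen_c' this \<epsilon>(1)]
      obtain P where P: "P \<in> ncpolys (Inl ` I')" "\<And>\<tau>. \<tau> \<in> T \<Longrightarrow> trace_seminorm \<tau> (a i - cstar.ev ?y P) < \<epsilon>"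
        by blast
      obtain H where H: "finite H" "H \<subseteq> Inl ` I'" "P \<in> ncpolys H"
        by (rule ncpolys_finite_vars[OF P(1)])
      then obtain G where "G \<subseteq> I'" "finite G" "H = Inl ` G"
        using finite_subset_image[OF H(1,2)] by blast
      then show ?thesis using H P(2) less_imp_le by blast
    qed
    then obtain P G where PG: "\<And>i. i \<in> F \<Longrightarrow> finite (G i) \<and> G i \<subseteq> I' \<and> P i \<in> ncpolys (Inl ` G i)"
      and aP: "\<And>i \<tau>. i \<in> F \<Longrightarrow> \<tau> \<in> T \<Longrightarrow> trace_seminorm \<tau> (a i - cstar.ev ?y (P i)) \<le> \<epsilon>"
      by metis
    define H where "H = (\<Union>i\<in>F. G i)"
    have H: "finite H" "H \<subseteq> I'" using PG F(1) by (auto simp: H_def)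
    have PH: "P i \<in> ncpolys (Inl ` H)" if "i \<in> F" for i
      using PG[OF that] ncpolys_mono[of "Inl ` G i" "Inl ` H"] that by (auto simp: H_def)
    \<comment> \<open>Coordinates of \<open>b\<close> are not covered; the value \<open>0\<close> for them is arbitrary.\<close>
    define P' :: "'i + 'j \<Rightarrow> ('k + 'l) ncpoly" where "P' = case_sum P (\<lambda>_. 0)"
    define L where "L = (\<Sum>i\<in>F. Lipschitz_const S (P i))"
    have L: "0 \<le> L" "\<And>i. i \<in> F \<Longrightarrow> Lipschitz_const S (P i) \<le> L"
      unfolding L_def using F(1) by (auto intro!: sum_nonneg member_le_sum Lipschitz_const_nonneg)
    define \<delta> where "\<delta> = \<epsilon> / (L + 1)"
    have \<delta>: "0 < \<delta>" using \<epsilon> L by (simp add: \<delta>_def)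
    have small: "Lipschitz_const S (P i) * \<delta> \<le> \<epsilon>" if "i \<in> F" for i
    proof -
      have "Lipschitz_const S (P i) * \<delta> \<le> L * \<delta>" using L(2)[OF that] \<delta> by (intro mult_right_mono) auto
      also have "\<dots> \<le> \<epsilon>" using L(1) \<epsilon> by (simp add: \<delta>_def field_simps)
      finally show ?thesis .
    qed
    have "?h F \<epsilon>0 \<le> ?h' H \<delta>"
    proof (rule INF_greatest, clarify)
      fix \<O>' assume O': "openin (law_topology S ?K') \<O>'" "laws_of T ?K' ?y \<subseteq> \<O>'"
      obtain \<O> where O: "openin (law_topology R ?K) \<O>" "laws_of T ?K ?x \<subseteq> \<O>"
        and le: "\<And>N. 0 < N \<Longrightarrow> orbital_covering_number N (Inl ` F) (10 * \<epsilon>) (microstates N R ?K \<O>)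
         \<le> orbital_covering_number N (Inl ` H) \<delta> (microstates N S ?K' \<O>')"
      proof (rule orbital_covering_number_microstates_le[OF T R S _ _ gen_ab _ _ _ _ _ \<epsilon>(1) \<delta> _ O',
            of "Inl ` F" "Inl ` H" P'])
        show "norm (?x i) \<le> R" if "i \<in> ?K" for i using that a b by (auto simp: bounded_tuple_def)
        show "norm (?y m) \<le> S" if "m \<in> ?K'" for m using that c d by (auto simp: bounded_tuple_def)
        show "finite (Inl ` F)" "Inl ` F \<subseteq> ?K" "Inl ` H \<subseteq> ?K'" using F H by auto
      qed (use PH aP small in \<open>auto simp: P'_def\<close>)
      have "?f (Inl ` F) \<epsilon>0 R ?K \<O> \<le> ?f (Inl ` H) \<delta> S ?K' \<O>'"
      proof (rule Limsup_mono)
        show "\<forall>\<^sub>F N in sequentially. ereal (1 / (real N)\<^sup>2) * log_enat (orbital_covering_number N (Inl ` F) \<epsilon>0 (microstates N R ?K \<O>))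
          \<le> ereal (1 / (real N)\<^sup>2) * log_enat (orbital_covering_number N (Inl ` H) \<delta> (microstates N S ?K' \<O>'))"
          using eventually_gt_at_top[of 0]
          by eventually_elim (auto intro!: ereal_mult_left_mono log_enat_mono simp: le \<epsilon>(2))
      qed
      then show "?h F \<epsilon>0 \<le> ?f (Inl ` H) \<delta> S ?K' \<O>'"
        using O by (intro INF_lower2[of \<O>]) auto
    qed
    then show ?thesis using H \<delta> by blast
  qed
  have "(SUP (F, \<epsilon>)\<in>{F. finite F \<and> F \<subseteq> I} \<times> {0<..}. ?h F \<epsilon>) \<le> (SUP (F, \<epsilon>)\<in>{F. finite F \<and> F \<subseteq> I'} \<times> {0<..}. ?h' F \<epsilon>)"
  proof (rule SUP_mono)
    fix p assume "p \<in> {F. finite F \<and> F \<subseteq> I} \<times> {0::real<..}"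
    then obtain F \<epsilon>0 where p: "p = (F, \<epsilon>0)" "finite F" "F \<subseteq> I" "0 < \<epsilon>0" by auto
    obtain H \<delta> where "finite H" "H \<subseteq> I'" "0 < \<delta>" "?h F \<epsilon>0 \<le> ?h' H \<delta>" using key[OF p(2-4)] by blast
    then show "\<exists>q\<in>{F. finite F \<and> F \<subseteq> I'} \<times> {0<..}. (case p of (F, \<epsilon>) \<Rightarrow> ?h F \<epsilon>) \<le> (case q of (F, \<epsilon>) \<Rightarrow> ?h' F \<epsilon>)"
      unfolding p(1) by (intro bexI[of _ "(H, \<delta>)"]) (simp_all only: prod.case mem_Times_iff fst_conv snd_conv mem_Collect_eq greaterThan_iff simp_thms)
  qed
  then show ?thesis unfolding one_bounded_entropy_def .
qed

theorem theorem5p1: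
  fixes A :: "'b::cstar_algebra set"
    and T :: "('b \<Rightarrow> complex) set"
    and R S :: real
    and I\<^sub>1 :: "'i set" and J\<^sub>1 :: "'j set" and I\<^sub>2 :: "'k set" and J\<^sub>2 :: "'l set"
    and a :: "'i \<Rightarrow> 'b" and b :: "'j \<Rightarrow> 'b" and c :: "'k \<Rightarrow> 'b" and d :: "'l \<Rightarrow> 'b"
  assumes "tracially_complete_inclusion A T"
    and "R > 0" and "S > 0"
    and "bounded_tuple R I\<^sub>1 a" and "bounded_tuple R J\<^sub>1 b"
    and "generates A (restrict_functionals A T) I\<^sub>1 a"
    and "generates UNIV T (I\<^sub>1 <+> J\<^sub>1) (case_sum a b)"
    and "bounded_tuple S I\<^sub>2 c" and "bounded_tuple S J\<^sub>2 d"
    and "generates A (restrict_functionals A T) I\<^sub>2 c"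
    and "generates UNIV T (I\<^sub>2 <+> J\<^sub>2) (case_sum c d)"
  shows "one_bounded_entropy T R I\<^sub>1 a J\<^sub>1 b = one_bounded_entropy T S I\<^sub>2 c J\<^sub>2 d"
proof (rule antisym)
  show "one_bounded_entropy T R I\<^sub>1 a J\<^sub>1 b \<le> one_bounded_entropy T S I\<^sub>2 c J\<^sub>2 d"
    using assms by (intro one_bounded_entropy_le[of A]) (auto simp: generates_def)
  show "one_bounded_entropy T S I\<^sub>2 c J\<^sub>2 d \<le> one_bounded_entropy T R I\<^sub>1 a J\<^sub>1 b"
    using assms by (intro one_bounded_entropy_le[of A]) (auto simp: generates_def)
qed

end
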